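(* Let $T>0$, $u_0\in L^2(\mathbb{R}^d)$, and let $q\in L^\infty(\mathbb{R}^d)$ be non-negative. Consider the Cauchy problem $$u_t(t,x)-\Delta u(t,x)-q(x)u(t,x)=0,\quad(t,x)\in(0,T)\times\mathbb{R}^d,\qquad u(0,x)=u_0(x),$$ and let $u$ be its classical solution. Let $(u_\varepsilon)_\varepsilon$ be a very weak solution of this problem. Then, for any regularising families $(q_\varepsilon)_\varepsilon$ and $(u_{0,\varepsilon})_\varepsilon$ of $q$ and $u_0$, the net $(u_\varepsilon)_\varepsilon$ converges in $L^2$ as $\varepsilon\to0$ to the classical solution, i.e. $\Vert u_\varepsilon(t,\cdot)-u(t,\cdot)\Vert_{L^2}\to0$ as $\varepsilon\to0$ for $t\in[0,T]$.
   Context: The classical solution is the unique solution $u\in C([0,T];L^2(\mathbb{R}^d))$ of the Cauchy problem. Regularising families: $q_\varepsilon=q\ast\psi_\varepsilon$, $u_{0,\varepsilon}=u_0\ast\psi_\varepsilon$, where $\psi\in C_0^\infty(\mathbb{R}^d)$, $\psi\ge0$, $\int\psi=1$ (Friedrichs mollifier), $\psi_\varepsilon(x)=\omega(\varepsilon)^{-d}\psi(x/\omega(\varepsilon))$ for $\varepsilon\in(0,1]$, and $\omega(\varepsilon)$ is a positive function with $\omega(\varepsilon)\to0$ as $\varepsilon\to0$. Moderateness: for a Banach space $X$, a net $(f_\varepsilon)_{\varepsilon\in(0,1]}$ in $X$ is $X$-moderate if there exist $N\in\mathbb{N}_0$, $c>0$ with $\Vert f_\varepsilon\Vert_X\le c\,\omega(\varepsilon)^{-N}$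 for all $\varepsilon$. Very weak solution: the net $(u_\varepsilon)_\varepsilon$ is a very weak solution if, for an $L^\infty$-moderate regularisation $(q_\varepsilon)_\varepsilon$ of $q$ and an $L^2$-moderate regularisation $(u_{0,\varepsilon})_\varepsilon$ of $u_0$, $u_\varepsilon$ solves $\partial_t u_\varepsilon-\Delta u_\varepsilon-q_\varepsilon u_\varepsilon=0$ with $u_\varepsilon(0,\cdot)=u_{0,\varepsilon}$ for all $\varepsilon\in(0,1]$, and $(u_\varepsilon)_\varepsilon$ is $C([0,T];L^2(\mathbb{R}^d))$-moderate. *)

theory Defs
  imports "HOL-Analysis.Analysis" "HOL-Probability.Essential_Supremum"
begin

section \<open>Smooth and test functions\<close>

definition partial_deriv :: "'a::euclidean_space \<Rightarrow> ('a \<Rightarrow> real) \<Rightarrow> 'a \<Rightarrow> real" where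
  "partial_deriv i f x = frechet_derivative f (at x) i"

primrec Ck :: "nat \<Rightarrow> ('a::euclidean_space \<Rightarrow> real) \<Rightarrow> bool" where
  "Ck 0 f \<longleftrightarrow> continuous_on UNIV f"
| "Ck (Suc k) f \<longleftrightarrow> f differentiable_on UNIV \<and> (\<forall>i\<in>Basis. Ck k (partial_deriv i f))"

definition smooth :: "('a::euclidean_space \<Rightarrow> real) \<Rightarrow> bool" where
  "smooth f \<longleftrightarrow> (\<forall>k. Ck k f)"

definition supp :: "('a::euclidean_space \<Rightarrow> real) \<Rightarrow> 'a set" where
  "supp f = closure {x. f x \<noteq> 0}"

definition test_functions :: "'a::euclidean_space set \<Rightarrow> ('a \<Rightarrow> real) set" where
  "test_functions \<Omega> = {\<phi>. smooth \<phi> \<and> compact (supp \<phi>) \<and> supp \<phi> \<subseteq> \<Omega>}"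

definition dt :: "(real \<times> 'a::euclidean_space \<Rightarrow> real) \<Rightarrow> real \<times> 'a \<Rightarrow> real" where
  "dt \<phi> = partial_deriv (1, 0) \<phi>"

definition laplace :: "(real \<times> 'a::euclidean_space \<Rightarrow> real) \<Rightarrow> real \<times> 'a \<Rightarrow> real" where
  "laplace \<phi> z = (\<Sum>i\<in>Basis. partial_deriv (0, i) (partial_deriv (0, i) \<phi>) z)"


section \<open>Function spaces\<close>

text \<open>Elements of the spaces are represented by functions; equality in the spaces is equality
  almost everywhere.\<close>

definition L2 :: "('a::euclidean_space \<Rightarrow> complex) set" where
  "L2 = {f. f \<in> borel_measurable lebesgue \<and> integrable lebesgue (\<lambda>x. (norm (f x))\<^sup>2)}"

definition L2_norm :: "('a::euclidean_space \<Rightarrow> complex) \<Rightarrow> real" where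
  "L2_norm f = sqrt (LINT x|lebesgue. (norm (f x))\<^sup>2)"

definition Linf :: "('a::euclidean_space \<Rightarrow> real) set" where
  "Linf = {f. f \<in> borel_measurable lebesgue \<and> esssup lebesgue (\<lambda>x. ereal \<bar>f x\<bar>) < \<infinity>}"

definition Linf_norm :: "('a::euclidean_space \<Rightarrow> real) \<Rightarrow> real" where
  "Linf_norm f = real_of_ereal (esssup lebesgue (\<lambda>x. ereal \<bar>f x\<bar>))"

definition CL2 :: "real \<Rightarrow> (real \<Rightarrow> 'a::euclidean_space \<Rightarrow> complex) set" where
  "CL2 T = {u. (\<forall>t\<in>{0..T}. u t \<in> L2) \<and>
               (\<forall>t\<in>{0..T}. ((\<lambda>s. L2_norm (\<lambda>x. u s x - u t x)) \<longlongrightarrow> 0) (at t within {0..T}))}"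

definition CL2_norm :: "real \<Rightarrow> (real \<Rightarrow> 'a::euclidean_space \<Rightarrow> complex) \<Rightarrow> real" where
  "CL2_norm T u = (SUP t\<in>{0..T}. L2_norm (u t))"


section \<open>The Cauchy problem\<close>

text \<open>Solutions of \<open>u\<^sub>t - \<Delta>u - q u = 0\<close>, \<open>u(0) = u\<^sub>0\<close> in \<open>C([0,T]; L\<^sup>2)\<close>.  Such a \<open>u\<close> need not
  be differentiable, so the equation is understood in the sense of distributions on
  \<open>(0,T) \<times> \<real>\<^sup>d\<close>.  The pairing is an iterated integral: a representative of an element of
  \<open>C([0,T]; L\<^sup>2)\<close> is chosen for each \<open>t\<close> separately and need not be jointly measurable, whereas the
  inner integral does not depend on the choice and is continuous in \<open>t\<close>.\<close>

definition cauchy_solution ::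
  "real \<Rightarrow> ('a::euclidean_space \<Rightarrow> real) \<Rightarrow> ('a \<Rightarrow> complex) \<Rightarrow> (real \<Rightarrow> 'a \<Rightarrow> complex) \<Rightarrow> bool" where
  "cauchy_solution T q u0 u \<longleftrightarrow>
     u \<in> CL2 T \<and>
     (AE x in lebesgue. u 0 x = u0 x) \<and>
     (\<forall>\<phi>\<in>test_functions ({0<..<T} \<times> UNIV).
        (LINT t:{0<..<T}|lebesgue. LINT x|lebesgue.
           (- dt \<phi> (t, x) - laplace \<phi> (t, x) - q x * \<phi> (t, x)) *\<^sub>R u t x) = 0)"


section \<open>Regularisation, moderateness and very weak solutions\<close>

definition friedrichs_mollifier :: "('a::euclidean_space \<Rightarrow> real) \<Rightarrow> bool" where
  "friedrichs_mollifier \<psi> \<longleftrightarrow>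
     \<psi> \<in> test_functions UNIV \<and> (\<forall>x. \<psi> x \<ge> 0) \<and> (LINT x|lebesgue. \<psi> x) = 1"

definition mollifier_scale :: "(real \<Rightarrow> real) \<Rightarrow> bool" where
  "mollifier_scale \<omega> \<longleftrightarrow> (\<forall>\<epsilon>\<in>{0<..1}. \<omega> \<epsilon> > 0) \<and> (\<omega> \<longlongrightarrow> 0) (at_right 0)"

definition mollifier_net :: "('a::euclidean_space \<Rightarrow> real) \<Rightarrow> (real \<Rightarrow> real) \<Rightarrow> real \<Rightarrow> 'a \<Rightarrow> real" where
  "mollifier_net \<psi> \<omega> \<epsilon> x = \<psi> (x /\<^sub>R \<omega> \<epsilon>) / \<omega> \<epsilon> ^ DIM('a)"

definition convolution ::
  "('a::euclidean_space \<Rightarrow> 'b::{banach, second_countable_topology}) \<Rightarrow> ('a \<Rightarrow> real) \<Rightarrow> 'a \<Rightarrow> 'b" where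
  "convolution f g x = (LINT y|lebesgue. g (x - y) *\<^sub>R f y)"

definition regularising_family ::
  "('a::euclidean_space \<Rightarrow> real) \<Rightarrow> (real \<Rightarrow> real) \<Rightarrow>
   ('a \<Rightarrow> 'b::{banach, second_countable_topology}) \<Rightarrow> (real \<Rightarrow> 'a \<Rightarrow> 'b) \<Rightarrow> bool" where
  "regularising_family \<psi> \<omega> f F \<longleftrightarrow>
     (\<forall>\<epsilon>\<in>{0<..1}. F \<epsilon> = convolution f (mollifier_net \<psi> \<omega> \<epsilon>))"

definition moderate :: "(real \<Rightarrow> real) \<Rightarrow> 'f set \<Rightarrow> ('f \<Rightarrow> real) \<Rightarrow> (real \<Rightarrow> 'f) \<Rightarrow> bool" where
  "moderate \<omega> X norm_X F \<longleftrightarrow>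
     (\<forall>\<epsilon>\<in>{0<..1}. F \<epsilon> \<in> X) \<and>
     (\<exists>N::nat. \<exists>c>0. \<forall>\<epsilon>\<in>{0<..1}. norm_X (F \<epsilon>) \<le> c / \<omega> \<epsilon> ^ N)"

definition very_weak_solution ::
  "real \<Rightarrow> ('a::euclidean_space \<Rightarrow> real) \<Rightarrow> (real \<Rightarrow> real) \<Rightarrow>
   ('a \<Rightarrow> real) \<Rightarrow> ('a \<Rightarrow> complex) \<Rightarrow> (real \<Rightarrow> 'a \<Rightarrow> real) \<Rightarrow> (real \<Rightarrow> 'a \<Rightarrow> complex) \<Rightarrow>
   (real \<Rightarrow> real \<Rightarrow> 'a \<Rightarrow> complex) \<Rightarrow> bool" where
  "very_weak_solution T \<psi> \<omega> q u0 q_net u0_net u_net \<longleftrightarrow>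
     regularising_family \<psi> \<omega> q q_net \<and> moderate \<omega> Linf Linf_norm q_net \<and>
     regularising_family \<psi> \<omega> u0 u0_net \<and> moderate \<omega> L2 L2_norm u0_net \<and>
     (\<forall>\<epsilon>\<in>{0<..1}. cauchy_solution T (q_net \<epsilon>) (u0_net \<epsilon>) (u_net \<epsilon>)) \<and>
     moderate \<omega> (CL2 T) (CL2_norm T) u_net"

end

theory Submission
  imports Defs
begin

text \<open>The difference \<open>v = u\<^sub>\<epsilon> - u\<close> solves \<open>v\<^sub>t - \<Delta>v = F\<close> in the sense of distributions, with
  \<open>F = q\<^sub>\<epsilon> u\<^sub>\<epsilon> - q u = q\<^sub>\<epsilon> v + (q\<^sub>\<epsilon> - q) u\<close>.  Testing with products \<open>\<eta>(t) \<rho>(x)\<close> and arguing as in the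
  lemma of du Bois-Reymond gives \<open>\<langle>v(t), \<rho>\<rangle> - \<langle>v(0), \<rho>\<rangle> = \<integral>\<^sub>0\<^sup>t \<langle>v, \<Delta>\<rho>\<rangle> + \<langle>F, \<rho>\<rangle> ds\<close>.  For
  \<open>\<rho> = \<psi>\<^sub>\<delta>(x - \<cdot>)\<close> this is, for each \<open>x\<close>, an ordinary differential equation for the mollification
  \<open>V = v * \<psi>\<^sub>\<delta>\<close>; integrating \<open>\<partial>\<^sub>t |V|\<^sup>2\<close> over \<open>x\<close> and discarding \<open>\<integral> V \<Delta>V = - \<integral> |\<nabla>V|\<^sup>2 \<le> 0\<close> yields, as
  \<open>\<delta> \<rightarrow> 0\<close>, the energy inequality \<open>\<parallel>v(t)\<parallel>\<^sup>2 \<le> \<parallel>v(0)\<parallel>\<^sup>2 + 2 \<integral>\<^sub>0\<^sup>t \<parallel>v\<parallel> \<parallel>F\<parallel> ds\<close>.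
  Since \<open>q\<^sub>\<epsilon>\<close> is bounded by the norm of \<open>q\<close>, Gronwall's inequality bounds \<open>\<parallel>v(t)\<parallel>\<^sup>2\<close> by a constant
  times \<open>\<parallel>u\<^sub>0\<^sub>,\<^sub>\<epsilon> - u\<^sub>0\<parallel>\<^sup>2 + \<integral>\<^sub>0\<^sup>T \<parallel>(q\<^sub>\<epsilon> - q) u\<parallel>\<^sup>2 ds\<close>, which tends to 0 because mollification
  converges in \<open>L\<^sup>2\<close>.\<close>


section \<open>The spaces \<open>L\<^sup>2\<close> and \<open>L\<^sup>\<infinity>\<close>\<close>

lemma L2_measurable [measurable_dest]: "f \<in> L2 \<Longrightarrow> f \<in> borel_measurable lebesgue"
  and L2_integrable: "f \<in> L2 \<Longrightarrow> integrable lebesgue (\<lambda>x. (norm (f x))\<^sup>2)"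
  by (auto simp: L2_def)

lemma L2_norm_nonneg [simp]: "0 \<le> L2_norm f"
  by (simp add: L2_norm_def)

lemma L2_norm_power2: "(L2_norm f)\<^sup>2 = (LINT x|lebesgue. (norm (f x))\<^sup>2)"
  by (simp add: L2_norm_def)

lemma L2_norm_zero [simp]: "L2_norm (\<lambda>x. 0) = 0"
  by (simp add: L2_norm_def)

lemma L2_norm_cong_AE:
  assumes [measurable]: "f \<in> borel_measurable lebesgue" "g \<in> borel_measurable lebesgue"
    and "AE x in lebesgue. f x = g x"
  shows "L2_norm f = L2_norm g"
proof -
  have "(LINT x|lebesgue. (norm (f x))\<^sup>2) = (LINT x|lebesgue. (norm (g x))\<^sup>2)"
    using assms(3) by (intro integral_cong_AE) auto
  then show ?thesis by (simp add: L2_norm_def)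
qed

lemma L2_norm_mono:
  assumes f [measurable]: "f \<in> borel_measurable lebesgue" and g: "g \<in> L2"
    and bound: "AE x in lebesgue. norm (f x) \<le> norm (g x)"
  shows "f \<in> L2" and "L2_norm f \<le> L2_norm g"
proof -
  have power2_le: "AE x in lebesgue. (norm (f x))\<^sup>2 \<le> (norm (g x))\<^sup>2"
    using bound by eventually_elim (simp add: power_mono)
  have integrable: "integrable lebesgue (\<lambda>x. (norm (f x))\<^sup>2)"
    by (rule Bochner_Integration.integrable_bound[OF L2_integrable[OF g]]) (use power2_le in auto)
  then show "f \<in> L2" by (simp add: L2_def)
  show "L2_norm f \<le> L2_norm g"
    unfolding L2_norm_def using integrable L2_integrable[OF g] power2_le
    by (intro real_sqrt_le_mono integral_mono_AE) auto
qed

lemma L2_scaleR: "f \<in> L2 \<Longrightarrow> (\<lambda>x. c *\<^sub>R f x) \<in> L2"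
  by (auto simp: L2_def power_mult_distrib)

lemma L2_norm_scaleR: "L2_norm (\<lambda>x. c *\<^sub>R f x) = \<bar>c\<bar> * L2_norm f"
  by (simp add: L2_norm_def power_mult_distrib real_sqrt_mult)

lemma L2_norm_minus_commute: "L2_norm (\<lambda>x. f x - g x) = L2_norm (\<lambda>x. g x - f x)"
  by (simp add: L2_norm_def norm_minus_commute)

lemma L2_add:
  assumes "f \<in> L2" "g \<in> L2"
  shows "(\<lambda>x. f x + g x) \<in> L2"
proof -
  note [measurable] = assms[THEN L2_measurable]
  have bound: "(norm (a + b))\<^sup>2 \<le> 2 * (norm a)\<^sup>2 + 2 * (norm b)\<^sup>2" for a b :: complex
  proof -
    have "(norm (a + b))\<^sup>2 + (norm (a - b))\<^sup>2 = 2 * (norm a)\<^sup>2 + 2 * (norm b)\<^sup>2"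
      by (simp add: power2_norm_eq_inner inner_simps inner_commute)
    then show ?thesis using zero_le_power2[of "norm (a - b)"] by linarith
  qed
  have "integrable lebesgue (\<lambda>x. (norm (f x + g x))\<^sup>2)"
    by (rule Bochner_Integration.integrable_bound[of _
        "\<lambda>x. 2 * (norm (f x))\<^sup>2 + 2 * (norm (g x))\<^sup>2"])
       (use bound assms[THEN L2_integrable] in auto)
  then show ?thesis by (simp add: L2_def)
qed

lemma L2_diff:
  assumes "f \<in> L2" "g \<in> L2"
  shows "(\<lambda>x. f x - g x) \<in> L2"
  using L2_add[OF assms(1) L2_scaleR[OF assms(2), of "-1"]] by simp

lemma Cauchy_Schwarz_integral:
  fixes f g :: "'a \<Rightarrow> real"
  assumes [measurable]: "f \<in> borel_measurable M" "g \<in> borel_measurable M"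
    and f: "integrable M (\<lambda>x. (f x)\<^sup>2)" and g: "integrable M (\<lambda>x. (g x)\<^sup>2)"
  shows "integrable M (\<lambda>x. f x * g x)"
    and "(LINT x|M. \<bar>f x * g x\<bar>) \<le> sqrt (LINT x|M. (f x)\<^sup>2) * sqrt (LINT x|M. (g x)\<^sup>2)"
proof -
  show integrable: "integrable M (\<lambda>x. f x * g x)"
  proof (rule Bochner_Integration.integrable_bound[of _ "\<lambda>x. (f x)\<^sup>2 + (g x)\<^sup>2"])
    have "\<bar>f x * g x\<bar> \<le> (f x)\<^sup>2 + (g x)\<^sup>2" for x
      using sum_squares_bound[of "\<bar>f x\<bar>" "\<bar>g x\<bar>"] abs_ge_zero[of "f x * g x"]
      unfolding power2_abs abs_mult by linarith
    then show "AE x in M. norm (f x * g x) \<le> norm ((f x)\<^sup>2 + (g x)\<^sup>2)" by auto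
  qed (use f g in auto)
  have "ennreal ((LINT x|M. \<bar>f x * g x\<bar>)\<^sup>2) = (\<integral>\<^sup>+x. ennreal \<bar>f x\<bar> * ennreal \<bar>g x\<bar> \<partial>M)\<^sup>2"
  proof -
    have "ennreal (LINT x|M. \<bar>f x * g x\<bar>) = (\<integral>\<^sup>+x. ennreal \<bar>f x * g x\<bar> \<partial>M)"
      using integrable by (intro nn_integral_eq_integral[symmetric]) auto
    then show ?thesis by (simp add: abs_mult ennreal_mult flip: ennreal_power)
  qed
  also have "\<dots> \<le> (\<integral>\<^sup>+x. (ennreal \<bar>f x\<bar>)\<^sup>2 \<partial>M) * (\<integral>\<^sup>+x. (ennreal \<bar>g x\<bar>)\<^sup>2 \<partial>M)"
    by (rule Cauchy_Schwarz_nn_integral) auto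
  also have "\<dots> = ennreal ((LINT x|M. (f x)\<^sup>2) * (LINT x|M. (g x)\<^sup>2))"
    using f g by (simp add: ennreal_power nn_integral_eq_integral ennreal_mult)
  finally have "(LINT x|M. \<bar>f x * g x\<bar>)\<^sup>2 \<le> (LINT x|M. (f x)\<^sup>2) * (LINT x|M. (g x)\<^sup>2)"
    by (subst (asm) ennreal_le_iff) auto
  then show "(LINT x|M. \<bar>f x * g x\<bar>) \<le> sqrt (LINT x|M. (f x)\<^sup>2) * sqrt (LINT x|M. (g x)\<^sup>2)"
    by (simp add: real_le_rsqrt flip: real_sqrt_mult)
qed

definition L2_inner :: "('a::euclidean_space \<Rightarrow> complex) \<Rightarrow> ('a \<Rightarrow> complex) \<Rightarrow> real" where
  "L2_inner f g = (LINT x|lebesgue. f x \<bullet> g x)"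

lemma integrable_inner_L2:
  assumes "f \<in> L2" "g \<in> L2"
  shows "integrable lebesgue (\<lambda>x. f x \<bullet> g x)"
    and "(LINT x|lebesgue. \<bar>f x \<bullet> g x\<bar>) \<le> L2_norm f * L2_norm g"
proof -
  note [measurable] = assms[THEN L2_measurable]
  note CS = Cauchy_Schwarz_integral[of "\<lambda>x. norm (f x)" lebesgue "\<lambda>x. norm (g x)"]
  have prod: "integrable lebesgue (\<lambda>x. norm (f x) * norm (g x))"
    by (rule CS) (use assms[THEN L2_integrable] in auto)
  then show integrable: "integrable lebesgue (\<lambda>x. f x \<bullet> g x)"
    by (rule Bochner_Integration.integrable_bound) (auto simp: Cauchy_Schwarz_ineq2)
  have "(LINT x|lebesgue. \<bar>f x \<bullet> g x\<bar>) \<le> (LINT x|lebesgue. \<bar>norm (f x) * norm (g x)\<bar>)"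
    using integrable prod by (intro integral_mono) (auto simp: Cauchy_Schwarz_ineq2)
  also have "\<dots> \<le> L2_norm f * L2_norm g"
    unfolding L2_norm_def by (rule CS) (use assms[THEN L2_integrable] in auto)
  finally show "(LINT x|lebesgue. \<bar>f x \<bullet> g x\<bar>) \<le> L2_norm f * L2_norm g" .
qed

lemma abs_L2_inner_le:
  assumes "f \<in> L2" "g \<in> L2"
  shows "\<bar>L2_inner f g\<bar> \<le> L2_norm f * L2_norm g"
  unfolding L2_inner_def
  using order_trans[OF integral_norm_bound[of lebesgue "\<lambda>x. f x \<bullet> g x"]]
    integrable_inner_L2(2)[OF assms]
  by simp

lemma L2_inner_commute: "L2_inner f g = L2_inner g f"
  by (simp add: L2_inner_def inner_commute)

lemma L2_inner_self: "L2_inner f f = (L2_norm f)\<^sup>2"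
  by (simp add: L2_inner_def L2_norm_power2 power2_norm_eq_inner)

lemma L2_inner_add_right:
  assumes "f \<in> L2" "g \<in> L2" "h \<in> L2"
  shows "L2_inner f (\<lambda>x. g x + h x) = L2_inner f g + L2_inner f h"
  using integrable_inner_L2(1)[OF assms(1,2)] integrable_inner_L2(1)[OF assms(1,3)]
  by (simp add: L2_inner_def inner_add_right)

lemma L2_inner_scaleR_right: "L2_inner f (\<lambda>x. c *\<^sub>R g x) = c * L2_inner f g"
  by (simp add: L2_inner_def)

lemma L2_inner_diff_right:
  assumes "f \<in> L2" "g \<in> L2" "h \<in> L2"
  shows "L2_inner f (\<lambda>x. g x - h x) = L2_inner f g - L2_inner f h"
  using L2_inner_add_right[OF assms(1,2) L2_scaleR[OF assms(3), of "-1"]]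
    L2_inner_scaleR_right[of f "-1" h] by simp

lemma L2_inner_sum_right:
  assumes "f \<in> L2" "\<And>i. i \<in> I \<Longrightarrow> g i \<in> L2"
  shows "L2_inner f (\<lambda>x. \<Sum>i\<in>I. g i x) = (\<Sum>i\<in>I. L2_inner f (g i))"
  unfolding L2_inner_def inner_sum_right
  by (intro Bochner_Integration.integral_sum integrable_inner_L2(1) assms)

lemma L2_norm_add_power2:
  assumes "f \<in> L2" "g \<in> L2"
  shows "(L2_norm (\<lambda>x. f x + g x))\<^sup>2 = (L2_norm f)\<^sup>2 + 2 * L2_inner f g + (L2_norm g)\<^sup>2"
proof -
  have "(L2_norm (\<lambda>x. f x + g x))\<^sup>2
      = (LINT x|lebesgue. (norm (f x))\<^sup>2 + 2 * (f x \<bullet> g x) + (norm (g x))\<^sup>2)"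
    unfolding L2_norm_power2
    by (simp add: power2_norm_eq_inner inner_add inner_commute algebra_simps)
  then show ?thesis
    using integrable_inner_L2(1)[OF assms] assms[THEN L2_integrable]
    by (simp add: L2_norm_power2 L2_inner_def)
qed

lemma L2_norm_triangle_ineq:
  assumes "f \<in> L2" "g \<in> L2"
  shows "L2_norm (\<lambda>x. f x + g x) \<le> L2_norm f + L2_norm g"
proof (rule power2_le_imp_le)
  show "(L2_norm (\<lambda>x. f x + g x))\<^sup>2 \<le> (L2_norm f + L2_norm g)\<^sup>2"
    unfolding L2_norm_add_power2[OF assms] power2_sum using abs_L2_inner_le[OF assms] by simp
qed simp

lemma L2_norm_triangle_sub:
  assumes "f \<in> L2" "g \<in> L2"
  shows "L2_norm f \<le> L2_norm (\<lambda>x. f x - g x) + L2_norm g"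
  using L2_norm_triangle_ineq[OF L2_diff[OF assms] assms(2)] by simp

lemma L2_norm_diff_triangle_ineq:
  assumes "f \<in> L2" "g \<in> L2" "h \<in> L2"
  shows "L2_norm (\<lambda>x. f x - h x) \<le> L2_norm (\<lambda>x. f x - g x) + L2_norm (\<lambda>x. g x - h x)"
  using L2_norm_triangle_ineq[OF L2_diff[OF assms(1,2)] L2_diff[OF assms(2,3)]] by simp

lemma L2_norm_triangle_ineq3:
  assumes "f \<in> L2" "g \<in> L2"
  shows "\<bar>L2_norm f - L2_norm g\<bar> \<le> L2_norm (\<lambda>x. f x - g x)"
  using L2_norm_triangle_sub[OF assms] L2_norm_triangle_sub[OF assms(2,1)]
  by (simp add: L2_norm_minus_commute[of f g])

lemma L2_norm_tendsto:
  assumes "f \<in> L2" and eventually_L2: "\<forall>\<^sub>F i in F. g i \<in> L2"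
    and lim: "((\<lambda>i. L2_norm (\<lambda>x. g i x - f x)) \<longlongrightarrow> 0) F"
  shows "((\<lambda>i. L2_norm (g i)) \<longlongrightarrow> L2_norm f) F"
proof (rule Lim_null[THEN iffD2], rule Lim_null_comparison[OF _ lim])
  show "\<forall>\<^sub>F i in F. norm (L2_norm (g i) - L2_norm f) \<le> L2_norm (\<lambda>x. g i x - f x)"
    using eventually_L2 by eventually_elim (simp add: L2_norm_triangle_ineq3 assms(1))
qed

lemma L2_inner_tendsto:
  assumes "f \<in> L2" "h \<in> L2" and eventually_L2: "\<forall>\<^sub>F i in F. g i \<in> L2"
    and lim: "((\<lambda>i. L2_norm (\<lambda>x. g i x - f x)) \<longlongrightarrow> 0) F"
  shows "((\<lambda>i. L2_inner h (g i)) \<longlongrightarrow> L2_inner h f) F"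
proof (rule Lim_null[THEN iffD2], rule Lim_null_comparison[OF _ tendsto_mult_right_zero[OF lim]])
  show "\<forall>\<^sub>F i in F. norm (L2_inner h (g i) - L2_inner h f) \<le> L2_norm h * L2_norm (\<lambda>x. g i x - f x)"
    using eventually_L2
    by eventually_elim (use assms(1,2) in
      \<open>simp add: abs_L2_inner_le L2_diff flip: L2_inner_diff_right\<close>)
qed

lemma L2_norm_dominated_convergence:
  fixes g :: "nat \<Rightarrow> 'a::euclidean_space \<Rightarrow> complex"
  assumes [measurable]: "\<And>n. g n \<in> borel_measurable lebesgue" "f \<in> borel_measurable lebesgue"
    and w: "integrable lebesgue w"
      and dominated: "\<And>n. AE x in lebesgue. (norm (g n x - f x))\<^sup>2 \<le> w x"
    and lim: "AE x in lebesgue. (\<lambda>n. g n x) \<longlonglongrightarrow> f x"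
  shows "(\<lambda>n. L2_norm (\<lambda>x. g n x - f x)) \<longlonglongrightarrow> 0"
proof -
  have "(\<lambda>n. LINT x|lebesgue. (norm (g n x - f x))\<^sup>2) \<longlonglongrightarrow> (LINT x::'a|lebesgue. 0)"
  proof (rule integral_dominated_convergence[OF _ _ w])
    show "AE x in lebesgue. (\<lambda>n. (norm (g n x - f x))\<^sup>2) \<longlonglongrightarrow> 0"
      using lim
    proof eventually_elim
      case (elim x)
      then show ?case using tendsto_power[OF tendsto_norm_zero[OF LIM_zero[OF elim]], of 2] by simp
    qed
  qed (use dominated in auto)
  then have "(\<lambda>n. sqrt (LINT x|lebesgue. (norm (g n x - f x))\<^sup>2)) \<longlonglongrightarrow> sqrt 0"
    by (intro tendsto_real_sqrt) simp
  then show ?thesis by (simp add: L2_norm_def)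
qed

lemma Linf_measurable [measurable_dest]: "q \<in> Linf \<Longrightarrow> q \<in> borel_measurable lebesgue"
  by (simp add: Linf_def)

lemma esssup_abs_nonneg:
  fixes q :: "'a::euclidean_space \<Rightarrow> real"
  assumes [measurable]: "q \<in> borel_measurable lebesgue"
  shows "0 \<le> esssup lebesgue (\<lambda>x. ereal \<bar>q x\<bar>)"
proof -
  have "esssup lebesgue (\<lambda>x::'a. 0) \<le> esssup lebesgue (\<lambda>x. ereal \<bar>q x\<bar>)"
    by (rule esssup_mono) auto
  then show ?thesis by (simp add: esssup_const)
qed

lemma ereal_Linf_norm:
  assumes "q \<in> Linf"
  shows "ereal (Linf_norm q) = esssup lebesgue (\<lambda>x. ereal \<bar>q x\<bar>)"
  using assms esssup_abs_nonneg[of q] by (simp add: Linf_def Linf_norm_def ereal_real')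

lemma Linf_norm_nonneg: "q \<in> Linf \<Longrightarrow> 0 \<le> Linf_norm q"
  using ereal_Linf_norm[of q] esssup_abs_nonneg[of q]
  by (metis Linf_measurable ereal_less_eq(5))

lemma AE_abs_le_Linf_norm:
  assumes "q \<in> Linf"
  shows "AE x in lebesgue. \<bar>q x\<bar> \<le> Linf_norm q"
  using esssup_AE[of "\<lambda>x. ereal \<bar>q x\<bar>" lebesgue] by (simp flip: ereal_Linf_norm[OF assms])

lemma LinfI:
  assumes [measurable]: "q \<in> borel_measurable lebesgue" and bound: "AE x in lebesgue. \<bar>q x\<bar> \<le> M"
  shows "q \<in> Linf" and "Linf_norm q \<le> M"
proof -
  have sup_le: "esssup lebesgue (\<lambda>x. ereal \<bar>q x\<bar>) \<le> ereal M"
    by (rule esssup_I) (use bound in auto)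
  then show q: "q \<in> Linf" by (auto simp: Linf_def intro: le_less_trans)
  show "Linf_norm q \<le> M" using sup_le by (simp flip: ereal_Linf_norm[OF q])
qed

lemma Linf_diff:
  assumes "p \<in> Linf" "q \<in> Linf"
  shows "(\<lambda>x. p x - q x) \<in> Linf" and "Linf_norm (\<lambda>x. p x - q x) \<le> Linf_norm p + Linf_norm q"
proof -
  note [measurable] = assms[THEN Linf_measurable]
  have "AE x in lebesgue. \<bar>p x - q x\<bar> \<le> Linf_norm p + Linf_norm q"
    using assms[THEN AE_abs_le_Linf_norm] by eventually_elim linarith
  then show "(\<lambda>x. p x - q x) \<in> Linf" "Linf_norm (\<lambda>x. p x - q x) \<le> Linf_norm p + Linf_norm q"
    by (intro LinfI; simp)+
qed

lemma L2_mult_Linf: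
  assumes m: "m \<in> Linf" and f: "f \<in> L2"
  shows "(\<lambda>x. m x *\<^sub>R f x) \<in> L2" and "L2_norm (\<lambda>x. m x *\<^sub>R f x) \<le> Linf_norm m * L2_norm f"
proof -
  note [measurable] = Linf_measurable[OF m] L2_measurable[OF f]
  have "AE x in lebesgue. norm (m x *\<^sub>R f x) \<le> norm (Linf_norm m *\<^sub>R f x)"
    using AE_abs_le_Linf_norm[OF m] by eventually_elim (simp add: mult_right_mono)
  note mono = L2_norm_mono[OF _ L2_scaleR[OF f] this]
  show "(\<lambda>x. m x *\<^sub>R f x) \<in> L2" by (rule mono) simp
  show "L2_norm (\<lambda>x. m x *\<^sub>R f x) \<le> Linf_norm m * L2_norm f"
    using mono(2) Linf_norm_nonneg[OF m] by (simp add: L2_norm_scaleR)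
qed

lemma L2_norm_mult_diff_le:
  assumes p: "p \<in> Linf" and q: "q \<in> Linf" and f: "f \<in> L2" and g: "g \<in> L2"
  shows "L2_norm (\<lambda>x. p x *\<^sub>R f x - q x *\<^sub>R g x)
    \<le> Linf_norm p * L2_norm (\<lambda>x. f x - g x) + L2_norm (\<lambda>x. (p x - q x) *\<^sub>R g x)"
proof -
  have "(\<lambda>x. p x *\<^sub>R f x - q x *\<^sub>R g x) = (\<lambda>x. p x *\<^sub>R (f x - g x) + (p x - q x) *\<^sub>R g x)"
    by (simp add: fun_eq_iff scaleR_diff_right scaleR_diff_left)
  then show ?thesis
    using L2_norm_triangle_ineq[OF L2_mult_Linf(1)[OF p L2_diff[OF f g]]
        L2_mult_Linf(1)[OF Linf_diff(1)[OF p q] g]]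
      L2_mult_Linf(2)[OF p L2_diff[OF f g]] by simp
qed


section \<open>Continuous functions of compact support\<close>

lemma borel_measurable_imp_lebesgue: "g \<in> borel_measurable borel \<Longrightarrow> g \<in> borel_measurable lebesgue"
  by (simp add: measurable_completion)

lemma ident_measurable_lebesgue_borel [measurable]: "(\<lambda>x. x) \<in> lebesgue \<rightarrow>\<^sub>M borel"
  by (simp add: measurable_completion)

lemma integrable_indicator_cball:
  "integrable lebesgue (indicator (cball c R) :: 'a::euclidean_space \<Rightarrow> real)"
  by (rule integrable_real_indicator)
     (use emeasure_lborel_cball_finite[of c R] in \<open>auto simp: less_top\<close>)

lemma indicator_cball_measurable [measurable]:
  "(indicator (cball c R) :: 'a::euclidean_space \<Rightarrow> real) \<in> borel_measurable lebesgue"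
  by (rule borel_measurable_integrable[OF integrable_indicator_cball])

lemma L2_norm_le_cball:
  fixes f :: "'a::euclidean_space \<Rightarrow> complex"
  assumes f [measurable]: "f \<in> borel_measurable lebesgue" and e: "0 \<le> e"
    and bound: "AE x in lebesgue. norm (f x) \<le> e * indicator (cball 0 R) x"
  shows "f \<in> L2" and "L2_norm f \<le> e * sqrt (measure lebesgue (cball (0::'a) R))"
proof -
  define g :: "'a \<Rightarrow> complex" where "g x = e *\<^sub>R of_real (indicator (cball 0 R) x)" for x
  have power2_indicator: "(norm (of_real (indicator (cball 0 R) x) :: complex))\<^sup>2
    = indicator (cball 0 R) x"
    for x :: 'a by (simp add: indicator_def)
  have "(\<lambda>x. of_real (indicator (cball 0 R) x)) \<in> (L2 :: ('a \<Rightarrow> complex) set)"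
    unfolding L2_def
    by (simp only: mem_Collect_eq power2_indicator integrable_indicator_cball) measurable
  then have g: "g \<in> L2" unfolding g_def by (rule L2_scaleR)
  have f_le: "AE x in lebesgue. norm (f x) \<le> norm (g x)"
    using bound by eventually_elim (use e in \<open>simp add: g_def\<close>)
  show "f \<in> L2" by (rule L2_norm_mono(1)[OF f g f_le])
  have "L2_norm g = e * sqrt (measure lebesgue (cball (0::'a) R))"
    using e unfolding g_def L2_norm_scaleR unfolding L2_norm_def power2_indicator by simp
  then show "L2_norm f \<le> e * sqrt (measure lebesgue (cball (0::'a) R))"
    using L2_norm_mono(2)[OF f g f_le] by simp
qed

definition Cc :: "('a::euclidean_space \<Rightarrow> 'b::real_normed_vector) set" where
  "Cc = {g. continuous_on UNIV g \<and> (\<exists>R. \<forall>x. R < norm x \<longrightarrow> g x = 0)}"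

lemma CcI: "continuous_on UNIV g \<Longrightarrow> (\<And>x. R < norm x \<Longrightarrow> g x = 0) \<Longrightarrow> g \<in> Cc"
  unfolding Cc_def by blast

lemma Cc_continuous: "g \<in> Cc \<Longrightarrow> continuous_on UNIV g"
  by (simp add: Cc_def)

lemma Cc_borel: "g \<in> Cc \<Longrightarrow> g \<in> borel_measurable borel"
  by (simp add: Cc_continuous borel_measurable_continuous_onI)

lemma Cc_vanish:
  assumes "g \<in> Cc"
  obtains R where "0 < R" "\<And>x. R < norm x \<Longrightarrow> g x = 0"
proof -
  obtain R where "\<And>x. R < norm x \<Longrightarrow> g x = 0" using assms by (auto simp: Cc_def)
  then show ?thesis using that[of "max R 1"] by simp
qed

lemma Cc_bounded:
  assumes "g \<in> Cc"
  obtains K where "0 < K" "\<And>x. norm (g x) \<le> K"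
proof -
  obtain R where R: "\<And>x. R < norm x \<Longrightarrow> g x = 0" using Cc_vanish[OF assms] by blast
  have "bounded (g ` cball 0 R)"
    using Cc_continuous[OF assms]
    by (intro compact_imp_bounded compact_continuous_image) (auto intro: continuous_on_subset)
  then obtain K where K: "0 < K" "\<And>x. norm x \<le> R \<Longrightarrow> norm (g x) \<le> K"
    unfolding bounded_pos by auto
  have "norm (g x) \<le> K" for x
    using K R[of x] by (cases "norm x \<le> R") auto
  then show ?thesis using K(1) that by blast
qed

lemma Cc_uniformly_continuous:
  assumes "g \<in> Cc"
  shows "uniformly_continuous_on UNIV g"
  unfolding uniformly_continuous_on_def
proof (intro allI impI)
  fix e :: real assume "0 < e"
  obtain R where R: "\<And>x. R < norm x \<Longrightarrow> g x = 0" using Cc_vanish[OF assms] by blast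
  have "uniformly_continuous_on (cball 0 (R + 1)) g"
    by (intro compact_uniformly_continuous continuous_on_subset[OF Cc_continuous[OF assms]]) auto
  then obtain d where d: "0 < d"
    "\<And>x y. norm x \<le> R + 1 \<Longrightarrow> norm y \<le> R + 1 \<Longrightarrow> dist y x < d \<Longrightarrow> dist (g y) (g x) < e"
    using \<open>0 < e\<close> unfolding uniformly_continuous_on_def by (metis mem_cball_0)
  have "dist (g y) (g x) < e" if "dist y x < min d 1" for x y
  proof (cases "norm x \<le> R + 1 \<and> norm y \<le> R + 1")
    case False
    moreover have "\<bar>norm y - norm x\<bar> < 1"
      using that norm_triangle_ineq3[of y x] by (simp add: dist_norm)
    ultimately have "g x = 0" "g y = 0" by (auto intro!: R)
    then show ?thesis using \<open>0 < e\<close> by simp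
  qed (use d that in auto)
  then show "\<exists>d>0. \<forall>x\<in>UNIV. \<forall>y\<in>UNIV. dist y x < d \<longrightarrow> dist (g y) (g x) < e"
    using d(1) by (intro exI[of _ "min d 1"]) auto
qed

lemma Cc_compose:
  assumes "g \<in> Cc" "continuous_on UNIV h" "h 0 = 0"
  shows "(\<lambda>x. h (g x)) \<in> Cc"
proof -
  obtain R where "\<And>x. R < norm x \<Longrightarrow> g x = 0" using Cc_vanish[OF assms(1)] by blast
  then show ?thesis
    using assms(3)
    by (intro CcI[of _ R] continuous_on_compose2[OF assms(2) Cc_continuous[OF assms(1)]]) auto
qed

lemma Cc_compose_affine:
  assumes "g \<in> Cc" "c \<noteq> 0"
  shows "(\<lambda>y. g (a + c *\<^sub>R y)) \<in> Cc"
proof -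
  obtain R where R: "0 < R" "\<And>x. R < norm x \<Longrightarrow> g x = 0" using Cc_vanish[OF assms(1)] by blast
  show ?thesis
  proof (rule CcI)
    show "continuous_on UNIV (\<lambda>y. g (a + c *\<^sub>R y))"
      by (rule continuous_on_compose2[OF Cc_continuous[OF assms(1)]])
         (auto intro!: continuous_intros)
    fix y :: 'a assume "(R + norm a) / \<bar>c\<bar> < norm y"
    then have "R + norm a < \<bar>c\<bar> * norm y" using assms(2) by (simp add: field_simps)
    then show "g (a + c *\<^sub>R y) = 0"
      using norm_diff_ineq[of "c *\<^sub>R y" a] by (intro R(2)) (simp add: add.commute)
  qed
qed

lemma Cc_reflect: "g \<in> Cc \<Longrightarrow> (\<lambda>y. g (x - y)) \<in> Cc"
  using Cc_compose_affine[of g "-1" x] by simp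

lemma Cc_translate: "g \<in> Cc \<Longrightarrow> (\<lambda>y. g (y + a)) \<in> Cc"
  using Cc_compose_affine[of g 1 a] by (simp add: add.commute)

lemma Cc_add:
  assumes "f \<in> Cc" "g \<in> Cc"
  shows "(\<lambda>x. f x + g x) \<in> Cc"
proof -
  obtain R where R: "\<And>x. R < norm x \<Longrightarrow> f x = 0" using Cc_vanish[OF assms(1)] by blast
  obtain S where S: "\<And>x. S < norm x \<Longrightarrow> g x = 0" using Cc_vanish[OF assms(2)] by blast
  show ?thesis
    by (rule CcI[of _ "max R S"]) (use R S assms in \<open>auto intro: continuous_on_add Cc_continuous\<close>)
qed

lemma Cc_scaleR: "g \<in> Cc \<Longrightarrow> (\<lambda>x. c *\<^sub>R g x) \<in> Cc"
  by (rule Cc_compose) (auto intro!: continuous_intros)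

lemma Cc_diff: "f \<in> Cc \<Longrightarrow> g \<in> Cc \<Longrightarrow> (\<lambda>x. f x - g x) \<in> Cc"
  using Cc_add[of f "\<lambda>x. (-1) *\<^sub>R g x"] Cc_scaleR[of g "-1"] by simp

lemma Cc_sum: "finite I \<Longrightarrow> (\<And>i. i \<in> I \<Longrightarrow> g i \<in> Cc) \<Longrightarrow> (\<lambda>x. \<Sum>i\<in>I. g i x) \<in> Cc"
proof (induction I rule: finite_induct)
  case empty
  then show ?case by (simp add: Cc_def)
next
  case (insert i I)
  then show ?case using Cc_add[of "g i" "\<lambda>x. \<Sum>i\<in>I. g i x"] by simp
qed

lemma Cc_norm: "g \<in> Cc \<Longrightarrow> (\<lambda>x. norm (g x)) \<in> Cc"
  by (rule Cc_compose) (auto intro!: continuous_intros)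

lemma Cc_norm_power2: "g \<in> Cc \<Longrightarrow> (\<lambda>x. (norm (g x))\<^sup>2) \<in> Cc"
  by (rule Cc_compose) (auto intro!: continuous_intros)

definition locally_integrable ::
  "('a::euclidean_space \<Rightarrow> 'b::{banach, second_countable_topology}) \<Rightarrow> bool" where
  "locally_integrable f \<longleftrightarrow> (\<forall>R. set_integrable lebesgue (cball 0 R) f)"

lemma continuous_imp_locally_integrable:
  assumes "continuous_on UNIV f"
  shows "locally_integrable f"
  unfolding locally_integrable_def set_integrable_def
proof
  fix R :: real
  have "integrable lborel (\<lambda>x. indicator (cball 0 R) x *\<^sub>R f x)"
    by (intro borel_integrable_compact continuous_on_subset[OF assms]) auto
  then show "integrable lebesgue (\<lambda>x. indicator (cball 0 R) x *\<^sub>R f x)"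
    by (subst integrable_completion) auto
qed

lemma Cc_integrable:
  fixes g :: "'a::euclidean_space \<Rightarrow> 'b::{banach, second_countable_topology}"
  assumes "g \<in> Cc"
  shows "integrable lebesgue g"
proof -
  obtain R where R: "\<And>x. R < norm x \<Longrightarrow> g x = 0" using Cc_vanish[OF assms] by blast
  have "integrable lebesgue (\<lambda>x. indicator (cball 0 R) x *\<^sub>R g x)"
    using continuous_imp_locally_integrable[OF Cc_continuous[OF assms]]
    by (simp add: locally_integrable_def set_integrable_def)
  also have "(\<lambda>x. indicator (cball 0 R) x *\<^sub>R g x) = g"
    using R by (auto simp: indicator_def fun_eq_iff not_le)
  finally show ?thesis .
qed

lemma Cc_integral_pos:
  fixes g :: "'a::euclidean_space \<Rightarrow> real"
  assumes g: "g \<in> Cc" and nonneg: "\<And>x. 0 \<le> g x" and "g a \<noteq> 0"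
  shows "0 < (LINT x|lebesgue. g x)"
proof -
  have "closed {x. g x = 0}"
    using continuous_closed_preimage_constant[OF Cc_continuous[OF g] closed_UNIV, of 0] by simp
  then have "\<not> (AE x in lebesgue. g x = 0)"
    using mem_closed_if_AE_lebesgue[of "{x. g x = 0}" a] \<open>g a \<noteq> 0\<close> by auto
  then have "(LINT x|lebesgue. g x) \<noteq> 0"
    using integral_nonneg_eq_0_iff_AE[OF Cc_integrable[OF g]] nonneg by simp
  then show ?thesis
    using nonneg by (simp add: order_less_le)
qed

lemma Cc_imp_L2: "g \<in> Cc \<Longrightarrow> g \<in> L2"
  using Cc_integrable[OF Cc_norm_power2]
  by (auto simp: L2_def intro: borel_measurable_imp_lebesgue Cc_borel)

lemma L2_imp_locally_integrable:
  assumes f: "f \<in> L2"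
  shows "locally_integrable f"
  unfolding locally_integrable_def set_integrable_def
proof
  fix R :: real
  note [measurable] = L2_measurable[OF f]
  have bound: "norm (f x) \<le> 1 + (norm (f x))\<^sup>2" for x
    using sum_squares_bound[of "norm (f x)" 1] norm_ge_zero[of "f x"] unfolding power_one
    by linarith
  show "integrable lebesgue (\<lambda>x. indicator (cball 0 R) x *\<^sub>R f x)"
  proof (rule Bochner_Integration.integrable_bound)
    show "integrable lebesgue (\<lambda>x. indicator (cball 0 R) x + (norm (f x))\<^sup>2)"
      by (intro Bochner_Integration.integrable_add integrable_indicator_cball L2_integrable f)
    show "AE x in lebesgue. norm (indicator (cball 0 R) x *\<^sub>R f x)
        \<le> norm (indicator (cball 0 R) x + (norm (f x))\<^sup>2)"
      using bound by (auto simp: indicator_def)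
  qed measurable
qed

lemma Linf_imp_locally_integrable:
  assumes q: "q \<in> Linf"
  shows "locally_integrable q"
  unfolding locally_integrable_def set_integrable_def
proof
  fix R :: real
  note [measurable] = Linf_measurable[OF q]
  show "integrable lebesgue (\<lambda>x. indicator (cball 0 R) x *\<^sub>R q x)"
  proof (rule Bochner_Integration.integrable_bound)
    show "integrable lebesgue (\<lambda>x. Linf_norm q * indicator (cball 0 R) x)"
      by (intro integrable_mult_right integrable_indicator_cball)
    show "AE x in lebesgue. norm (indicator (cball 0 R) x *\<^sub>R q x)
        \<le> norm (Linf_norm q * indicator (cball 0 R) x)"
      using AE_abs_le_Linf_norm[OF q] by eventually_elim (auto simp: indicator_def)
  qed measurable
qed


section \<open>Pairings and convolution\<close>

definition pairing ::
  "('a::euclidean_space \<Rightarrow> real) \<Rightarrow> ('a \<Rightarrow> 'b::{banach, second_countable_topology}) \<Rightarrow> 'b" where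
  "pairing g f = (LINT x|lebesgue. g x *\<^sub>R f x)"

lemma integrable_scaleR_Cc:
  assumes g: "g \<in> Cc" and f: "locally_integrable f"
  shows "integrable lebesgue (\<lambda>x. g x *\<^sub>R f x)"
proof -
  obtain R where R: "\<And>x. R < norm x \<Longrightarrow> g x = 0" using Cc_vanish[OF g] by blast
  obtain K where K: "0 < K" "\<And>x. norm (g x) \<le> K" using Cc_bounded[OF g] by blast
  have cut: "integrable lebesgue (\<lambda>x. indicator (cball 0 R) x *\<^sub>R f x)"
    using f by (simp add: locally_integrable_def set_integrable_def)
  note [measurable]
    = borel_measurable_imp_lebesgue[OF Cc_borel[OF g]] borel_measurable_integrable[OF cut]
  have "integrable lebesgue (\<lambda>x. g x *\<^sub>R (indicator (cball 0 R) x *\<^sub>R f x))"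
  proof (rule Bochner_Integration.integrable_bound[OF integrable_scaleR_right[OF cut, of K]])
    show "AE x in lebesgue. norm (g x *\<^sub>R (indicator (cball 0 R) x *\<^sub>R f x))
        \<le> norm (K *\<^sub>R (indicator (cball 0 R) x *\<^sub>R f x))"
      using K by (intro AE_I2) (auto simp: indicator_def mult_right_mono)
  qed measurable
  moreover have "g x *\<^sub>R (indicator (cball 0 R) x *\<^sub>R f x) = g x *\<^sub>R f x" for x
    using R[of x] by (cases "norm x \<le> R") auto
  ultimately show ?thesis by (simp only:)
qed

lemma pairing_scaleR_left: "pairing (\<lambda>x. c * g x) f = c *\<^sub>R pairing g f"
  by (simp add: pairing_def flip: scaleR_scaleR)

lemma pairing_diff_left:
  assumes "g \<in> Cc" "g' \<in> Cc" "locally_integrable f"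
  shows "pairing (\<lambda>x. g x - g' x) f = pairing g f - pairing g' f"
  unfolding pairing_def scaleR_diff_left
  by (intro Bochner_Integration.integral_diff integrable_scaleR_Cc assms)

lemma pairing_sum_left:
  assumes "\<And>i. i \<in> I \<Longrightarrow> g i \<in> Cc" "locally_integrable f"
  shows "pairing (\<lambda>x. \<Sum>i\<in>I. g i x) f = (\<Sum>i\<in>I. pairing (g i) f)"
  unfolding pairing_def scaleR_sum_left
  by (intro Bochner_Integration.integral_sum integrable_scaleR_Cc assms)

lemma pairing_diff_right:
  assumes "g \<in> Cc" "locally_integrable f" "locally_integrable h"
  shows "pairing g (\<lambda>x. f x - h x) = pairing g f - pairing g h"
  unfolding pairing_def scaleR_diff_right
  by (intro Bochner_Integration.integral_diff integrable_scaleR_Cc assms)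

lemma norm_pairing_le_L2:
  assumes g: "g \<in> Cc" and f: "f \<in> L2"
  shows "norm (pairing g f) \<le> sqrt (LINT x|lebesgue. (g x)\<^sup>2) * L2_norm f"
proof -
  note [measurable] = L2_measurable[OF f] borel_measurable_imp_lebesgue[OF Cc_borel[OF g]]
  have "norm (pairing g f) \<le> (LINT x|lebesgue. \<bar>g x * norm (f x)\<bar>)"
    unfolding pairing_def
    using integral_norm_bound[of lebesgue "\<lambda>x. g x *\<^sub>R f x"] by (simp add: abs_mult)
  also have "\<dots> \<le> sqrt (LINT x|lebesgue. (g x)\<^sup>2) * L2_norm f"
    unfolding L2_norm_def
    by (rule Cauchy_Schwarz_integral(2))
       (use Cc_integrable[OF Cc_norm_power2[OF g]] L2_integrable[OF f] in auto)
  finally show ?thesis .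
qed

lemma norm_pairing_le_cball:
  assumes g: "g \<in> Cc" and f: "locally_integrable f"
    and bound: "\<And>x. \<bar>g x\<bar> \<le> e * indicator (cball 0 R) x"
  shows "norm (pairing g f) \<le> e * (LINT x:cball 0 R|lebesgue. norm (f x))"
proof -
  have "set_integrable lebesgue (cball 0 R) f" using f by (simp add: locally_integrable_def)
  then have "integrable lebesgue (\<lambda>x. norm (indicator (cball 0 R) x *\<^sub>R f x))"
    unfolding set_integrable_def by (rule integrable_norm)
  then have "norm (pairing g f) \<le> (LINT x|lebesgue. e * norm (indicator (cball 0 R) x *\<^sub>R f x))"
    unfolding pairing_def
  proof (intro Bochner_Integration.integral_norm_bound_integral integrable_scaleR_Cc g f
      integrable_mult_right)
    show "norm (g x *\<^sub>R f x) \<le> e * norm (indicator (cball 0 R) x *\<^sub>R f x)" for x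
      using mult_right_mono[OF bound[of x] norm_ge_zero[of "f x"]] by (simp add: mult.assoc)
  qed
  then show ?thesis by (simp add: set_lebesgue_integral_def)
qed

lemma convolution_eq_pairing: "convolution f g x = pairing (\<lambda>y. g (x - y)) f"
  by (simp add: convolution_def pairing_def)

lemma convolution_integrable:
  "locally_integrable f \<Longrightarrow> g \<in> Cc \<Longrightarrow> integrable lebesgue (\<lambda>y. g (x - y) *\<^sub>R f y)"
  by (intro integrable_scaleR_Cc Cc_reflect)

lemma convolution_diff_left:
  assumes "locally_integrable f" "locally_integrable f'" "g \<in> Cc"
  shows "convolution (\<lambda>x. f x - f' x) g x = convolution f g x - convolution f' g x"
  unfolding convolution_eq_pairing by (intro pairing_diff_right Cc_reflect assms)

lemma convolution_diff_right:
  assumes "locally_integrable f" "g \<in> Cc" "g' \<in> Cc"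
  shows "convolution f (\<lambda>x. g x - g' x) x = convolution f g x - convolution f g' x"
  unfolding convolution_eq_pairing by (intro pairing_diff_left Cc_reflect assms)

lemma convolution_scaleR_right: "convolution f (\<lambda>x. c * g x) x = c *\<^sub>R convolution f g x"
  unfolding convolution_eq_pairing by (rule pairing_scaleR_left)

lemma convolution_sum_right:
  assumes "locally_integrable f" "\<And>i. i \<in> I \<Longrightarrow> g i \<in> Cc"
  shows "convolution f (\<lambda>x. \<Sum>i\<in>I. g i x) x = (\<Sum>i\<in>I. convolution f (g i) x)"
  unfolding convolution_eq_pairing by (intro pairing_sum_left Cc_reflect assms)

lemma convolution_translate_right: "convolution f (\<lambda>x. g (x + a)) x = convolution f g (x + a)"
  by (simp add: convolution_def algebra_simps)

lemma convolution_of_real: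
  "convolution (\<lambda>y. complex_of_real (f y)) g x = of_real (convolution f g x)"
  by (simp add: convolution_def scaleR_conv_of_real flip: integral_complex_of_real)

lemma pos_mult_less_exists:
  fixes e N :: real
  assumes "0 < e"
  obtains d where "0 < d" "d * N < e"
proof
  show "0 < e / (\<bar>N\<bar> + 1)" using assms by (simp add: add_nonneg_pos)
  have "e * N < e * (\<bar>N\<bar> + 1)" using assms by (intro mult_strict_left_mono) auto
  then show "e / (\<bar>N\<bar> + 1) * N < e" by (simp add: pos_divide_less_eq add_nonneg_pos)
qed

lemma continuous_convolution:
  assumes f: "locally_integrable f" and g: "g \<in> Cc"
  shows "continuous_on UNIV (convolution f g)"
  unfolding continuous_on_iff
proof (intro ballI allI impI)
  fix x :: 'a and e :: real assume "0 < e"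
  obtain R where R: "0 < R" "\<And>x. R < norm x \<Longrightarrow> g x = 0" using Cc_vanish[OF g] by blast
  define N where "N = (LINT y:cball 0 (R + norm x + 1)|lebesgue. norm (f y))"
  obtain e' where e': "0 < e'" "e' * N < e" by (rule pos_mult_less_exists[OF \<open>0 < e\<close>])
  obtain d where d: "0 < d" "\<And>x y. dist y x < d \<Longrightarrow> dist (g y) (g x) < e'"
    using Cc_uniformly_continuous[OF g] e'(1) unfolding uniformly_continuous_on_def
    by (metis UNIV_I)
  have "dist (convolution f g x') (convolution f g x) < e" if x': "dist x' x < min d 1" for x'
  proof -
    let ?h = "\<lambda>y. g (x' - y) - g (x - y)"
    have h_le: "\<bar>?h y\<bar> \<le> e' * indicator (cball 0 (R + norm x + 1)) y" for y
    proof (cases "norm y \<le> R + norm x + 1")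
      case True
      have "dist (g (x' - y)) (g (x - y)) < e'" using x' by (intro d(2)) (simp add: dist_norm)
      then show ?thesis using True by (simp add: dist_real_def)
    next
      case False
      have "R < norm (x' - y)" "R < norm (x - y)"
        using False x' norm_triangle_ineq2[of y x'] norm_triangle_ineq2[of y x]
          norm_triangle_sub[of x' x]
        by (simp_all add: norm_minus_commute dist_norm)
      then show ?thesis using False R by simp
    qed
    have "dist (convolution f g x') (convolution f g x) = norm (pairing ?h f)"
      by (simp add: dist_norm convolution_eq_pairing pairing_diff_left Cc_reflect f g)
    also have "\<dots> \<le> e' * N"
      unfolding N_def by (intro norm_pairing_le_cball[OF _ f h_le] Cc_diff Cc_reflect g)
    also have "\<dots> < e" by (rule e'(2))
    finally show ?thesis .
  qed
  then show "\<exists>d>0. \<forall>x'\<in>UNIV. dist x' x < d \<longrightarrow> dist (convolution f g x') (convolution f g x) < e"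
    using d(1) by (intro exI[of _ "min d 1"]) auto
qed

lemma convolution_borel:
  "locally_integrable f \<Longrightarrow> g \<in> Cc \<Longrightarrow> convolution f g \<in> borel_measurable borel"
  by (intro borel_measurable_continuous_onI continuous_convolution)

lemma lebesgue_integral_affine_borel:
  fixes g :: "'a::euclidean_space \<Rightarrow> 'b::{banach, second_countable_topology}"
  assumes [measurable]: "g \<in> borel_measurable borel" and "c \<noteq> 0"
  shows "(LINT x|lebesgue. g x) = \<bar>c\<bar> ^ DIM('a) *\<^sub>R (LINT x|lebesgue. g (a + c *\<^sub>R x))"
proof -
  have "(LINT x|lborel. g x) = \<bar>c\<bar> ^ DIM('a) *\<^sub>R (LINT x|lborel. g (a + c *\<^sub>R x))"
    by (subst lborel_affine[OF \<open>c \<noteq> 0\<close>, of a]) (simp add: integral_density integral_distr)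
  then show ?thesis by (simp add: integral_completion)
qed

lemma lebesgue_integral_reflect_borel:
  fixes g :: "'a::euclidean_space \<Rightarrow> 'b::{banach, second_countable_topology}"
  assumes "g \<in> borel_measurable borel"
  shows "(LINT y|lebesgue. g (x - y)) = (LINT y|lebesgue. g y)"
  using lebesgue_integral_affine_borel[OF assms, of "-1" x] by simp

lemma lebesgue_integral_translate_borel:
  fixes g :: "'a::euclidean_space \<Rightarrow> 'b::{banach, second_countable_topology}"
  assumes "g \<in> borel_measurable borel"
  shows "(LINT y|lebesgue. g (y + a)) = (LINT y|lebesgue. g y)"
  using lebesgue_integral_affine_borel[OF assms, of 1 a] by (simp add: add.commute)

lemma nn_integral_translate_borel:
  fixes g :: "'a::euclidean_space \<Rightarrow> ennreal"
  assumes [measurable]: "g \<in> borel_measurable borel"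
  shows "(\<integral>\<^sup>+x. g (x + a) \<partial>lebesgue) = (\<integral>\<^sup>+x. g x \<partial>lebesgue)"
proof -
  have "(\<integral>\<^sup>+x. g (x + a) \<partial>lborel) = (\<integral>\<^sup>+x. g x \<partial>lborel)"
    by (subst (2) lborel_affine[of 1 a])
       (simp_all add: nn_integral_density nn_integral_distr add.commute)
  then show ?thesis by (simp add: nn_integral_completion)
qed

lemma norm_convolution_le_L2:
  assumes f: "f \<in> L2" and g: "g \<in> Cc"
  shows "norm (convolution f g x) \<le> sqrt (LINT y|lebesgue. (g y)\<^sup>2) * L2_norm f"
proof -
  have "(\<lambda>y. (g y)\<^sup>2) \<in> borel_measurable borel" using Cc_borel[OF g] by measurable
  from lebesgue_integral_reflect_borel[OF this] show ?thesis
    using norm_pairing_le_L2[OF Cc_reflect[OF g] f] by (simp add: convolution_eq_pairing)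
qed

lemma sigma_finite_lebesgue: "sigma_finite_measure (lebesgue :: 'a::euclidean_space measure)"
proof
  obtain A :: "'a set set" where "countable A" "A \<subseteq> sets lborel" "\<Union>A = space lborel"
      "\<forall>a\<in>A. emeasure lborel a \<noteq> \<infinity>"
    using sigma_finite_measure.sigma_finite_countable[OF sigma_finite_lborel] by blast
  then show "\<exists>A. countable A \<and> A \<subseteq> sets lebesgue \<and> \<Union>A = space lebesgue \<and>
      (\<forall>a\<in>A. emeasure lebesgue (a::'a set) \<noteq> \<infinity>)"
    by (intro exI[of _ A]) (auto simp: emeasure_completion)
qed

lemma nn_integral_convolution:
  fixes f g :: "'a::euclidean_space \<Rightarrow> ennreal"
  assumes [measurable]: "f \<in> borel_measurable lebesgue" "g \<in> borel_measurable borel"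
  shows "(\<integral>\<^sup>+x. \<integral>\<^sup>+y. g (x - y) * f y \<partial>lebesgue \<partial>lebesgue)
    = (\<integral>\<^sup>+x. g x \<partial>lebesgue) * (\<integral>\<^sup>+x. f x \<partial>lebesgue)"
proof -
  interpret pair_sigma_finite "lebesgue :: 'a measure" "lebesgue :: 'a measure"
    by (simp add: pair_sigma_finite_def sigma_finite_lebesgue)
  have "(\<integral>\<^sup>+x. \<integral>\<^sup>+y. g (x - y) * f y \<partial>lebesgue \<partial>lebesgue)
      = (\<integral>\<^sup>+y. \<integral>\<^sup>+x. g (x - y) * f y \<partial>lebesgue \<partial>lebesgue)"
    by (rule Fubini') measurable
  also have "\<dots> = (\<integral>\<^sup>+y. (\<integral>\<^sup>+x. g x \<partial>lebesgue) * f y \<partial>lebesgue)"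
    using nn_integral_translate_borel[of g "- y" for y] by (simp add: nn_integral_multc)
  finally show ?thesis by (simp add: nn_integral_cmult)
qed

lemma norm_convolution_power2_le:
  assumes f: "f \<in> L2" and g: "g \<in> Cc"
  shows "ennreal ((norm (convolution f g x))\<^sup>2)
    \<le> ennreal (LINT y|lebesgue. \<bar>g y\<bar>)
      * (\<integral>\<^sup>+y. ennreal \<bar>g (x - y)\<bar> * ennreal ((norm (f y))\<^sup>2) \<partial>lebesgue)"
proof -
  note [measurable] = L2_measurable[OF f] Cc_borel[OF g]
  have mass: "(\<integral>\<^sup>+y. ennreal \<bar>g (x - y)\<bar> \<partial>lebesgue) = ennreal (LINT y|lebesgue. \<bar>g y\<bar>)"
    using Cc_integrable[OF Cc_norm[OF Cc_reflect[OF g]]]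
      lebesgue_integral_reflect_borel[of "\<lambda>y. \<bar>g y\<bar>" x]
    by (simp add: nn_integral_eq_integral)
  have "ennreal ((norm (convolution f g x))\<^sup>2) = (ennreal (norm (convolution f g x)))\<^sup>2"
    by (simp add: ennreal_power)
  also have "\<dots> \<le> (\<integral>\<^sup>+y. ennreal (norm (g (x - y) *\<^sub>R f y)) \<partial>lebesgue)\<^sup>2"
    unfolding convolution_def
    by (intro power_mono integral_norm_bound_ennreal convolution_integrable
        L2_imp_locally_integrable f g) auto
  also have "\<dots>
    = (\<integral>\<^sup>+y. ennreal (sqrt \<bar>g (x - y)\<bar>) * ennreal (sqrt \<bar>g (x - y)\<bar> * norm (f y)) \<partial>lebesgue)\<^sup>2"
    by (simp flip: ennreal_mult mult.assoc)
  also have "\<dots> \<le> (\<integral>\<^sup>+y. (ennreal (sqrt \<bar>g (x - y)\<bar>))\<^sup>2 \<partial>lebesgue) *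
      (\<integral>\<^sup>+y. (ennreal (sqrt \<bar>g (x - y)\<bar> * norm (f y)))\<^sup>2 \<partial>lebesgue)"
    by (rule Cauchy_Schwarz_nn_integral) auto
  finally show ?thesis by (simp add: ennreal_power power_mult_distrib mass ennreal_mult)
qed

lemma convolution_Young:
  assumes f: "f \<in> L2" and g: "g \<in> Cc"
  shows "convolution f g \<in> L2"
    and "L2_norm (convolution f g) \<le> (LINT y|lebesgue. \<bar>g y\<bar>) * L2_norm f"
proof -
  define A where "A = (LINT y|lebesgue. \<bar>g y\<bar>)"
  have mass: "0 \<le> A" "(\<integral>\<^sup>+y. ennreal \<bar>g y\<bar> \<partial>lebesgue) = ennreal A"
    using Cc_integrable[OF Cc_norm[OF g]] by (simp_all add: nn_integral_eq_integral A_def)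
  note [measurable] = L2_measurable[OF f] Cc_borel[OF g]
  have meas [measurable]: "convolution f g \<in> borel_measurable lebesgue"
    by (intro borel_measurable_imp_lebesgue convolution_borel L2_imp_locally_integrable f g)
  have "(\<integral>\<^sup>+x. ennreal ((norm (convolution f g x))\<^sup>2) \<partial>lebesgue)
      \<le> (\<integral>\<^sup>+x. ennreal A
        * (\<integral>\<^sup>+y. ennreal \<bar>g (x - y)\<bar> * ennreal ((norm (f y))\<^sup>2) \<partial>lebesgue) \<partial>lebesgue)"
    unfolding A_def by (intro nn_integral_mono norm_convolution_power2_le f g)
  also have "\<dots>
    = ennreal A * (\<integral>\<^sup>+x. \<integral>\<^sup>+y. ennreal \<bar>g (x - y)\<bar> * ennreal ((norm (f y))\<^sup>2) \<partial>lebesgue \<partial>lebesgue)"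
    by (intro nn_integral_cmult sigma_finite_measure.borel_measurable_nn_integral
        sigma_finite_lebesgue) measurable
  also have "\<dots> = ennreal A * (ennreal A * ennreal ((L2_norm f)\<^sup>2))"
    using nn_integral_convolution[of "\<lambda>y. ennreal ((norm (f y))\<^sup>2)" "\<lambda>y. ennreal \<bar>g y\<bar>"]
      L2_integrable[OF f]
    by (simp add: mass(2) nn_integral_eq_integral L2_norm_power2)
  also have "\<dots> = ennreal ((A * L2_norm f)\<^sup>2)"
    using mass(1) by (simp add: power2_eq_square ac_simps flip: ennreal_mult)
  finally have bound: "(\<integral>\<^sup>+x. ennreal ((norm (convolution f g x))\<^sup>2) \<partial>lebesgue)
    \<le> ennreal ((A * L2_norm f)\<^sup>2)" .
  have integrable: "integrable lebesgue (\<lambda>x. (norm (convolution f g x))\<^sup>2)"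
    using bound by (intro integrableI_nonneg) (auto intro: le_less_trans)
  then show "convolution f g \<in> L2" using meas by (simp add: L2_def)
  have "(L2_norm (convolution f g))\<^sup>2 \<le> (A * L2_norm f)\<^sup>2"
    using bound integrable by (simp add: L2_norm_power2 nn_integral_eq_integral)
  then show "L2_norm (convolution f g) \<le> (LINT y|lebesgue. \<bar>g y\<bar>) * L2_norm f"
    unfolding A_def[symmetric] by (rule power2_le_imp_le) (simp add: mass(1))
qed


section \<open>Density and mollification\<close>

lemma bounded_support_AE_limit_Cc:
  fixes f :: "'a::euclidean_space \<Rightarrow> 'b::euclidean_space"
  assumes f: "f \<in> borel_measurable lebesgue" and K: "0 < K"
    and f_le: "\<And>x. norm (f x) \<le> K" and f_vanish: "\<And>x. K < norm x \<Longrightarrow> f x = 0"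
  obtains h :: "nat \<Rightarrow> 'a \<Rightarrow> 'b" where "\<And>n. h n \<in> Cc" "\<And>n x. norm (h n x) \<le> K"
    "\<And>n x. K + 1 < norm x \<Longrightarrow> h n x = 0" "AE x in lebesgue. (\<lambda>n. h n x) \<longlonglongrightarrow> f x"
proof -
  have "f measurable_on UNIV"
    using f by (simp add: measurable_on_iff_borel_measurable lebesgue_on_UNIV_eq)
  then obtain N g where N: "negligible N" and g_cont: "\<And>n. continuous_on UNIV (g n)"
      and g_lim: "\<And>x. x \<notin> N \<Longrightarrow> (\<lambda>n. g n x) \<longlonglongrightarrow> f x"
    unfolding measurable_on_def by auto
  define cutoff :: "'a \<Rightarrow> real" where "cutoff x = max 0 (min 1 (K + 1 - norm x))" for x
  define proj :: "'b \<Rightarrow> 'b" where "proj = closest_point (cball 0 K)"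
  have cutoff_bounds: "0 \<le> cutoff x" "cutoff x \<le> 1" for x by (auto simp: cutoff_def)
  have proj_cont: "continuous_on UNIV proj"
    unfolding proj_def using K by (intro continuous_on_closest_point) auto
  have proj_le: "norm (proj z) \<le> K" for z
    using closest_point_in_set[of "cball 0 K" z] K by (simp add: proj_def)
  have proj_id: "proj z = z" if "norm z \<le> K" for z
    using that by (simp add: proj_def closest_point_self)
  define h where "h n x = cutoff x *\<^sub>R proj (g n x)" for n x
  have h_vanish: "h n x = 0" if "K + 1 < norm x" for n x using that by (simp add: h_def cutoff_def)
  have "continuous_on UNIV (h n)" for n
    unfolding h_def cutoff_def
    by (intro continuous_intros continuous_on_compose2[OF proj_cont g_cont]) auto
  then have h_Cc: "h n \<in> Cc" for n by (rule CcI[OF _ h_vanish])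
  have h_le: "norm (h n x) \<le> K" for n x
    using mult_mono[OF cutoff_bounds(2)[of x] proj_le[of "g n x"]] cutoff_bounds[of x]
    by (simp add: h_def)
  have "(\<lambda>n. h n x) \<longlonglongrightarrow> f x" if "x \<notin> N" for x
  proof -
    have "isCont proj (f x)" using proj_cont by (simp add: continuous_on_eq_continuous_at)
    then have "(\<lambda>n. h n x) \<longlonglongrightarrow> cutoff x *\<^sub>R proj (f x)"
      unfolding h_def by (intro tendsto_intros isCont_tendsto_compose[of _ proj] g_lim that)
    also have "cutoff x *\<^sub>R proj (f x) = f x"
      using f_vanish[of x] K by (cases "norm x \<le> K") (auto simp: proj_id f_le cutoff_def)
    finally show ?thesis .
  qed
  then have "AE x in lebesgue. (\<lambda>n. h n x) \<longlonglongrightarrow> f x"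
    using N by (intro AE_I'[of N]) (auto simp: negligible_iff_null_sets)
  then show ?thesis using that[of h] h_Cc h_le h_vanish by blast
qed

lemma L2_approx_Cc_bounded_support:
  fixes f :: "'a::euclidean_space \<Rightarrow> complex"
  assumes f: "f \<in> borel_measurable lebesgue" and K: "0 < K"
    and f_le: "\<And>x. norm (f x) \<le> K" and f_vanish: "\<And>x. K < norm x \<Longrightarrow> f x = 0" and "0 < e"
  obtains g where "g \<in> Cc" "L2_norm (\<lambda>x. g x - f x) < e"
proof -
  obtain h :: "nat \<Rightarrow> 'a \<Rightarrow> complex" where h: "\<And>n. h n \<in> Cc" "\<And>n x. norm (h n x) \<le> K"
    "\<And>n x. K + 1 < norm x \<Longrightarrow> h n x = 0" "AE x in lebesgue. (\<lambda>n. h n x) \<longlonglongrightarrow> f x"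
    by (rule bounded_support_AE_limit_Cc[OF f K f_le f_vanish]) blast+
  have "(\<lambda>n. L2_norm (\<lambda>x. h n x - f x)) \<longlonglongrightarrow> 0"
  proof (rule L2_norm_dominated_convergence[OF _ f _ _ h(4)])
    show "integrable lebesgue (\<lambda>x. (2 * K)\<^sup>2 * indicator (cball (0::'a) (K + 1)) x :: real)"
      by (intro integrable_mult_right integrable_indicator_cball)
    show "h n \<in> borel_measurable lebesgue" for n by (intro borel_measurable_imp_lebesgue Cc_borel h)
    have "(norm (h n x - f x))\<^sup>2 \<le> (2 * K)\<^sup>2 * indicator (cball 0 (K + 1)) x" for n x
    proof (cases "norm x \<le> K + 1")
      case True
      have "norm (h n x - f x) \<le> 2 * K"
        using norm_triangle_ineq4[of "h n x" "f x"] h(2)[of n x] f_le[of x] by linarith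
      then have "(norm (h n x - f x))\<^sup>2 \<le> (2 * K)\<^sup>2" by (rule power_mono) simp
      then show ?thesis using True by simp
    qed (use h(3) f_vanish in auto)
    then show "AE x in lebesgue. (norm (h n x - f x))\<^sup>2 \<le> (2 * K)\<^sup>2 * indicator (cball 0 (K + 1)) x"
      for n
      by simp
  qed
  then obtain n where "L2_norm (\<lambda>x. h n x - f x) < e"
    using order_tendstoD(2)[OF _ \<open>0 < e\<close>] eventually_happens'[OF sequentially_bot] by blast
  then show ?thesis using that h(1) by blast
qed

lemma L2_approx_bounded_support:
  fixes f :: "'a::euclidean_space \<Rightarrow> complex"
  assumes f: "f \<in> L2" and "0 < e"
  obtains h K where "h \<in> L2" "0 < K" "\<And>x. norm (h x) \<le> K" "\<And>x. K < norm x \<Longrightarrow> h x = 0"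
    "L2_norm (\<lambda>x. h x - f x) < e"
proof -
  note [measurable] = L2_measurable[OF f]
  define h where "h n x = (if norm x \<le> real n \<and> norm (f x) \<le> real n then f x else 0)" for n x
  have h_meas [measurable]: "h n \<in> borel_measurable lebesgue" for n unfolding h_def by measurable
  have h_L2: "h n \<in> L2" for n by (rule L2_norm_mono(1)[OF h_meas f]) (auto simp: h_def)
  have "(\<lambda>n. L2_norm (\<lambda>x. h n x - f x)) \<longlonglongrightarrow> 0"
  proof (rule L2_norm_dominated_convergence[OF h_meas L2_measurable[OF f] L2_integrable[OF f]])
    show "AE x in lebesgue. (norm (h n x - f x))\<^sup>2 \<le> (norm (f x))\<^sup>2" for n
      by (intro AE_I2) (auto simp: h_def)
    have "\<forall>\<^sub>F n in sequentially. h n x = f x" for x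
      using eventually_ge_at_top[of "nat \<lceil>max (norm x) (norm (f x))\<rceil>"]
      by eventually_elim (auto simp: h_def nat_le_iff ceiling_le_iff)
    then show "AE x in lebesgue. (\<lambda>n. h n x) \<longlonglongrightarrow> f x" by (simp add: tendsto_eventually)
  qed
  then have "\<forall>\<^sub>F n in sequentially. L2_norm (\<lambda>x. h n x - f x) < e"
    using \<open>0 < e\<close> by (rule order_tendstoD(2))
  then have "\<forall>\<^sub>F n in sequentially. L2_norm (\<lambda>x. h n x - f x) < e \<and> 1 \<le> n"
    using eventually_ge_at_top[of 1] by eventually_elim simp
  then obtain n where "L2_norm (\<lambda>x. h n x - f x) < e" "1 \<le> n"
    using eventually_happens'[OF sequentially_bot] by blast
  then show ?thesis using that[OF h_L2, of "real n" n] by (simp add: h_def)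
qed

lemma L2_approx_Cc:
  fixes f :: "'a::euclidean_space \<Rightarrow> complex"
  assumes f: "f \<in> L2" and "0 < e"
  obtains g where "g \<in> Cc" "L2_norm (\<lambda>x. g x - f x) < e"
proof -
  have "0 < e / 2" using \<open>0 < e\<close> by simp
  obtain h K where h: "h \<in> L2" "0 < K" "\<And>x. norm (h x) \<le> K" "\<And>x. K < norm x \<Longrightarrow> h x = 0"
    and h_close: "L2_norm (\<lambda>x. h x - f x) < e / 2"
    by (rule L2_approx_bounded_support[OF f \<open>0 < e / 2\<close>]) blast
  obtain g where g: "g \<in> Cc" and g_close: "L2_norm (\<lambda>x. g x - h x) < e / 2"
    by (rule L2_approx_Cc_bounded_support[OF L2_measurable[OF h(1)] h(2-4) \<open>0 < e / 2\<close>])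
  have "L2_norm (\<lambda>x. g x - f x) < e"
    using L2_norm_diff_triangle_ineq[OF Cc_imp_L2[OF g] h(1) f] g_close h_close by linarith
  then show ?thesis using that g by blast
qed

lemma L2_tendsto_0_by_density:
  fixes A :: "'i \<Rightarrow> ('a::euclidean_space \<Rightarrow> complex) \<Rightarrow> 'a \<Rightarrow> complex"
  assumes f: "f \<in> L2"
    and Cc_lim: "\<And>g. g \<in> Cc \<Longrightarrow> ((\<lambda>i. L2_norm (A i g)) \<longlongrightarrow> 0) F"
    and bound: "\<forall>\<^sub>F i in F. \<forall>g\<in>Cc. L2_norm (A i f) \<le> L2_norm (A i g) + K * L2_norm (\<lambda>x. g x - f x)"
  shows "((\<lambda>i. L2_norm (A i f)) \<longlongrightarrow> 0) F"
proof (rule tendstoI)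
  fix e :: real assume "0 < e"
  then have "0 < e / 2" by simp
  then obtain d where d: "0 < d" "d * \<bar>K\<bar> < e / 2" by (rule pos_mult_less_exists)
  obtain g where g: "g \<in> Cc" "L2_norm (\<lambda>x. g x - f x) < d" by (rule L2_approx_Cc[OF f d(1)])
  have "K * L2_norm (\<lambda>x. g x - f x) \<le> \<bar>K\<bar> * d"
    using g(2) by (intro mult_mono) auto
  then have K_le: "K * L2_norm (\<lambda>x. g x - f x) < e / 2" using d(2) by (simp add: mult.commute)
  have "\<forall>\<^sub>F i in F. L2_norm (A i g) < e / 2"
    by (rule order_tendstoD(2)[OF Cc_lim[OF g(1)]]) (use \<open>0 < e\<close> in simp)
  then show "\<forall>\<^sub>F i in F. dist (L2_norm (A i f)) 0 < e"
    using bound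
  proof eventually_elim
    case (elim i)
    then have "L2_norm (A i f) \<le> L2_norm (A i g) + K * L2_norm (\<lambda>x. g x - f x)" using g(1) by blast
    then show ?case using elim(1) K_le by simp
  qed
qed

definition dilate :: "('a::euclidean_space \<Rightarrow> real) \<Rightarrow> real \<Rightarrow> 'a \<Rightarrow> real" where
  "dilate \<psi> c x = \<psi> (x /\<^sub>R c) / c ^ DIM('a)"

abbreviation mollify ::
  "('a::euclidean_space \<Rightarrow> real) \<Rightarrow> real \<Rightarrow> ('a \<Rightarrow> 'b) \<Rightarrow> 'a \<Rightarrow> 'b::{banach, second_countable_topology}"
    where
  "mollify \<psi> c f \<equiv> convolution f (dilate \<psi> c)"

lemma mollifier_net_eq_dilate: "mollifier_net \<psi> \<omega> \<epsilon> = dilate \<psi> (\<omega> \<epsilon>)"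
  by (simp add: fun_eq_iff mollifier_net_def dilate_def)

lemma dilate_eq_scaled_affine: "dilate \<psi> c = (\<lambda>x. inverse (c ^ DIM('a)) * \<psi> (0 + inverse c *\<^sub>R x))"
  for \<psi> :: "'a::euclidean_space \<Rightarrow> real"
  by (simp add: fun_eq_iff dilate_def divide_inverse mult.commute)

lemma dilate_Cc: "\<psi> \<in> Cc \<Longrightarrow> 0 < c \<Longrightarrow> dilate \<psi> c \<in> Cc"
  unfolding dilate_eq_scaled_affine
  using Cc_scaleR[OF Cc_compose_affine[of \<psi> "inverse c" 0]] by simp

lemma lebesgue_integral_dilate:
  fixes \<psi> :: "'a::euclidean_space \<Rightarrow> real"
  assumes "\<psi> \<in> Cc" "0 < c"
  shows "(LINT x|lebesgue. dilate \<psi> c x) = (LINT x|lebesgue. \<psi> x)"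
  using lebesgue_integral_affine_borel[OF Cc_borel[OF dilate_Cc[OF assms]], of c 0] assms(2)
  by (simp add: dilate_def)

locale mollifier =
  fixes \<psi> :: "'a::euclidean_space \<Rightarrow> real" and S :: real
  assumes Cc: "\<psi> \<in> Cc" and nonneg: "0 \<le> \<psi> x" and integral_1: "(LINT x|lebesgue. \<psi> x) = 1"
    and radius_pos: "0 < S" and vanish: "S < norm x \<Longrightarrow> \<psi> x = 0"
begin

lemma dilate_nonneg: "0 < c \<Longrightarrow> 0 \<le> dilate \<psi> c x"
  by (simp add: dilate_def nonneg)

lemma dilate_vanish: "0 < c \<Longrightarrow> c * S < norm x \<Longrightarrow> dilate \<psi> c x = 0"
  by (simp add: dilate_def vanish pos_less_divide_eq mult.commute flip: divide_inverse_commute)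

lemma integral_abs_dilate: "0 < c \<Longrightarrow> (LINT x|lebesgue. \<bar>dilate \<psi> c x\<bar>) = 1"
  by (simp add: dilate_nonneg lebesgue_integral_dilate[OF Cc] integral_1)

lemma integral_dilate_reflect: "0 < c \<Longrightarrow> (LINT y|lebesgue. dilate \<psi> c (x - y)) = 1"
  by (simp add: lebesgue_integral_reflect_borel Cc_borel dilate_Cc Cc lebesgue_integral_dilate
      integral_1)

lemma norm_mollify_minus_le:
  fixes f :: "'a \<Rightarrow> 'b::{banach, second_countable_topology}"
  assumes f: "locally_integrable f" and c_pos: "0 < c"
    and close: "AE y in lebesgue. dist x y \<le> c * S \<longrightarrow> norm (f y - a) \<le> e"
  shows "norm (mollify \<psi> c f x - a) \<le> e"
proof -
  let ?D = "\<lambda>y. dilate \<psi> c (x - y)"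
  have D_integrable: "integrable lebesgue ?D" by (intro Cc_integrable Cc_reflect dilate_Cc Cc c_pos)
  have fD_integrable: "integrable lebesgue (\<lambda>y. ?D y *\<^sub>R f y)"
    by (intro convolution_integrable f dilate_Cc Cc c_pos)
  have "mollify \<psi> c f x - a = (LINT y|lebesgue. ?D y *\<^sub>R (f y - a))"
    using D_integrable fD_integrable integral_dilate_reflect[OF c_pos]
    by (simp add: convolution_def scaleR_diff_right)
  also have "norm \<dots> \<le> (LINT y|lebesgue. norm (?D y *\<^sub>R (f y - a)))"
    by (rule integral_norm_bound)
  also have "\<dots> \<le> (LINT y|lebesgue. ?D y * e)"
  proof (rule integral_mono_AE)
    show "integrable lebesgue (\<lambda>y. norm (?D y *\<^sub>R (f y - a)))"
      unfolding scaleR_diff_right using D_integrable fD_integrable by (intro integrable_norm) simp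
    show "integrable lebesgue (\<lambda>y. ?D y * e)" using D_integrable by simp
    show "AE y in lebesgue. norm (?D y *\<^sub>R (f y - a)) \<le> ?D y * e"
      using close
    proof eventually_elim
      case (elim y)
      then show ?case
        using dilate_vanish[OF c_pos, of "x - y"] dilate_nonneg[OF c_pos, of "x - y"]
        by (cases "dist x y \<le> c * S") (auto simp: dist_norm mult_left_mono)
    qed
  qed
  also have "\<dots> = e" using integral_dilate_reflect[OF c_pos] by simp
  finally show ?thesis .
qed

lemma mollify_cong_ball:
  fixes f f' :: "'a \<Rightarrow> 'b::{banach, second_countable_topology}"
  assumes "0 < c" "\<And>y. dist x y \<le> c * S \<Longrightarrow> f y = f' y"
  shows "mollify \<psi> c f x = mollify \<psi> c f' x"
  unfolding convolution_def
proof (intro Bochner_Integration.integral_cong refl)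
  show "dilate \<psi> c (x - y) *\<^sub>R f y = dilate \<psi> c (x - y) *\<^sub>R f' y" for y
    using assms(2)[of y] dilate_vanish[OF assms(1), of "x - y"]
    by (cases "dist x y \<le> c * S") (auto simp: dist_norm)
qed

lemma mollify_tendsto_pointwise:
  fixes f :: "'a \<Rightarrow> 'b::{banach, second_countable_topology}"
  assumes f: "continuous_on UNIV f"
  shows "((\<lambda>c. mollify \<psi> c f x) \<longlongrightarrow> f x) (at_right 0)"
proof (rule tendstoI)
  fix e :: real assume "0 < e"
  have "0 < e / 2" using \<open>0 < e\<close> by simp
  then obtain d where d: "0 < d" "\<And>y. dist y x < d \<Longrightarrow> dist (f y) (f x) < e / 2"
    using f unfolding continuous_on_iff by (metis UNIV_I)
  have "dist (mollify \<psi> c f x) (f x) < e" if c_small: "0 < c" "c < d / S" for c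
  proof -
    have "c * S < d" using c_small radius_pos by (simp add: field_simps)
    then have "norm (f y - f x) \<le> e / 2" if "dist x y \<le> c * S" for y
      using d(2)[of y] that by (simp add: dist_norm norm_minus_commute)
    then have "norm (mollify \<psi> c f x - f x) \<le> e / 2"
      by (intro norm_mollify_minus_le continuous_imp_locally_integrable f c_small) auto
    then show ?thesis using \<open>0 < e\<close> by (simp add: dist_norm)
  qed
  then show "\<forall>\<^sub>F c in at_right 0. dist (mollify \<psi> c f x) (f x) < e"
    unfolding eventually_at_right_field using d(1) radius_pos by (intro exI[of _ "d / S"]) auto
qed

lemma L2_mollify: "f \<in> L2 \<Longrightarrow> 0 < c \<Longrightarrow> mollify \<psi> c f \<in> L2"
  by (intro convolution_Young(1) dilate_Cc Cc)

lemma L2_norm_mollify_le: "f \<in> L2 \<Longrightarrow> 0 < c \<Longrightarrow> L2_norm (mollify \<psi> c f) \<le> L2_norm f"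
  using convolution_Young(2)[OF _ dilate_Cc[OF Cc], of f c] by (simp add: integral_abs_dilate)

lemma Linf_mollify:
  assumes q: "q \<in> Linf" and c_pos: "0 < c"
  shows "mollify \<psi> c q \<in> Linf"
    and "Linf_norm (mollify \<psi> c q) \<le> Linf_norm q"
proof -
  have loc: "locally_integrable q" by (rule Linf_imp_locally_integrable[OF q])
  have "AE y in lebesgue. dist x y \<le> c * S \<longrightarrow> norm (q y - 0) \<le> Linf_norm q" for x
    using AE_abs_le_Linf_norm[OF q] by eventually_elim simp
  then have bound: "\<bar>mollify \<psi> c q x\<bar> \<le> Linf_norm q" for x
    using norm_mollify_minus_le[OF loc c_pos, of x 0] by simp
  have meas: "mollify \<psi> c q \<in> borel_measurable lebesgue"
    by (intro borel_measurable_imp_lebesgue convolution_borel loc dilate_Cc Cc c_pos)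
  show "mollify \<psi> c q \<in> Linf" "Linf_norm (mollify \<psi> c q) \<le> Linf_norm q"
    by (rule LinfI[OF meas AE_I2[OF bound]])+
qed

lemma mollify_Cc_uniform_approx:
  fixes g :: "'a \<Rightarrow> 'b::{banach, second_countable_topology}"
  assumes g: "g \<in> Cc" and R: "0 < R" "\<And>x. R < norm x \<Longrightarrow> g x = 0" and "0 < e"
  obtains d where "0 < d" "\<And>c x. 0 < c \<Longrightarrow> c < d \<Longrightarrow>
    norm (mollify \<psi> c g x - g x) \<le> e * indicator (cball 0 (R + S)) x"
proof -
  have loc: "locally_integrable g"
    by (rule continuous_imp_locally_integrable[OF Cc_continuous[OF g]])
  obtain d where d: "0 < d" "\<And>x y. dist y x < d \<Longrightarrow> dist (g y) (g x) < e"
    using Cc_uniformly_continuous[OF g] \<open>0 < e\<close> unfolding uniformly_continuous_on_def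
    by (metis UNIV_I)
  have "norm (mollify \<psi> c g x - g x) \<le> e * indicator (cball 0 (R + S)) x"
    if c_small: "0 < c" "c < min 1 (d / S)" for c x
  proof -
    have cS_small: "c * S < d" "c * S \<le> S" using c_small radius_pos by (auto simp: field_simps)
    show ?thesis
    proof (cases "norm x \<le> R + S")
      case True
      have "norm (g y - g x) \<le> e" if "dist x y \<le> c * S" for y
        using d(2)[of y x] that cS_small(1) by (simp add: dist_norm norm_minus_commute)
      then show ?thesis using True norm_mollify_minus_le[OF loc c_small(1), of x "g x" e] by simp
    next
      case False
      have "g y = 0" if "dist x y \<le> c * S" for y
        using that cS_small(2) False norm_triangle_sub[of x y] by (intro R(2)) (simp add: dist_norm)
      then show ?thesis
        using False R radius_pos norm_mollify_minus_le[OF loc c_small(1), of x 0 0] by simp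
    qed
  qed
  then show ?thesis using that[of "min 1 (d / S)"] d(1) radius_pos by simp
qed

lemma L2_mollify_tendsto_Cc:
  fixes g :: "'a \<Rightarrow> complex"
  assumes g: "g \<in> Cc"
  shows "((\<lambda>c. L2_norm (\<lambda>x. mollify \<psi> c g x - g x)) \<longlongrightarrow> 0) (at_right 0)"
proof (rule tendstoI)
  fix e :: real assume "0 < e"
  obtain R where R: "0 < R" "\<And>x. R < norm x \<Longrightarrow> g x = 0" using Cc_vanish[OF g] by blast
  define N where "N = sqrt (measure lebesgue (cball (0::'a) (R + S)))"
  obtain e' where e': "0 < e'" "e' * N < e" by (rule pos_mult_less_exists[OF \<open>0 < e\<close>])
  obtain d where d: "0 < d" "\<And>c x. 0 < c \<Longrightarrow> c < d \<Longrightarrow>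
      norm (mollify \<psi> c g x - g x) \<le> e' * indicator (cball 0 (R + S)) x"
    by (rule mollify_Cc_uniform_approx[OF g R e'(1)]) blast+
  have "dist (L2_norm (\<lambda>x. mollify \<psi> c g x - g x)) 0 < e" if c_small: "0 < c" "c < d" for c
  proof -
    have "L2_norm (\<lambda>x. mollify \<psi> c g x - g x) \<le> e' * N"
      unfolding N_def
    proof (rule L2_norm_le_cball(2)[OF _ _ AE_I2[OF d(2)[OF c_small]]])
      show "(\<lambda>x. mollify \<psi> c g x - g x) \<in> borel_measurable lebesgue"
        by (intro L2_measurable L2_diff L2_mollify Cc_imp_L2 g c_small(1))
    qed (use e'(1) in simp)
    then show ?thesis using e'(2) by simp
  qed
  then show "\<forall>\<^sub>F c in at_right 0. dist (L2_norm (\<lambda>x. mollify \<psi> c g x - g x)) 0 < e"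
    unfolding eventually_at_right_field using d(1) by blast
qed

lemma L2_mollify_tendsto:
  assumes f: "f \<in> L2"
  shows "((\<lambda>c. L2_norm (\<lambda>x. mollify \<psi> c f x - f x)) \<longlongrightarrow> 0) (at_right 0)"
proof (rule L2_tendsto_0_by_density[where A = "\<lambda>c g x. mollify \<psi> c g x - g x" and K = 2, OF f])
  show "((\<lambda>c. L2_norm (\<lambda>x. mollify \<psi> c g x - g x)) \<longlongrightarrow> 0) (at_right 0)"
    if "g \<in> Cc" for g :: "'a \<Rightarrow> complex" using that by (rule L2_mollify_tendsto_Cc)
  have "L2_norm (\<lambda>x. mollify \<psi> c f x - f x)
      \<le> L2_norm (\<lambda>x. mollify \<psi> c g x - g x) + 2 * L2_norm (\<lambda>x. g x - f x)"
    if c_pos: "0 < c" and "g \<in> Cc" for c g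
  proof -
    have g: "g \<in> L2" by (rule Cc_imp_L2) fact
    have diff: "mollify \<psi> c f x - mollify \<psi> c g x
        = mollify \<psi> c (\<lambda>x. f x - g x) x" for x
      by (simp add: convolution_diff_left L2_imp_locally_integrable f g dilate_Cc Cc c_pos)
    have "L2_norm (\<lambda>x. mollify \<psi> c f x - mollify \<psi> c g x) \<le> L2_norm (\<lambda>x. f x - g x)"
      unfolding diff by (intro L2_norm_mollify_le L2_diff f g c_pos)
    moreover note L2_norm_diff_triangle_ineq[OF L2_mollify[OF f c_pos] L2_mollify[OF g c_pos] f]
      L2_norm_diff_triangle_ineq[OF L2_mollify[OF g c_pos] g f]
    ultimately show ?thesis by (simp add: L2_norm_minus_commute[of f g])
  qed
  then show "\<forall>\<^sub>F c in at_right 0. \<forall>g\<in>Cc. L2_norm (\<lambda>x. mollify \<psi> c f x - f x)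
      \<le> L2_norm (\<lambda>x. mollify \<psi> c g x - g x) + 2 * L2_norm (\<lambda>x. g x - f x)"
    unfolding eventually_at_right_field by (intro exI[of _ 1]) auto
qed

text \<open>On the support of \<open>g\<close> the mollification sees \<open>q\<close> only in a fixed ball,
  where \<open>q\<close> is square integrable.\<close>

lemma L2_mollify_mult_tendsto_Cc:
  fixes g :: "'a \<Rightarrow> complex"
  assumes q: "q \<in> Linf" and g: "g \<in> Cc"
  shows "((\<lambda>c. L2_norm (\<lambda>x. (mollify \<psi> c q x - q x) *\<^sub>R g x)) \<longlongrightarrow> 0) (at_right 0)"
proof -
  obtain R where R: "0 < R" "\<And>x. R < norm x \<Longrightarrow> g x = 0" using Cc_vanish[OF g] by blast
  obtain K where K: "0 < K" "\<And>x. norm (g x) \<le> K" using Cc_bounded[OF g] by blast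
  note [measurable] = Linf_measurable[OF q] borel_measurable_imp_lebesgue[OF Cc_borel[OF g]]
  define p :: "'a \<Rightarrow> complex" where "p x = of_real (indicator (cball 0 (R + S)) x * q x)" for x
  have p_le: "AE x in lebesgue. norm (p x) \<le> Linf_norm q * indicator (cball 0 (R + S)) x"
    using AE_abs_le_Linf_norm[OF q] by eventually_elim (simp add: p_def indicator_def)
  have p: "p \<in> L2"
    by (rule L2_norm_le_cball(1)[OF _ Linf_norm_nonneg[OF q] p_le]) (simp add: p_def)
  let ?p = "\<lambda>c x. mollify \<psi> c p x - p x" and ?q = "\<lambda>c x. mollify \<psi> c q x - q x"
  have p_eq_q: "?p c x = of_real (?q c x)" if c_small: "0 < c" "c < 1" and x: "norm x \<le> R" for c x
  proof -
    have p_eq: "p y = of_real (q y)" if "dist x y \<le> S" for y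
      using that x norm_triangle_sub[of y x] by (simp add: p_def dist_norm norm_minus_commute)
    have "c * S \<le> S" using c_small radius_pos by simp
    then have "mollify \<psi> c p x = mollify \<psi> c (\<lambda>y. of_real (q y)) x"
      by (intro mollify_cong_ball c_small p_eq) simp
    also have "\<dots> = of_real (mollify \<psi> c q x)"
      by (rule convolution_of_real)
    finally show ?thesis using p_eq[of x] radius_pos by simp
  qed
  show ?thesis
  proof (rule Lim_null_comparison[OF _ tendsto_mult_right_zero[OF L2_mollify_tendsto[OF p]]])
    have "norm (L2_norm (\<lambda>x. ?q c x *\<^sub>R g x)) \<le> K * L2_norm (?p c)" if c_small: "0 < c" "c < 1"
      for c
    proof -
      note [measurable] = Linf_measurable[OF Linf_mollify(1)[OF q c_small(1)]]
      have "norm (?q c x *\<^sub>R g x) \<le> norm (K *\<^sub>R ?p c x)" for x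
      proof (cases "norm x \<le> R")
        case True
        then have "norm (?p c x) = \<bar>?q c x\<bar>" by (simp only: p_eq_q[OF c_small] norm_of_real)
        then show ?thesis using K by (simp add: mult.commute mult_right_mono)
      qed (use R in simp)
      then have "L2_norm (\<lambda>x. ?q c x *\<^sub>R g x) \<le> L2_norm (\<lambda>x. K *\<^sub>R ?p c x)"
        using p c_small(1) by (intro L2_norm_mono(2) L2_scaleR L2_diff L2_mollify AE_I2) auto
      then show ?thesis using K(1) by (simp add: L2_norm_scaleR)
    qed
    then show "\<forall>\<^sub>F c in at_right 0. norm (L2_norm (\<lambda>x. ?q c x *\<^sub>R g x)) \<le> K * L2_norm (?p c)"
      unfolding eventually_at_right_field by (intro exI[of _ 1]) auto
  qed
qed

lemma L2_mollify_mult_tendsto: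
  assumes q: "q \<in> Linf" and f: "f \<in> L2"
  shows "((\<lambda>c. L2_norm (\<lambda>x. (mollify \<psi> c q x - q x) *\<^sub>R f x)) \<longlongrightarrow> 0) (at_right 0)"
proof -
  let ?m = "\<lambda>c x. mollify \<psi> c q x - q x"
  show ?thesis
  proof (rule L2_tendsto_0_by_density[where A = "\<lambda>c g x. ?m c x *\<^sub>R g x"
        and K = "2 * Linf_norm q", OF f])
    show "((\<lambda>c. L2_norm (\<lambda>x. ?m c x *\<^sub>R g x)) \<longlongrightarrow> 0) (at_right 0)" if "g \<in> Cc" for g :: "'a \<Rightarrow> complex"
      using q that by (rule L2_mollify_mult_tendsto_Cc)
    have "L2_norm (\<lambda>x. ?m c x *\<^sub>R f x)
        \<le> L2_norm (\<lambda>x. ?m c x *\<^sub>R g x) + 2 * Linf_norm q * L2_norm (\<lambda>x. g x - f x)"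
      if c_pos: "0 < c" and "g \<in> Cc" for c g
    proof -
      have g: "g \<in> L2" by (rule Cc_imp_L2) fact
      note m = Linf_diff[OF Linf_mollify(1)[OF q c_pos] q]
      have "L2_norm (\<lambda>x. ?m c x *\<^sub>R (f x - g x)) \<le> 2 * Linf_norm q * L2_norm (\<lambda>x. f x - g x)"
        using m(2) Linf_mollify(2)[OF q c_pos]
        by (intro order_trans[OF L2_mult_Linf(2)[OF m(1) L2_diff[OF f g]]] mult_right_mono) auto
      then show ?thesis
        using L2_norm_triangle_sub[OF L2_mult_Linf(1)[OF m(1) f] L2_mult_Linf(1)[OF m(1) g]]
        by (simp add: scaleR_diff_right L2_norm_minus_commute[of f g])
    qed
    then show "\<forall>\<^sub>F c in at_right 0. \<forall>g\<in>Cc. L2_norm (\<lambda>x. ?m c x *\<^sub>R f x)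
        \<le> L2_norm (\<lambda>x. ?m c x *\<^sub>R g x) + 2 * Linf_norm q * L2_norm (\<lambda>x. g x - f x)"
      unfolding eventually_at_right_field by (intro exI[of _ 1]) auto
  qed
qed

end


section \<open>Continuous curves in \<open>L\<^sup>2\<close>\<close>

lemma CL2_imp_L2: "u \<in> CL2 T \<Longrightarrow> t \<in> {0..T} \<Longrightarrow> u t \<in> L2"
  by (simp add: CL2_def)

lemma CL2_tendsto:
  "u \<in> CL2 T \<Longrightarrow> t \<in> {0..T} \<Longrightarrow> ((\<lambda>s. L2_norm (\<lambda>x. u s x - u t x)) \<longlongrightarrow> 0) (at t within {0..T})"
  by (simp add: CL2_def)

lemma CL2I:
  assumes "\<And>t. t \<in> {0..T} \<Longrightarrow> u t \<in> L2"
    and "\<And>t. t \<in> {0..T} \<Longrightarrow> (b t \<longlongrightarrow> 0) (at t within {0..T})"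
    and bound: "\<And>s t. s \<in> {0..T} \<Longrightarrow> t \<in> {0..T} \<Longrightarrow> L2_norm (\<lambda>x. u s x - u t x) \<le> b t s"
  shows "u \<in> CL2 T"
  unfolding CL2_def
proof (intro CollectI conjI ballI assms)
  fix t assume t: "t \<in> {0..T}"
  then have "\<forall>\<^sub>F s in at t within {0..T}. norm (L2_norm (\<lambda>x. u s x - u t x)) \<le> b t s"
    using bound by (simp add: eventually_at_filter)
  then show "((\<lambda>s. L2_norm (\<lambda>x. u s x - u t x)) \<longlongrightarrow> 0) (at t within {0..T})"
    using assms(2)[OF t] by (rule Lim_null_comparison)
qed

lemma CL2_mono:
  assumes "u \<in> CL2 T" "t \<le> T"
  shows "u \<in> CL2 t"
proof -
  have sub: "{0..t} \<subseteq> {0..T}" using assms(2) by auto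
  then have "((\<lambda>r. L2_norm (\<lambda>x. u r x - u s x)) \<longlongrightarrow> 0) (at s within {0..t})" if "s \<in> {0..t}" for s
    using that by (intro tendsto_within_subset[OF CL2_tendsto[OF assms(1)] sub]) auto
  then show ?thesis using CL2_imp_L2[OF assms(1)] sub by (auto simp: CL2_def)
qed

lemma CL2_lipschitz_image:
  assumes u: "u \<in> CL2 T" and A_L2: "\<And>f. f \<in> L2 \<Longrightarrow> A f \<in> L2"
    and lipschitz: "\<And>f g. f \<in> L2 \<Longrightarrow> g \<in> L2 \<Longrightarrow>
      L2_norm (\<lambda>x. A f x - A g x) \<le> K * L2_norm (\<lambda>x. f x - g x)"
  shows "(\<lambda>t. A (u t)) \<in> CL2 T"
  by (rule CL2I[OF _ tendsto_mult_right_zero[OF CL2_tendsto[OF u], where c = K]])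
     (simp_all add: A_L2 lipschitz CL2_imp_L2[OF u])

lemma CL2_const: "f \<in> L2 \<Longrightarrow> (\<lambda>t. f) \<in> CL2 T"
  by (simp add: CL2_def)

lemma CL2_add:
  assumes u: "u \<in> CL2 T" and v: "v \<in> CL2 T"
  shows "(\<lambda>t x. u t x + v t x) \<in> CL2 T"
proof (rule CL2I)
  show "(\<lambda>x. u t x + v t x) \<in> L2" if "t \<in> {0..T}" for t
    using that by (intro L2_add CL2_imp_L2[OF u] CL2_imp_L2[OF v])
  show "((\<lambda>s. L2_norm (\<lambda>x. u s x - u t x) + L2_norm (\<lambda>x. v s x - v t x)) \<longlongrightarrow> 0) (at t within {0..T})"
    if "t \<in> {0..T}" for t
    by (intro tendsto_add_zero CL2_tendsto u v that)
  show "L2_norm (\<lambda>x. u s x + v s x - (u t x + v t x))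
      \<le> L2_norm (\<lambda>x. u s x - u t x) + L2_norm (\<lambda>x. v s x - v t x)"
    if "s \<in> {0..T}" "t \<in> {0..T}" for s t
    using L2_norm_triangle_ineq[OF L2_diff[OF that[THEN CL2_imp_L2[OF u]]]
      L2_diff[OF that[THEN CL2_imp_L2[OF v]]]]
    by (simp add: algebra_simps)
qed

lemma CL2_scaleR:
  assumes "u \<in> CL2 T"
  shows "(\<lambda>t x. c *\<^sub>R u t x) \<in> CL2 T"
  using assms
  by (rule CL2_lipschitz_image[where A = "\<lambda>f x. c *\<^sub>R f x" and K = "\<bar>c\<bar>"])
     (simp_all add: L2_scaleR L2_norm_scaleR flip: scaleR_diff_right)

lemma CL2_diff: "u \<in> CL2 T \<Longrightarrow> v \<in> CL2 T \<Longrightarrow> (\<lambda>t x. u t x - v t x) \<in> CL2 T"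
  using CL2_add[OF _ CL2_scaleR[of v T "-1"], of u] by simp

lemma CL2_mult_Linf:
  assumes "m \<in> Linf" "u \<in> CL2 T"
  shows "(\<lambda>t x. m x *\<^sub>R u t x) \<in> CL2 T"
  using assms(2)
  by (rule CL2_lipschitz_image[where A = "\<lambda>f x. m x *\<^sub>R f x" and K = "Linf_norm m"])
     (simp_all add: L2_mult_Linf assms(1) L2_diff flip: scaleR_diff_right)

lemma CL2_convolution:
  assumes "g \<in> Cc" "u \<in> CL2 T"
  shows "(\<lambda>t. convolution (u t) g) \<in> CL2 T"
  using assms(2)
  by (rule CL2_lipschitz_image[where A = "\<lambda>f. convolution f g" and K = "LINT y|lebesgue. \<bar>g y\<bar>"])
     (simp_all add: convolution_Young L2_diff L2_imp_locally_integrable assms(1)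
         flip: convolution_diff_left)

lemma continuous_on_L2_norm:
  assumes u: "u \<in> CL2 T"
  shows "continuous_on {0..T} (\<lambda>t. L2_norm (u t))"
  unfolding continuous_on_def
proof
  fix t assume t: "t \<in> {0..T}"
  show "((\<lambda>t. L2_norm (u t)) \<longlongrightarrow> L2_norm (u t)) (at t within {0..T})"
    by (rule L2_norm_tendsto[OF CL2_imp_L2[OF u t] _ CL2_tendsto[OF u t]])
       (simp add: eventually_at_filter CL2_imp_L2[OF u])
qed

lemma continuous_on_L2_inner:
  assumes u: "u \<in> CL2 T" and v: "v \<in> CL2 T"
  shows "continuous_on {0..T} (\<lambda>t. L2_inner (u t) (v t))"
proof -
  have "continuous_on {0..T}
      (\<lambda>t. ((L2_norm (\<lambda>x. u t x + v t x))\<^sup>2 - (L2_norm (u t))\<^sup>2 - (L2_norm (v t))\<^sup>2) / 2)"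
    by (intro continuous_intros continuous_on_L2_norm CL2_add u v) simp
  then show ?thesis
    by (rule continuous_on_eq) (simp add: L2_norm_add_power2 CL2_imp_L2[OF u] CL2_imp_L2[OF v])
qed

lemma continuous_on_convolution_CL2:
  assumes u: "u \<in> CL2 T" and g: "g \<in> Cc"
  shows "continuous_on ({0..T} \<times> UNIV) (\<lambda>(t, x). convolution (u t) g x)"
  unfolding continuous_on_def
proof (clarify)
  fix t x assume t: "t \<in> {0..T}"
  define C where "C = sqrt (LINT y|lebesgue. (g y)\<^sup>2)"
  have loc: "locally_integrable (u s)" if "s \<in> {0..T}" for s
    by (intro L2_imp_locally_integrable CL2_imp_L2[OF u] that)
  let ?b = "\<lambda>z. C * L2_norm (\<lambda>y. u (fst z) y - u t y)
    + norm (convolution (u t) g (snd z) - convolution (u t) g x)"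
  have "continuous_on ({0..T} \<times> UNIV) ?b"
    by (intro continuous_intros
        continuous_on_compose2[OF continuous_convolution[OF loc[OF t] g] continuous_on_snd]
        continuous_on_compose2[OF
          continuous_on_L2_norm[OF CL2_diff[OF u CL2_const[OF CL2_imp_L2[OF u t]]]]
          continuous_on_fst]) auto
  then have "(?b \<longlongrightarrow> ?b (t, x)) (at (t, x) within {0..T} \<times> UNIV)"
    using t unfolding continuous_on_def by blast
  then have lim: "(?b \<longlongrightarrow> 0) (at (t, x) within {0..T} \<times> UNIV)" by simp
  have bound: "norm (convolution (u s) g y - convolution (u t) g x) \<le> ?b (s, y)"
    if s: "s \<in> {0..T}" for s y
  proof -
    have "norm (convolution (u s) g y - convolution (u t) g y) \<le> C * L2_norm (\<lambda>y. u s y - u t y)"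
      unfolding C_def using s t
      by (simp add: norm_convolution_le_L2 L2_diff CL2_imp_L2[OF u] loc g
          flip: convolution_diff_left)
    then show ?thesis
      using norm_triangle_ineq[of "convolution (u s) g y - convolution (u t) g y"
          "convolution (u t) g y - convolution (u t) g x"] by simp
  qed
  show "((\<lambda>(s, y). convolution (u s) g y) \<longlongrightarrow> convolution (u t) g x) (at (t, x) within {0..T} \<times> UNIV)"
  proof (rule Lim_null[THEN iffD2], rule Lim_null_comparison[OF _ lim])
    show "\<forall>\<^sub>F z in at (t, x) within {0..T} \<times> UNIV.
        norm ((case z of (s, y) \<Rightarrow> convolution (u s) g y) - convolution (u t) g x) \<le> ?b z"
      unfolding eventually_at_filter using bound by (auto intro!: always_eventually)
  qed
qed

lemma continuous_on_pairing:
  assumes u: "u \<in> CL2 T" and \<rho>: "\<rho> \<in> Cc"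
  shows "continuous_on {0..T} (\<lambda>t. pairing \<rho> (u t))"
proof -
  have "continuous_on {0..T} (\<lambda>t. case (t, 0) of (t, x) \<Rightarrow> convolution (u t) (\<lambda>y. \<rho> (0 - y)) x)"
    by (rule continuous_on_compose2[OF continuous_on_convolution_CL2[OF u Cc_reflect[OF \<rho>]]])
       (auto intro!: continuous_intros)
  then show ?thesis by (simp add: convolution_eq_pairing)
qed

lemma CL2_bounded:
  assumes "u \<in> CL2 T"
  obtains B where "\<And>t. t \<in> {0..T} \<Longrightarrow> L2_norm (u t) \<le> B"
proof -
  have "bounded ((\<lambda>t. L2_norm (u t)) ` {0..T})"
    by (intro compact_imp_bounded compact_continuous_image continuous_on_L2_norm assms) auto
  then obtain B where "\<forall>t\<in>{0..T}. L2_norm (u t) \<le> B" by (auto simp: bounded_iff)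
  then show ?thesis using that[of B] by blast
qed


section \<open>Smooth functions and test functions\<close>

lemma differentiable_on_UNIV_has_derivative:
  "f differentiable_on UNIV \<Longrightarrow> (f has_derivative frechet_derivative f (at x)) (at x)"
  by (simp add: differentiable_on_def frechet_derivative_works)

lemma has_derivative_imp_differentiable_on_UNIV:
  "(\<And>x. (f has_derivative f' x) (at x)) \<Longrightarrow> f differentiable_on UNIV"
  unfolding differentiable_on_def differentiable_def by blast

lemma partial_deriv_eq: "(f has_derivative f') (at x) \<Longrightarrow> partial_deriv v f x = f' v"
  by (simp add: partial_deriv_def frechet_derivative_at[symmetric])

lemma partial_deriv_real_eq: "(f has_real_derivative d) (at x) \<Longrightarrow> partial_deriv 1 f x = d"
  by (simp add: has_field_derivative_def partial_deriv_eq)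

lemma linear_partial_deriv: "f differentiable_on UNIV \<Longrightarrow> linear (\<lambda>v. partial_deriv v f x)"
  unfolding partial_deriv_def
  by (rule has_derivative_linear[OF differentiable_on_UNIV_has_derivative])

lemma partial_deriv_eq_sum_Basis:
  assumes "f differentiable_on UNIV"
  shows "partial_deriv v f x = (\<Sum>b\<in>Basis. (v \<bullet> b) * partial_deriv b f x)"
proof -
  interpret linear "\<lambda>v. partial_deriv v f x" by (rule linear_partial_deriv[OF assms])
  show ?thesis
    using sum[of "\<lambda>b. (v \<bullet> b) *\<^sub>R b" Basis] by (simp add: euclidean_representation scale)
qed

lemma has_derivative_compose_affine:
  assumes "f differentiable_on UNIV" "bounded_linear L"
  shows "((\<lambda>y. f (a + L y)) has_derivative (\<lambda>v. frechet_derivative f (at (a + L y)) (L v))) (at y)"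
  by (rule has_derivative_compose[OF _ differentiable_on_UNIV_has_derivative[OF assms(1)]])
     (auto intro!: derivative_eq_intros bounded_linear.has_derivative[OF assms(2)])

lemma partial_deriv_compose_affine:
  assumes "f differentiable_on UNIV" "bounded_linear L"
  shows "partial_deriv v (\<lambda>y. f (a + L y)) y = partial_deriv (L v) f (a + L y)"
  using partial_deriv_eq[OF has_derivative_compose_affine[OF assms]]
  by (simp add: partial_deriv_def)

lemma partial_deriv_add:
  assumes "f differentiable_on UNIV" "g differentiable_on UNIV"
  shows "partial_deriv v (\<lambda>x. f x + g x) = (\<lambda>x. partial_deriv v f x + partial_deriv v g x)"
  using partial_deriv_eq[OF
    has_derivative_add[OF assms[THEN differentiable_on_UNIV_has_derivative]]]
  by (simp add: fun_eq_iff partial_deriv_def)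

lemma partial_deriv_mult:
  assumes "f differentiable_on UNIV" "g differentiable_on UNIV"
  shows "partial_deriv v (\<lambda>x. f x * g x)
      = (\<lambda>x. f x * partial_deriv v g x + partial_deriv v f x * g x)"
  using partial_deriv_eq[OF
    has_derivative_mult[OF assms[THEN differentiable_on_UNIV_has_derivative]]]
  by (simp add: fun_eq_iff partial_deriv_def)

lemma partial_deriv_const: "partial_deriv v (\<lambda>x. c) = (\<lambda>x. 0)"
  by (rule ext, rule partial_deriv_eq) simp

lemma Ck_imp_continuous: "Ck k f \<Longrightarrow> continuous_on UNIV f"
  by (cases k) (auto intro: differentiable_imp_continuous_on)

lemma Ck_SucD: "Ck (Suc k) f \<Longrightarrow> Ck k f"
proof (induction k arbitrary: f)
  case 0
  then show ?case using Ck_imp_continuous[of "Suc 0" f] by simp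
next
  case (Suc k)
  then show ?case by auto
qed

lemma Ck_const: "Ck k (\<lambda>x. c)"
proof (induction k arbitrary: c)
  case (Suc k)
  then show ?case by (simp add: partial_deriv_const)
qed simp

lemma Ck_add: "Ck k f \<Longrightarrow> Ck k g \<Longrightarrow> Ck k (\<lambda>x. f x + g x)"
proof (induction k arbitrary: f g)
  case (Suc k)
  then show ?case by (simp add: partial_deriv_add)
qed (simp add: continuous_on_add)

lemma Ck_mult: "Ck k f \<Longrightarrow> Ck k g \<Longrightarrow> Ck k (\<lambda>x. f x * g x)"
proof (induction k arbitrary: f g)
  case (Suc k)
  then show ?case by (simp add: partial_deriv_mult Ck_add Ck_SucD)
qed (simp add: continuous_on_mult)

lemma Ck_sum: "(\<And>i. i \<in> I \<Longrightarrow> Ck k (f i)) \<Longrightarrow> Ck k (\<lambda>x. \<Sum>i\<in>I. f i x)"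
  by (induction I rule: infinite_finite_induct) (auto simp: Ck_const Ck_add)

lemma Ck_compose_affine:
  assumes L: "bounded_linear L"
  shows "Ck k f \<Longrightarrow> Ck k (\<lambda>y. f (a + L y))"
proof (induction k arbitrary: f)
  case 0
  have "continuous_on UNIV (\<lambda>y. a + L y)"
    by (intro continuous_intros linear_continuous_on L)
  then show ?case using continuous_on_compose2[of UNIV f] 0 by simp
next
  case (Suc k)
  then have f: "f differentiable_on UNIV" by simp
  have "partial_deriv i (\<lambda>y. f (a + L y)) = (\<lambda>y. \<Sum>b\<in>Basis. (L i \<bullet> b) * partial_deriv b f (a + L y))"
    for i
    by (rule ext)
       (unfold partial_deriv_compose_affine[OF f L], rule partial_deriv_eq_sum_Basis[OF f])
  moreover have "Ck k (\<lambda>y. \<Sum>b\<in>Basis. (L i \<bullet> b) * partial_deriv b f (a + L y))" for i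
    using Suc by (intro Ck_sum Ck_mult Ck_const) simp
  ultimately show ?case
    using has_derivative_imp_differentiable_on_UNIV[OF has_derivative_compose_affine[OF f L]]
    by simp
qed

lemma smooth_imp_differentiable: "smooth f \<Longrightarrow> f differentiable_on UNIV"
  unfolding smooth_def by (metis Ck.simps(2))

lemma smooth_imp_continuous: "smooth f \<Longrightarrow> continuous_on UNIV f"
  unfolding smooth_def using Ck_imp_continuous by blast

lemma smooth_partial_deriv: "smooth f \<Longrightarrow> i \<in> Basis \<Longrightarrow> smooth (partial_deriv i f)"
  unfolding smooth_def by (metis Ck.simps(2))

lemma smooth_mult: "smooth f \<Longrightarrow> smooth g \<Longrightarrow> smooth (\<lambda>x. f x * g x)"
  by (simp add: smooth_def Ck_mult)

lemma smooth_cmult: "smooth f \<Longrightarrow> smooth (\<lambda>x. c * f x)"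
  by (simp add: smooth_def Ck_mult Ck_const)

lemma smooth_diff: "smooth f \<Longrightarrow> smooth g \<Longrightarrow> smooth (\<lambda>x. f x - g x)"
  using Ck_add[of _ f "\<lambda>x. - 1 * g x"] Ck_mult[OF Ck_const[of _ "- 1"], of _ g]
  by (simp add: smooth_def)

lemma smooth_compose_affine: "bounded_linear L \<Longrightarrow> smooth f \<Longrightarrow> smooth (\<lambda>y. f (a + L y))"
  by (simp add: smooth_def Ck_compose_affine)

lemma smooth_reflect: "smooth f \<Longrightarrow> smooth (\<lambda>y. f (x - y))"
  using smooth_compose_affine[OF bounded_linear_minus[OF bounded_linear_ident], of f x] by simp

lemma smooth_antiderivative:
  fixes f F :: "real \<Rightarrow> real"
  assumes F: "\<And>x. (F has_real_derivative f x) (at x)" and f: "smooth f"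
  shows "smooth F"
  unfolding smooth_def
proof
  fix k
  have diff: "F differentiable_on UNIV"
    using F by (auto simp: differentiable_on_def real_differentiable_def)
  have "partial_deriv 1 F = f" using partial_deriv_real_eq[OF F] by blast
  then show "Ck k F"
    using f diff by (cases k) (auto simp: smooth_def differentiable_imp_continuous_on)
qed

lemma partial_deriv_reflect:
  assumes "f differentiable_on UNIV"
  shows "partial_deriv v (\<lambda>y. f (x - y)) y = - partial_deriv v f (x - y)"
  using partial_deriv_compose_affine
      [OF assms bounded_linear_minus[OF bounded_linear_ident], of v x y]
    linear_neg[OF linear_partial_deriv[OF assms]] by simp

definition laplacian :: "('a::euclidean_space \<Rightarrow> real) \<Rightarrow> 'a \<Rightarrow> real" where
  "laplacian \<rho> x = (\<Sum>i\<in>Basis. partial_deriv i (partial_deriv i \<rho>) x)"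

lemma laplacian_reflect:
  fixes \<rho> :: "'a::euclidean_space \<Rightarrow> real"
  assumes "smooth \<rho>"
  shows "laplacian (\<lambda>y. \<rho> (x - y)) y = laplacian \<rho> (x - y)"
proof -
  have "partial_deriv i (partial_deriv i (\<lambda>y. \<rho> (x - y))) y
    = partial_deriv i (partial_deriv i \<rho>) (x - y)"
    if "i \<in> Basis" for i
  proof -
    have d: "partial_deriv i \<rho> differentiable_on UNIV"
      by (intro smooth_imp_differentiable smooth_partial_deriv assms that)
    have "partial_deriv i (\<lambda>y. \<rho> (x - y)) = (\<lambda>y. - 1 * partial_deriv i \<rho> (x - y))"
      by (simp add: fun_eq_iff partial_deriv_reflect smooth_imp_differentiable assms)
    moreover have "partial_deriv i (\<lambda>y. - 1 * partial_deriv i \<rho> (x - y)) y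
        = - 1 * partial_deriv i (\<lambda>y. partial_deriv i \<rho> (x - y)) y"
      by (subst partial_deriv_mult)
         (simp_all add: partial_deriv_const smooth_imp_differentiable smooth_reflect
             smooth_partial_deriv assms that)
    ultimately show ?thesis by (simp add: partial_deriv_reflect[OF d])
  qed
  then show ?thesis by (simp add: laplacian_def)
qed

definition tensor ::
  "('a::euclidean_space \<Rightarrow> real) \<Rightarrow> ('b::euclidean_space \<Rightarrow> real) \<Rightarrow> 'a \<times> 'b \<Rightarrow> real" where
  "tensor f g z = f (fst z) * g (snd z)"

lemma smooth_tensor: "smooth f \<Longrightarrow> smooth g \<Longrightarrow> smooth (tensor f g)"
  using smooth_mult[OF smooth_compose_affine[OF bounded_linear_fst, of f 0]
      smooth_compose_affine[OF bounded_linear_snd, of g 0]]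
  by (simp add: tensor_def[abs_def])

lemma partial_deriv_tensor:
  assumes f: "f differentiable_on UNIV" and g: "g differentiable_on UNIV"
  shows "partial_deriv (u, v) (tensor f g) (x, y)
      = partial_deriv u f x * g y + f x * partial_deriv v g y"
proof -
  have fst: "(\<lambda>z. f (0 + fst z)) differentiable_on UNIV"
    and snd: "(\<lambda>z. g (0 + snd z)) differentiable_on UNIV"
    by (rule has_derivative_imp_differentiable_on_UNIV has_derivative_compose_affine
        f g bounded_linear_fst bounded_linear_snd)+
  have "partial_deriv (u, v) (\<lambda>z. f (0 + fst z) * g (0 + snd z)) (x, y)
      = partial_deriv u f x * g y + f x * partial_deriv v g y"
    unfolding partial_deriv_mult[OF fst snd]
      partial_deriv_compose_affine[OF f bounded_linear_fst]
      partial_deriv_compose_affine[OF g bounded_linear_snd]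
    by simp
  then show ?thesis by (simp add: tensor_def[abs_def])
qed

lemma partial_deriv_tensor_fst:
  assumes "smooth f" "smooth g"
  shows "partial_deriv (u, 0) (tensor f g) = tensor (partial_deriv u f) g"
  using linear_0[OF linear_partial_deriv[OF smooth_imp_differentiable[OF assms(2)]]]
  by (simp add: fun_eq_iff tensor_def partial_deriv_tensor smooth_imp_differentiable assms)

lemma partial_deriv_tensor_snd:
  assumes "smooth f" "smooth g"
  shows "partial_deriv (0, v) (tensor f g) = tensor f (partial_deriv v g)"
  using linear_0[OF linear_partial_deriv[OF smooth_imp_differentiable[OF assms(1)]]]
  by (simp add: fun_eq_iff tensor_def partial_deriv_tensor smooth_imp_differentiable assms)

lemma dt_tensor: "smooth \<eta> \<Longrightarrow> smooth \<rho> \<Longrightarrow> dt (tensor \<eta> \<rho>) (t, x) = partial_deriv 1 \<eta> t * \<rho> x"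
  by (simp add: dt_def partial_deriv_tensor_fst) (simp add: tensor_def)

lemma laplace_tensor:
  assumes "smooth \<eta>" "smooth \<rho>"
  shows "laplace (tensor \<eta> \<rho>) (t, x) = \<eta> t * laplacian \<rho> x"
proof -
  have "partial_deriv (0, i) (partial_deriv (0, i) (tensor \<eta> \<rho>)) (t, x)
      = \<eta> t * partial_deriv i (partial_deriv i \<rho>) x" if "i \<in> Basis" for i
    by (simp add: partial_deriv_tensor_snd smooth_partial_deriv assms that) (simp add: tensor_def)
  then show ?thesis by (simp add: laplace_def laplacian_def sum_distrib_left)
qed

lemma test_functions_smooth: "\<phi> \<in> test_functions \<Omega> \<Longrightarrow> smooth \<phi>"
  by (simp add: test_functions_def)

lemma zero_outside_supp: "x \<notin> supp f \<Longrightarrow> f x = 0"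
  using closure_subset[of "{x. f x \<noteq> 0}"] by (auto simp: supp_def)

lemma test_functionsI:
  assumes "smooth \<phi>" "compact C" "C \<subseteq> \<Omega>" and vanish: "\<And>x. x \<notin> C \<Longrightarrow> \<phi> x = 0"
  shows "\<phi> \<in> test_functions \<Omega>"
proof -
  have "supp \<phi> \<subseteq> C"
    unfolding supp_def using vanish by (intro closure_minimal compact_imp_closed assms) auto
  moreover have "compact (supp \<phi>)"
    using compact_Int_closed[OF assms(2), of "supp \<phi>"] calculation
    by (simp add: supp_def Int_absorb1)
  ultimately show ?thesis using assms(1,3) by (auto simp: test_functions_def)
qed

lemma test_functions_imp_Cc:
  assumes "\<phi> \<in> test_functions \<Omega>"
  shows "\<phi> \<in> Cc"
proof -
  have "bounded (supp \<phi>)" using assms by (simp add: test_functions_def compact_imp_bounded)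
  then obtain R where "\<And>x. x \<in> supp \<phi> \<Longrightarrow> norm x \<le> R" unfolding bounded_iff by blast
  then have "\<phi> x = 0" if "R < norm x" for x using that zero_outside_supp[of x \<phi>] by force
  then show ?thesis by (rule CcI[OF smooth_imp_continuous[OF test_functions_smooth[OF assms]]])
qed

lemma test_functions_UNIV_iff: "\<phi> \<in> test_functions UNIV \<longleftrightarrow> smooth \<phi> \<and> \<phi> \<in> Cc"
proof
  assume \<phi>: "smooth \<phi> \<and> \<phi> \<in> Cc"
  then obtain R where "\<And>x. R < norm x \<Longrightarrow> \<phi> x = 0" using Cc_vanish[of \<phi>] by blast
  then show "\<phi> \<in> test_functions UNIV"
    using \<phi> by (intro test_functionsI[of \<phi> "cball 0 R"]) auto
qed (simp add: test_functions_imp_Cc test_functions_smooth)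

lemma tensor_test_functions:
  assumes f: "f \<in> test_functions A" and g: "g \<in> test_functions B"
  shows "tensor f g \<in> test_functions (A \<times> B)"
proof (rule test_functionsI)
  show "smooth (tensor f g)"
    by (intro smooth_tensor test_functions_smooth[OF f] test_functions_smooth[OF g])
  show "compact (supp f \<times> supp g)" "supp f \<times> supp g \<subseteq> A \<times> B"
    using f g by (auto simp: test_functions_def intro!: compact_Times)
  show "tensor f g z = 0" if "z \<notin> supp f \<times> supp g" for z
    using that zero_outside_supp[of "fst z" f] zero_outside_supp[of "snd z" g]
    by (auto simp: tensor_def mem_Times_iff)
qed

lemma partial_deriv_test_functions:
  assumes f: "f \<in> test_functions \<Omega>" and i: "i \<in> Basis"
  shows "partial_deriv i f \<in> test_functions \<Omega>"
proof (rule test_functionsI)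
  show "smooth (partial_deriv i f)" by (intro smooth_partial_deriv test_functions_smooth[OF f] i)
  show "compact (supp f)" "supp f \<subseteq> \<Omega>" using f by (auto simp: test_functions_def)
  fix x assume x: "x \<notin> supp f"
  have "(f has_derivative (\<lambda>_. 0)) (at x)"
  proof (rule has_derivative_transform_within_open[of "\<lambda>_. 0" _ _ _ "- supp f"])
    show "open (- supp f)" by (simp add: supp_def open_Compl)
  qed (use x zero_outside_supp in auto)
  then show "partial_deriv i f x = 0" by (rule partial_deriv_eq)
qed

lemma laplacian_Cc: "\<rho> \<in> test_functions UNIV \<Longrightarrow> laplacian \<rho> \<in> Cc"
  unfolding laplacian_def[abs_def]
  by (intro Cc_sum finite_Basis test_functions_imp_Cc partial_deriv_test_functions)

lemma test_functions_reflect: "\<rho> \<in> test_functions UNIV \<Longrightarrow> (\<lambda>y. \<rho> (x - y)) \<in> test_functions UNIV"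
  by (simp add: test_functions_UNIV_iff smooth_reflect Cc_reflect)

lemma smooth_dilate: "smooth \<psi> \<Longrightarrow> smooth (dilate \<psi> c)"
  unfolding dilate_eq_scaled_affine
  by (intro smooth_cmult smooth_compose_affine bounded_linear_scaleR_right)

lemma dilate_test_functions:
  "\<psi> \<in> test_functions UNIV \<Longrightarrow> 0 < c \<Longrightarrow> dilate \<psi> c \<in> test_functions UNIV"
  by (simp add: test_functions_UNIV_iff smooth_dilate dilate_Cc)

lemma friedrichs_mollifier_imp_mollifier:
  assumes "friedrichs_mollifier \<psi>"
  obtains S where "mollifier \<psi> S"
proof -
  have \<psi>: "\<psi> \<in> Cc" using assms test_functions_imp_Cc by (auto simp: friedrichs_mollifier_def)
  obtain S where "0 < S" "\<And>x. S < norm x \<Longrightarrow> \<psi> x = 0" using Cc_vanish[OF \<psi>] by blast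
  then show ?thesis
    using that[of S] \<psi> assms by (auto simp: mollifier_def friedrichs_mollifier_def)
qed


section \<open>Integration by parts for mollified functions\<close>

definition difference_quotient ::
  "'a::euclidean_space \<Rightarrow> real \<Rightarrow> ('a \<Rightarrow> 'b::real_vector) \<Rightarrow> 'a \<Rightarrow> 'b" where
  "difference_quotient v h f x = inverse h *\<^sub>R (f (x + h *\<^sub>R v) - f x)"

lemma difference_quotient_Cc:
  fixes f :: "'a::euclidean_space \<Rightarrow> 'b::real_normed_vector"
  shows "f \<in> Cc \<Longrightarrow> difference_quotient v h f \<in> Cc"
  unfolding difference_quotient_def[abs_def] by (intro Cc_scaleR Cc_diff Cc_translate)

lemma convolution_difference_quotient:
  assumes f: "locally_integrable f" and g: "g \<in> Cc"
  shows "convolution f (difference_quotient v h g) x = difference_quotient v h (convolution f g) x"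
  by (simp add: difference_quotient_def[abs_def] convolution_scaleR_right
      convolution_translate_right
      convolution_diff_right[OF f Cc_translate[OF g] g])

lemma difference_quotient_uniform_approx:
  assumes f: "f \<in> test_functions UNIV" and i: "i \<in> Basis" and "0 < e"
  obtains d where "0 < d"
    "\<And>h x. h \<noteq> 0 \<Longrightarrow> \<bar>h\<bar> < d \<Longrightarrow> \<bar>difference_quotient i h f x - partial_deriv i f x\<bar> \<le> e"
proof -
  note diff = smooth_imp_differentiable[OF test_functions_smooth[OF f]]
  have "uniformly_continuous_on UNIV (partial_deriv i f)"
    by (rule Cc_uniformly_continuous[OF
        test_functions_imp_Cc[OF partial_deriv_test_functions[OF f i]]])
  then obtain d where d: "0 < d"
    "\<And>x y. dist y x < d \<Longrightarrow> dist (partial_deriv i f y) (partial_deriv i f x) < e"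
    using \<open>0 < e\<close> unfolding uniformly_continuous_on_def by (metis UNIV_I)
  have "\<bar>difference_quotient i h f x - partial_deriv i f x\<bar> \<le> e" if h: "h \<noteq> 0" "\<bar>h\<bar> < d" for h x
  proof -
    define r where "r t = f (x + t *\<^sub>R i) - t * partial_deriv i f x" for t
    have "(r has_real_derivative partial_deriv i f (x + t *\<^sub>R i) - partial_deriv i f x) (at t)"
      for t
    proof -
      have "((\<lambda>t. f (x + t *\<^sub>R i)) has_derivative (\<lambda>s. s * partial_deriv i f (x + t *\<^sub>R i))) (at t)"
        using has_derivative_compose_affine[OF diff bounded_linear_scaleR_left, of x i t]
          linear_scale[OF linear_partial_deriv[OF diff]]
        by (simp flip: partial_deriv_def)
      then have "((\<lambda>t. f (x + t *\<^sub>R i)) has_real_derivative partial_deriv i f (x + t *\<^sub>R i)) (at t)"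
        by (simp add: has_field_derivative_def mult_commute_abs)
      then show ?thesis unfolding r_def by (auto intro!: derivative_eq_intros)
    qed
    moreover have "norm (partial_deriv i f (x + t *\<^sub>R i) - partial_deriv i f x) \<le> e"
      if "t \<in> cball 0 \<bar>h\<bar>" for t
      using d(2)[of "x + t *\<^sub>R i" x] that h i by (simp add: dist_norm)
    ultimately have "norm (r h - r 0) \<le> e * norm (h - 0)"
      by (intro field_differentiable_bound[of "cball 0 \<bar>h\<bar>"])
         (auto intro: has_field_derivative_at_within)
    moreover have "difference_quotient i h f x - partial_deriv i f x = (r h - r 0) / h"
      using h by (simp add: difference_quotient_def r_def field_simps)
    ultimately show ?thesis using h by (simp add: abs_divide pos_divide_le_eq)
  qed
  then show ?thesis using d(1) that by blast
qed

lemma difference_quotient_tendsto_L1: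
  fixes f :: "'a::euclidean_space \<Rightarrow> real"
  assumes f: "f \<in> test_functions UNIV" and i: "i \<in> Basis"
  shows "((\<lambda>h. LINT x|lebesgue. \<bar>difference_quotient i h f x - partial_deriv i f x\<bar>) \<longlongrightarrow> 0) (at 0)"
proof (rule tendstoI)
  fix e :: real assume "0 < e"
  note f_Cc = test_functions_imp_Cc[OF f]
    and pd_Cc = test_functions_imp_Cc[OF partial_deriv_test_functions[OF f i]]
  obtain R where R: "0 < R" "\<And>x. R < norm x \<Longrightarrow> f x = 0" using Cc_vanish[OF f_Cc] by blast
  obtain R' where R': "0 < R'" "\<And>x. R' < norm x \<Longrightarrow> partial_deriv i f x = 0"
    using Cc_vanish[OF pd_Cc] by blast
  define B :: "'a set" where "B = cball 0 (max R R' + 1)"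
  obtain e' where e': "0 < e'" "e' * measure lebesgue B < e"
    by (rule pos_mult_less_exists[OF \<open>0 < e\<close>])
  obtain d where d: "0 < d"
    "\<And>h x. h \<noteq> 0 \<Longrightarrow> \<bar>h\<bar> < d \<Longrightarrow> \<bar>difference_quotient i h f x - partial_deriv i f x\<bar> \<le> e'"
    using difference_quotient_uniform_approx[OF f i e'(1)] by blast
  have "dist (LINT x|lebesgue. \<bar>difference_quotient i h f x - partial_deriv i f x\<bar>) 0 < e"
    if h: "h \<noteq> 0" "\<bar>h\<bar> < min d 1" for h
  proof -
    have bound: "\<bar>difference_quotient i h f x - partial_deriv i f x\<bar> \<le> e' * indicator B x" for x
    proof (cases "x \<in> B")
      case False
      then have "R < norm x" "R' < norm x" "R < norm (x + h *\<^sub>R i)"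
        using h i norm_diff_ineq[of x "h *\<^sub>R i"] by (auto simp: B_def)
      then show ?thesis using False R R' by (simp add: difference_quotient_def)
    qed (use d(2) h in simp)
    have "(LINT x|lebesgue. \<bar>difference_quotient i h f x - partial_deriv i f x\<bar>)
        \<le> (LINT x|lebesgue. e' * indicator B x)"
      using bound Cc_integrable[OF Cc_norm[OF Cc_diff[OF difference_quotient_Cc[OF f_Cc] pd_Cc]]]
      by (intro integral_mono integrable_mult_right)
         (simp_all add: B_def integrable_indicator_cball)
    then show ?thesis using e'(2) by (simp add: B_def)
  qed
  then show "\<forall>\<^sub>F h in at 0.
      dist (LINT x|lebesgue. \<bar>difference_quotient i h f x - partial_deriv i f x\<bar>) 0 < e"
    unfolding eventually_at using d(1) by (intro exI[of _ "min d 1"]) auto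
qed

lemma difference_quotient_convolution_tendsto:
  assumes f: "f \<in> L2" and g: "g \<in> test_functions UNIV" and i: "i \<in> Basis"
  shows "((\<lambda>h. L2_norm (\<lambda>x.
      difference_quotient i h (convolution f g) x - convolution f (partial_deriv i g) x))
    \<longlongrightarrow> 0) (at 0)"
proof (rule Lim_null_comparison[OF always_eventually tendsto_mult_left_zero], rule allI)
  show "((\<lambda>h. LINT x|lebesgue. \<bar>difference_quotient i h g x - partial_deriv i g x\<bar>) \<longlongrightarrow> 0) (at 0)"
    by (rule difference_quotient_tendsto_L1[OF g i])
  fix h
  note g_Cc = test_functions_imp_Cc[OF g]
    and pd_Cc = test_functions_imp_Cc[OF partial_deriv_test_functions[OF g i]]
  note loc = L2_imp_locally_integrable[OF f] and dq_Cc = difference_quotient_Cc[OF g_Cc]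
  have "(\<lambda>x. difference_quotient i h (convolution f g) x - convolution f (partial_deriv i g) x)
      = convolution f (\<lambda>x. difference_quotient i h g x - partial_deriv i g x)"
    by (simp add: fun_eq_iff convolution_diff_right[OF loc dq_Cc pd_Cc]
        convolution_difference_quotient[OF loc g_Cc])
  then show "norm (L2_norm (\<lambda>x.
      difference_quotient i h (convolution f g) x - convolution f (partial_deriv i g) x))
      \<le> (LINT x|lebesgue. \<bar>difference_quotient i h g x - partial_deriv i g x\<bar>) * L2_norm f"
    using convolution_Young(2)[OF f Cc_diff[OF dq_Cc pd_Cc]] by simp
qed

lemma L2_inner_difference_quotient:
  assumes V: "V \<in> L2" "V \<in> borel_measurable borel" and W: "W \<in> L2" "W \<in> borel_measurable borel"
    and V': "\<And>a. (\<lambda>x. V (x + a)) \<in> L2" and W': "\<And>a. (\<lambda>x. W (x + a)) \<in> L2"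
  shows "L2_inner V (difference_quotient v h W) = - L2_inner W (difference_quotient v (- h) V)"
proof -
  have "(\<lambda>x. V x \<bullet> W (x + h *\<^sub>R v)) \<in> borel_measurable borel" using V(2) W(2) by measurable
  from lebesgue_integral_translate_borel[OF this, of "- (h *\<^sub>R v)"]
  have shift: "L2_inner V (\<lambda>x. W (x + h *\<^sub>R v)) = L2_inner W (\<lambda>x. V (x + (- h) *\<^sub>R v))"
    by (simp add: L2_inner_def inner_commute)
  have "L2_inner V (difference_quotient v h W)
    = inverse h * (L2_inner V (\<lambda>x. W (x + h *\<^sub>R v)) - L2_inner V W)"
    unfolding difference_quotient_def[abs_def] L2_inner_scaleR_right
      L2_inner_diff_right[OF V(1) W' W(1)] ..
  moreover have "L2_inner W (difference_quotient v (- h) V)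
      = inverse (- h) * (L2_inner W (\<lambda>x. V (x + (- h) *\<^sub>R v)) - L2_inner W V)"
    unfolding difference_quotient_def[abs_def] L2_inner_scaleR_right
      L2_inner_diff_right[OF W(1) V' V(1)] ..
  ultimately show ?thesis
    unfolding shift by (simp add: L2_inner_commute[of V W])
qed

lemma convolution_integration_by_parts:
  assumes f: "f \<in> L2" "f' \<in> L2" and g: "g \<in> test_functions UNIV" "g' \<in> test_functions UNIV"
    and i: "i \<in> Basis"
  shows "L2_inner (convolution f g) (convolution f' (partial_deriv i g'))
    = - L2_inner (convolution f (partial_deriv i g)) (convolution f' g')"
proof -
  let ?V = "convolution f g" and ?W = "convolution f' g'"
  let ?V' = "convolution f (partial_deriv i g)" and ?W' = "convolution f' (partial_deriv i g')"
  have conv_L2: "convolution F G \<in> L2" "convolution F G \<in> borel_measurable borel"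
    "(\<lambda>x. convolution F G (x + a)) \<in> L2" "difference_quotient i h (convolution F G) \<in> L2"
    if "F \<in> L2" "G \<in> test_functions UNIV" for F :: "'a \<Rightarrow> complex" and G a h
  proof -
    have G: "G \<in> Cc" by (rule test_functions_imp_Cc[OF that(2)])
    show "convolution F G \<in> L2" by (rule convolution_Young(1)[OF that(1) G])
    show "convolution F G \<in> borel_measurable borel"
      by (rule convolution_borel[OF L2_imp_locally_integrable[OF that(1)] G])
    show shift: "(\<lambda>x. convolution F G (x + a)) \<in> L2" for a
      using convolution_Young(1)[OF that(1) Cc_translate[OF G]]
      by (simp add: convolution_translate_right[abs_def])
    show "difference_quotient i h (convolution F G) \<in> L2"
      unfolding difference_quotient_def[abs_def] using shift[of 0]
      by (intro L2_scaleR L2_diff shift) simp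
  qed
  note V = conv_L2[OF f(1) g(1)] and W = conv_L2[OF f(2) g(2)]
  note V'_L2 = conv_L2(1)[OF f(1) partial_deriv_test_functions[OF g(1) i]]
    and W'_L2 = conv_L2(1)[OF f(2) partial_deriv_test_functions[OF g(2) i]]
  have "((\<lambda>h. L2_inner ?V (difference_quotient i h ?W)) \<longlongrightarrow> L2_inner ?V ?W') (at 0)"
    by (intro L2_inner_tendsto W'_L2 V(1) always_eventually allI W(4)
        difference_quotient_convolution_tendsto[OF f(2) g(2) i])
  moreover have "((\<lambda>h. - L2_inner ?W (difference_quotient i (- h) ?V)) \<longlongrightarrow> - L2_inner ?W ?V') (at 0)"
  proof (rule tendsto_minus, rule filterlim_compose[of _ _ "at 0" uminus])
    show "((\<lambda>h. L2_inner ?W (difference_quotient i h ?V)) \<longlongrightarrow> L2_inner ?W ?V') (at 0)"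
      by (intro L2_inner_tendsto V'_L2 W(1) always_eventually allI V(4)
          difference_quotient_convolution_tendsto[OF f(1) g(1) i])
    show "filterlim uminus (at 0) (at (0::real))" by (simp add: filterlim_def filtermap_at_minus)
  qed
  ultimately show ?thesis
    unfolding L2_inner_difference_quotient[OF V(1,2) W(1,2) V(3) W(3)] L2_inner_commute[of ?W]
    by (rule tendsto_unique[OF trivial_limit_at])
qed

lemma convolution_laplacian_nonpos:
  assumes f: "f \<in> L2" and \<rho>: "\<rho> \<in> test_functions UNIV"
  shows "L2_inner (convolution f \<rho>) (convolution f (laplacian \<rho>)) \<le> 0"
proof -
  let ?d2 = "\<lambda>i. partial_deriv i (partial_deriv i \<rho>)"
  have Cc: "?d2 i \<in> Cc" if "i \<in> Basis" for i
    using that by (intro test_functions_imp_Cc[of _ UNIV] partial_deriv_test_functions \<rho>)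
  have "convolution f (laplacian \<rho>) = (\<lambda>x. \<Sum>i\<in>Basis. convolution f (?d2 i) x)"
    unfolding laplacian_def[abs_def]
    by (intro ext convolution_sum_right L2_imp_locally_integrable f Cc)
  then have "L2_inner (convolution f \<rho>) (convolution f (laplacian \<rho>))
      = (\<Sum>i\<in>Basis. L2_inner (convolution f \<rho>) (convolution f (?d2 i)))"
    using L2_inner_sum_right
      [OF convolution_Young(1)[OF f test_functions_imp_Cc[OF \<rho>]],
        of Basis "\<lambda>i. convolution f (?d2 i)"]
    by (simp add: convolution_Young(1) f Cc)
  also have "\<dots> = (\<Sum>i\<in>Basis. - (L2_norm (convolution f (partial_deriv i \<rho>)))\<^sup>2)"
    by (intro sum.cong refl)
       (simp add: convolution_integration_by_parts[OF f f \<rho>] partial_deriv_test_functions \<rho>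
           L2_inner_self)
  also have "\<dots> \<le> 0" by (simp add: sum_nonpos)
  finally show ?thesis .
qed


section \<open>From distributional solutions to integral identities\<close>

lemma friedrichs_mollifier_test_functions: "friedrichs_mollifier \<psi> \<Longrightarrow> \<psi> \<in> test_functions UNIV"
  by (simp add: friedrichs_mollifier_def)

text \<open>The restriction of \<open>\<psi>\<close> to a line through a point where it does not vanish, normalised.\<close>

lemma friedrichs_mollifier_real_exists:
  fixes \<psi> :: "'a::euclidean_space \<Rightarrow> real"
  assumes \<psi>: "friedrichs_mollifier \<psi>"
  obtains \<theta> :: "real \<Rightarrow> real" where "friedrichs_mollifier \<theta>"
proof -
  have \<psi>_smooth: "smooth \<psi>" and \<psi>_Cc: "\<psi> \<in> Cc" and \<psi>_nonneg: "\<And>x. 0 \<le> \<psi> x"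
    using \<psi> by (simp_all add: friedrichs_mollifier_def test_functions_UNIV_iff)
  have "\<psi> \<noteq> (\<lambda>x. 0)" using \<psi> by (auto simp: friedrichs_mollifier_def)
  then obtain a where a: "\<psi> a \<noteq> 0" by (auto simp: fun_eq_iff)
  obtain e :: 'a where e: "e \<in> Basis" using nonempty_Basis by blast
  define \<beta> where "\<beta> s = \<psi> (a + s *\<^sub>R e)" for s :: real
  have \<beta>_smooth: "smooth \<beta>"
    unfolding \<beta>_def[abs_def] by (intro smooth_compose_affine bounded_linear_scaleR_left \<psi>_smooth)
  obtain R where R: "\<And>x. R < norm x \<Longrightarrow> \<psi> x = 0" using Cc_vanish[OF \<psi>_Cc] by blast
  have \<beta>_Cc: "\<beta> \<in> Cc"
  proof (rule CcI[OF smooth_imp_continuous[OF \<beta>_smooth]])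
    fix s :: real assume "R + norm a < norm s"
    then show "\<beta> s = 0"
      unfolding \<beta>_def using norm_diff_ineq[of "s *\<^sub>R e" a] e by (intro R) (simp add: add.commute)
  qed
  define I where "I = (LINT s|lebesgue. \<beta> s)"
  have I_pos: "0 < I"
    unfolding I_def by (rule Cc_integral_pos[OF \<beta>_Cc, of 0]) (use \<psi>_nonneg a in \<open>auto simp: \<beta>_def\<close>)
  have "(\<lambda>s. inverse I * \<beta> s) \<in> test_functions UNIV"
    using Cc_scaleR[OF \<beta>_Cc, of "inverse I"]
    by (simp add: test_functions_UNIV_iff smooth_cmult \<beta>_smooth)
  moreover have "(LINT s|lebesgue. inverse I * \<beta> s) = 1" using I_pos by (simp add: I_def)
  ultimately have "friedrichs_mollifier (\<lambda>s. inverse I * \<beta> s)"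
    using I_pos \<psi>_nonneg by (simp add: friedrichs_mollifier_def \<beta>_def)
  then show ?thesis by (rule that)
qed

lemma smooth_has_real_derivative:
  fixes f :: "real \<Rightarrow> real"
  assumes "smooth f"
  shows "(f has_real_derivative partial_deriv 1 f x) (at x)"
proof -
  obtain d where "(f has_real_derivative d) (at x)"
    using smooth_imp_differentiable[OF assms]
    by (auto simp: differentiable_on_def real_differentiable_def)
  then show ?thesis using partial_deriv_real_eq by blast
qed

lemma lebesgue_integral_eq_integral_Icc:
  fixes f :: "real \<Rightarrow> 'b::euclidean_space"
  assumes "continuous_on {a..b} f" and vanish: "\<And>s. s \<notin> {a..b} \<Longrightarrow> f s = 0"
  shows "(LINT s|lebesgue. f s) = integral {a..b} f"
proof -
  have "(LINT s:{a..b}|lebesgue. f s) = integral {a..b} f"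
    by (intro set_lebesgue_integral_eq_integral absolutely_integrable_continuous_real assms)
  moreover have "indicator {a..b} s *\<^sub>R f s = f s" for s
    using vanish[of s] by (cases "s \<in> {a..b}") simp_all
  ultimately show ?thesis by (simp only: set_lebesgue_integral_def)
qed

lemma test_function_antiderivative:
  fixes \<kappa> :: "real \<Rightarrow> real"
  assumes \<kappa>: "smooth \<kappa>" and vanish: "\<And>s. s \<notin> {a..b} \<Longrightarrow> \<kappa> s = 0"
    and mean: "(LINT s|lebesgue. \<kappa> s) = 0" and sub: "{a..b} \<subseteq> \<Omega>"
  obtains \<eta> where "\<eta> \<in> test_functions \<Omega>" "partial_deriv 1 \<eta> = \<kappa>"
proof -
  define \<eta> where "\<eta> s = integral {a - 1..s} \<kappa>" for s
  have cont: "continuous_on S \<kappa>" for S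
    using smooth_imp_continuous[OF \<kappa>] continuous_on_subset by blast
  have left: "\<eta> s = 0" if "s < a" for s
    unfolding \<eta>_def using that vanish by (intro integral_unique has_integral_is_0) auto
  have right: "\<eta> s = 0" if "b < s" for s
  proof -
    have "\<kappa> r = 0" if "r \<notin> {a - 1..s}" for r using that \<open>b < s\<close> by (intro vanish) auto
    then show ?thesis using lebesgue_integral_eq_integral_Icc[OF cont] mean by (simp add: \<eta>_def)
  qed
  have deriv: "(\<eta> has_real_derivative \<kappa> s) (at s)" for s
  proof (cases "s < a")
    case True
    have "(\<eta> has_real_derivative 0) (at s)"
      by (rule has_field_derivative_transform_within_open[where f = "\<lambda>_. 0" and S = "{..<a}"])
         (use True left in auto)
    then show ?thesis using True vanish by simp
  next
    case False
    then have "(\<eta> has_real_derivative \<kappa> s) (at s within {a - 1..s + 1})"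
      unfolding \<eta>_def by (intro integral_has_real_derivative cont) auto
    then show ?thesis using False by (simp add: at_within_Icc_at)
  qed
  have "\<eta> \<in> test_functions \<Omega>"
    by (rule test_functionsI[OF smooth_antiderivative[OF deriv \<kappa>] compact_Icc sub])
       (use left right in fastforce)
  moreover have "partial_deriv 1 \<eta> = \<kappa>" using partial_deriv_real_eq[OF deriv] by blast
  ultimately show ?thesis by (rule that)
qed

definition weakly_constant :: "real \<Rightarrow> (real \<Rightarrow> complex) \<Rightarrow> bool" where
  "weakly_constant T p \<longleftrightarrow>
    (\<forall>\<eta>\<in>test_functions {0<..<T}. integral {0..T} (\<lambda>s. partial_deriv 1 \<eta> s *\<^sub>R p s) = 0)"

text \<open>The test function is the antiderivative of \<open>\<theta>\<^sub>c(a - \<cdot>) - \<theta>\<^sub>c(b - \<cdot>)\<close>.\<close>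

lemma mollify_eq_if_weakly_constant:
  fixes p :: "real \<Rightarrow> complex"
  assumes \<theta>: "mollifier \<theta> S" "smooth \<theta>" and p: "continuous_on UNIV p"
    and c_pos: "0 < c" and "a \<le> b" and sub: "{a - c * S..b + c * S} \<subseteq> {0<..<T}"
    and weak: "weakly_constant T p"
  shows "mollify \<theta> c p a = mollify \<theta> c p b"
proof -
  interpret mollifier \<theta> S by (rule \<theta>)
  define \<kappa> where "\<kappa> s = dilate \<theta> c (a - s) - dilate \<theta> c (b - s)" for s
  have D: "dilate \<theta> c \<in> Cc" by (rule dilate_Cc[OF Cc c_pos])
  have p_loc: "locally_integrable p" by (rule continuous_imp_locally_integrable[OF p])
  have smooth: "smooth \<kappa>"
    unfolding \<kappa>_def[abs_def] by (intro smooth_diff smooth_reflect smooth_dilate \<theta>)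
  have vanish: "\<kappa> s = 0" if "s \<notin> {a - c * S..b + c * S}" for s
  proof -
    have "c * S < norm (a - s)" "c * S < norm (b - s)" using that \<open>a \<le> b\<close> by (auto simp: abs_if)
    then show ?thesis by (simp add: \<kappa>_def dilate_vanish[OF c_pos])
  qed
  have mean: "(LINT s|lebesgue. \<kappa> s) = 0"
    unfolding \<kappa>_def using Cc_integrable[OF Cc_reflect[OF D]]
    by (simp add: integral_dilate_reflect[OF c_pos])
  obtain \<eta> where \<eta>: "\<eta> \<in> test_functions {0<..<T}" "partial_deriv 1 \<eta> = \<kappa>"
    by (rule test_function_antiderivative[OF smooth vanish mean sub])
  have "mollify \<theta> c p a - mollify \<theta> c p b = (LINT s|lebesgue. \<kappa> s *\<^sub>R p s)"
    unfolding convolution_eq_pairing \<kappa>_def[abs_def]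
      pairing_diff_left[OF Cc_reflect[OF D] Cc_reflect[OF D] p_loc, symmetric]
    by (simp add: pairing_def)
  also have "\<dots> = integral {0..T} (\<lambda>s. \<kappa> s *\<^sub>R p s)"
  proof (rule lebesgue_integral_eq_integral_Icc)
    show "continuous_on {0..T} (\<lambda>s. \<kappa> s *\<^sub>R p s)"
      using p smooth_imp_continuous[OF smooth]
      by (intro continuous_on_scaleR) (auto intro: continuous_on_subset)
    fix s assume "s \<notin> {0..T}"
    then have "s \<notin> {a - c * S..b + c * S}" using subsetD[OF sub, of s] by auto
    then show "\<kappa> s *\<^sub>R p s = 0" by (simp add: vanish)
  qed
  also have "\<dots> = 0" using weak \<eta> by (auto simp: weakly_constant_def)
  finally show ?thesis by simp
qed

lemma weakly_constant_interior:
  fixes p :: "real \<Rightarrow> complex" and \<theta> :: "real \<Rightarrow> real"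
  assumes \<theta>: "friedrichs_mollifier \<theta>" and p: "continuous_on UNIV p"
    and weak: "weakly_constant T p"
    and ab: "0 < a" "a < b" "b < T"
  shows "p a = p b"
proof -
  obtain S where moll: "mollifier \<theta> S" using friedrichs_mollifier_imp_mollifier[OF \<theta>] by blast
  interpret mollifier \<theta> S by (rule moll)
  have smooth: "smooth \<theta>"
    by (rule test_functions_smooth[OF friedrichs_mollifier_test_functions[OF \<theta>]])
  define d where "d = min a (T - b) / S"
  have "0 < d" using ab radius_pos by (simp add: d_def)
  have "mollify \<theta> c p a = mollify \<theta> c p b" if c_small: "0 < c" "c < d" for c
  proof (rule mollify_eq_if_weakly_constant[OF moll smooth p c_small(1) _ _ weak])
    have "c * S < min a (T - b)" using c_small radius_pos by (simp add: d_def field_simps)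
    then show "{a - c * S..b + c * S} \<subseteq> {0<..<T}" by auto
  qed (use ab in simp)
  then have "\<forall>\<^sub>F c in at_right 0. mollify \<theta> c p a = mollify \<theta> c p b"
    unfolding eventually_at_right_field using \<open>0 < d\<close> by blast
  from Lim_transform_eventually[OF mollify_tendsto_pointwise[OF p] this]
  show ?thesis
    using tendsto_unique[OF trivial_limit_at_right_real] mollify_tendsto_pointwise[OF p] by blast
qed

lemma du_Bois_Reymond_constant:
  fixes p :: "real \<Rightarrow> complex" and \<theta> :: "real \<Rightarrow> real"
  assumes \<theta>: "friedrichs_mollifier \<theta>" and T_pos: "0 < T" and p: "continuous_on {0..T} p"
    and weak: "weakly_constant T p"
    and t: "t \<in> {0..T}"
  shows "p t = p 0"
proof -
  define p' where "p' = ext_cont p 0 T"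
  have p'_eq: "p' s = p s" if "s \<in> {0..T}" for s using that by (simp add: p'_def)
  have p'_cont: "continuous_on UNIV p'"
    unfolding p'_def using p by (intro continuous_on_ext_cont) simp
  have "integral {0..T} (\<lambda>s. f s *\<^sub>R p' s) = integral {0..T} (\<lambda>s. f s *\<^sub>R p s)"
    for f :: "real \<Rightarrow> real"
    by (intro Henstock_Kurzweil_Integration.integral_cong) (simp add: p'_eq)
  then have p'_weak: "weakly_constant T p'" using weak by (simp add: weakly_constant_def)
  have interior: "p a = p b" if "0 < a" "a < b" "b < T" for a b
    using weakly_constant_interior[OF \<theta> p'_cont p'_weak that] that by (simp add: p'_eq)
  have "p s = p (T / 2)" if "s \<in> {0<..<T}" for s
  proof (cases s "T / 2" rule: linorder_cases)
    case less
    then show ?thesis using that by (intro interior) auto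
  next
    case equal
    then show ?thesis by (rule arg_cong)
  next
    case greater
    then show ?thesis using that T_pos by (intro interior[symmetric]) auto
  qed
  moreover have "closure {0<..<T} = {0..T}" using T_pos by simp
  ultimately have "p s = p (T / 2)" if "s \<in> {0..T}" for s
    using continuous_constant_on_closure[of "{0<..<T}" p "p (T / 2)" s] p that by metis
  from this[OF t] this[of 0] show ?thesis using T_pos by simp
qed

lemma integral_by_parts_test_function:
  fixes G g :: "real \<Rightarrow> complex"
  assumes \<eta>: "\<eta> \<in> test_functions {a<..<b}" and "a \<le> b"
    and G: "continuous_on {a..b} G" and g: "continuous_on {a..b} g"
    and deriv: "\<And>s. s \<in> {a<..<b} \<Longrightarrow> (G has_vector_derivative g s) (at s)"
  shows "((\<lambda>s. partial_deriv 1 \<eta> s *\<^sub>R G s) has_integral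
      - integral {a..b} (\<lambda>s. \<eta> s *\<^sub>R g s)) {a..b}"
proof (rule integration_by_parts_interior[OF bounded_bilinear_scaleR \<open>a \<le> b\<close> _ G _ deriv])
  note smooth = test_functions_smooth[OF \<eta>]
  show cont: "continuous_on {a..b} \<eta>"
    using smooth_imp_continuous[OF smooth] by (auto intro: continuous_on_subset)
  show "(\<eta> has_vector_derivative partial_deriv 1 \<eta> s) (at s)" for s
    using smooth_has_real_derivative[OF smooth]
    by (simp add: has_real_derivative_iff_has_vector_derivative)
  have "a \<notin> supp \<eta>" "b \<notin> supp \<eta>" using \<eta> by (auto simp: test_functions_def)
  then have boundary: "\<eta> a = 0" "\<eta> b = 0" by (simp_all add: zero_outside_supp)
  show "((\<lambda>s. \<eta> s *\<^sub>R g s) has_integral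
      \<eta> b *\<^sub>R G b - \<eta> a *\<^sub>R G a - - integral {a..b} (\<lambda>s. \<eta> s *\<^sub>R g s)) {a..b}"
    using integrable_integral[OF integrable_continuous_real[OF continuous_on_scaleR[OF cont g]]]
    by (simp add: boundary)
qed

lemma du_Bois_Reymond:
  fixes m g :: "real \<Rightarrow> complex" and \<theta> :: "real \<Rightarrow> real"
  assumes \<theta>: "friedrichs_mollifier \<theta>" and T_pos: "0 < T"
    and m: "continuous_on {0..T} m" and g: "continuous_on {0..T} g"
    and weak: "\<And>\<eta>. \<eta> \<in> test_functions {0<..<T} \<Longrightarrow>
      integral {0..T} (\<lambda>s. partial_deriv 1 \<eta> s *\<^sub>R m s + \<eta> s *\<^sub>R g s) = 0"
    and t: "t \<in> {0..T}"
  shows "m t - m 0 = integral {0..t} g"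
proof -
  define G where "G s = integral {0..s} g" for s
  have G_cont: "continuous_on {0..T} G"
    unfolding G_def by (intro indefinite_integral_continuous_1 integrable_continuous_real g)
  have G_deriv: "(G has_vector_derivative g s) (at s)" if "s \<in> {0<..<T}" for s
    using integral_has_vector_derivative[OF g, of s] that
    by (simp add: G_def[abs_def] at_within_Icc_at)
  have "m t - G t = m 0 - G 0"
  proof (rule du_Bois_Reymond_constant[OF \<theta> T_pos _ _ t])
    show "continuous_on {0..T} (\<lambda>s. m s - G s)" by (intro continuous_on_diff m G_cont)
    show "weakly_constant T (\<lambda>s. m s - G s)"
      unfolding weakly_constant_def
    proof
      fix \<eta> :: "real \<Rightarrow> real" assume \<eta>: "\<eta> \<in> test_functions {0<..<T}"
      note smooth = test_functions_smooth[OF \<eta>]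
      have integrable: "(\<lambda>s. \<eta> s *\<^sub>R g s) integrable_on {0..T}"
        "(\<lambda>s. partial_deriv 1 \<eta> s *\<^sub>R m s) integrable_on {0..T}"
        using smooth_imp_continuous[OF smooth]
          smooth_imp_continuous[OF smooth_partial_deriv[OF smooth, of 1]]
        by (auto intro!: integrable_continuous_real continuous_on_scaleR m g
            intro: continuous_on_subset)
      have "((\<lambda>s. partial_deriv 1 \<eta> s *\<^sub>R G s) has_integral
        - integral {0..T} (\<lambda>s. \<eta> s *\<^sub>R g s)) {0..T}"
        using T_pos by (intro integral_by_parts_test_function \<eta> G_cont g G_deriv) auto
      from has_integral_diff[OF integrable_integral[OF integrable(2)] this]
      have "integral {0..T} (\<lambda>s. partial_deriv 1 \<eta> s *\<^sub>R (m s - G s))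
          = integral {0..T} (\<lambda>s. partial_deriv 1 \<eta> s *\<^sub>R m s) + integral {0..T} (\<lambda>s. \<eta> s *\<^sub>R g s)"
        by (simp add: scaleR_diff_right integral_unique)
      also have "\<dots> = integral {0..T} (\<lambda>s. partial_deriv 1 \<eta> s *\<^sub>R m s + \<eta> s *\<^sub>R g s)"
        by (rule Henstock_Kurzweil_Integration.integral_add[OF integrable(2,1), symmetric])
      finally show "integral {0..T} (\<lambda>s. partial_deriv 1 \<eta> s *\<^sub>R (m s - G s)) = 0"
        using weak[OF \<eta>] by simp
    qed
  qed
  then show ?thesis by (simp add: G_def algebra_simps)
qed

definition weak_heat_solution ::
  "real \<Rightarrow> (real \<Rightarrow> 'a::euclidean_space \<Rightarrow> complex) \<Rightarrow> (real \<Rightarrow> 'a \<Rightarrow> complex) \<Rightarrow> bool" where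
  "weak_heat_solution T F v \<longleftrightarrow> v \<in> CL2 T \<and> F \<in> CL2 T \<and>
    (\<forall>\<rho>\<in>test_functions UNIV. \<forall>t\<in>{0..T}. pairing \<rho> (v t) - pairing \<rho> (v 0)
      = integral {0..t} (\<lambda>s. pairing (laplacian \<rho>) (v s) + pairing \<rho> (F s)))"

abbreviation heat_adjoint ::
  "('a::euclidean_space \<Rightarrow> real) \<Rightarrow> (real \<times> 'a \<Rightarrow> real) \<Rightarrow> real \<Rightarrow> 'a \<Rightarrow> real" where
  "heat_adjoint q \<phi> t x \<equiv> - dt \<phi> (t, x) - laplace \<phi> (t, x) - q x * \<phi> (t, x)"

lemma pairing_heat_adjoint_tensor:
  assumes \<eta>: "smooth \<eta>" and \<rho>: "\<rho> \<in> test_functions UNIV"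
    and f: "locally_integrable f" and qf: "locally_integrable (\<lambda>x. q x *\<^sub>R f x)"
  shows "(LINT x|lebesgue. heat_adjoint q (tensor \<eta> \<rho>) s x *\<^sub>R f x)
    = - (partial_deriv 1 \<eta> s *\<^sub>R pairing \<rho> f
         + \<eta> s *\<^sub>R (pairing (laplacian \<rho>) f + pairing \<rho> (\<lambda>x. q x *\<^sub>R f x)))"
proof -
  note \<rho>_smooth = test_functions_smooth[OF \<rho>] and \<rho>_Cc = test_functions_imp_Cc[OF \<rho>]
  have "heat_adjoint q (tensor \<eta> \<rho>) s x *\<^sub>R f x
      = - partial_deriv 1 \<eta> s *\<^sub>R (\<rho> x *\<^sub>R f x)
        - \<eta> s *\<^sub>R (laplacian \<rho> x *\<^sub>R f x) - \<eta> s *\<^sub>R (\<rho> x *\<^sub>R (q x *\<^sub>R f x))" for x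
    by (simp add: dt_tensor[OF \<eta> \<rho>_smooth] laplace_tensor[OF \<eta> \<rho>_smooth] tensor_def scaleR_diff_left
        mult_ac)
  then show ?thesis
    using integrable_scaleR_Cc[OF \<rho>_Cc f] integrable_scaleR_Cc[OF laplacian_Cc[OF \<rho>] f]
      integrable_scaleR_Cc[OF \<rho>_Cc qf]
    by (simp add: pairing_def scaleR_add_right del: scaleR_scaleR)
qed

lemma cauchy_solution_imp_weak_heat_solution:
  fixes u :: "real \<Rightarrow> 'a::euclidean_space \<Rightarrow> complex" and \<psi> :: "'a \<Rightarrow> real"
  assumes \<psi>: "friedrichs_mollifier \<psi>" and T_pos: "0 < T" and q: "q \<in> Linf"
    and sol: "cauchy_solution T q u0 u"
  shows "weak_heat_solution T (\<lambda>t x. q x *\<^sub>R u t x) u"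
  unfolding weak_heat_solution_def
proof (intro conjI ballI)
  show u: "u \<in> CL2 T" using sol by (simp add: cauchy_solution_def)
  show qu: "(\<lambda>t x. q x *\<^sub>R u t x) \<in> CL2 T" by (rule CL2_mult_Linf[OF q u])
  fix \<rho> :: "'a \<Rightarrow> real" and t assume \<rho>: "\<rho> \<in> test_functions UNIV" and t: "t \<in> {0..T}"
  obtain \<theta> :: "real \<Rightarrow> real" where \<theta>: "friedrichs_mollifier \<theta>"
    by (rule friedrichs_mollifier_real_exists[OF \<psi>])
  let ?m = "\<lambda>s. pairing \<rho> (u s)"
    and ?g = "\<lambda>s. pairing (laplacian \<rho>) (u s) + pairing \<rho> (\<lambda>x. q x *\<^sub>R u s x)"
  have m: "continuous_on {0..T} ?m" by (intro continuous_on_pairing u test_functions_imp_Cc[OF \<rho>])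
  have g: "continuous_on {0..T} ?g"
    by (intro continuous_on_add continuous_on_pairing u qu laplacian_Cc \<rho>
        test_functions_imp_Cc[OF \<rho>])
  show "?m t - ?m 0 = integral {0..t} ?g"
  proof (rule du_Bois_Reymond[OF \<theta> T_pos m g _ t])
    fix \<eta> :: "real \<Rightarrow> real" assume \<eta>: "\<eta> \<in> test_functions {0<..<T}"
    note \<eta>_smooth = test_functions_smooth[OF \<eta>]
    let ?k = "\<lambda>s. partial_deriv 1 \<eta> s *\<^sub>R ?m s + \<eta> s *\<^sub>R ?g s"
    have "continuous_on {0..T} ?k"
      using smooth_imp_continuous[OF \<eta>_smooth]
        smooth_imp_continuous[OF smooth_partial_deriv[OF \<eta>_smooth, of 1]]
      by (intro continuous_on_add continuous_on_scaleR m g) (auto intro: continuous_on_subset)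
    then have "set_integrable lebesgue {0<..<T} ?k"
      by (rule set_integrable_subset[OF absolutely_integrable_continuous_real]) auto
    then have "integral {0..T} ?k = (LINT s:{0<..<T}|lebesgue. ?k s)"
      by (simp add: set_lebesgue_integral_eq_integral(2) integral_open_interval_real)
    also have "\<dots> = (LINT s:{0<..<T}|lebesgue. - (LINT x|lebesgue.
        heat_adjoint q (tensor \<eta> \<rho>) s x *\<^sub>R u s x))"
    proof (intro set_lebesgue_integral_cong allI impI)
      fix s assume "s \<in> {0<..<T}"
      then have "locally_integrable (u s)" "locally_integrable (\<lambda>x. q x *\<^sub>R u s x)"
        using CL2_imp_L2[OF u] CL2_imp_L2[OF qu] by (auto intro: L2_imp_locally_integrable)
      then show "?k s = - (LINT x|lebesgue.
          heat_adjoint q (tensor \<eta> \<rho>) s x *\<^sub>R u s x)"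
        by (simp add: pairing_heat_adjoint_tensor[OF \<eta>_smooth \<rho>])
    qed simp
    also have "\<dots> = 0"
      using sol tensor_test_functions[OF \<eta> \<rho>]
      by (simp add: cauchy_solution_def set_lebesgue_integral_def)
    finally show "integral {0..T} ?k = 0" .
  qed
qed

lemma weak_heat_solution_mono: "weak_heat_solution T F v \<Longrightarrow> t \<le> T \<Longrightarrow> weak_heat_solution t F v"
  by (auto simp: weak_heat_solution_def intro: CL2_mono)

lemma weak_heat_solution_diff:
  assumes v: "weak_heat_solution T F v" and w: "weak_heat_solution T G w"
  shows "weak_heat_solution T (\<lambda>t x. F t x - G t x) (\<lambda>t x. v t x - w t x)"
  unfolding weak_heat_solution_def
proof (intro conjI ballI)
  have CL2: "v \<in> CL2 T" "w \<in> CL2 T" "F \<in> CL2 T" "G \<in> CL2 T"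
    using v w by (auto simp: weak_heat_solution_def)
  then show "(\<lambda>t x. v t x - w t x) \<in> CL2 T" "(\<lambda>t x. F t x - G t x) \<in> CL2 T"
    by (auto intro: CL2_diff)
  fix \<rho> :: "'a \<Rightarrow> real" and t assume \<rho>: "\<rho> \<in> test_functions UNIV" and t: "t \<in> {0..T}"
  note Cc = test_functions_imp_Cc[OF \<rho>] laplacian_Cc[OF \<rho>]
  have diff: "pairing g (\<lambda>x. f s x - h s x) = pairing g (f s) - pairing g (h s)"
    if "g \<in> Cc" "f \<in> CL2 T" "h \<in> CL2 T" "s \<in> {0..T}" for g s and f h :: "real \<Rightarrow> 'a \<Rightarrow> complex"
    using that by (intro pairing_diff_right L2_imp_locally_integrable CL2_imp_L2)
  let ?rhs = "\<lambda>F v s. pairing (laplacian \<rho>) (v s) + pairing \<rho> (F s)"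
  have rhs: "?rhs F v integrable_on {0..t}" if "F \<in> CL2 T" "v \<in> CL2 T" for F v
    using t that Cc
    by (intro integrable_continuous_real continuous_on_add continuous_on_pairing
        CL2_mono[where t = t]) auto
  have "pairing \<rho> (\<lambda>x. v t x - w t x) - pairing \<rho> (\<lambda>x. v 0 x - w 0 x)
      = (pairing \<rho> (v t) - pairing \<rho> (v 0)) - (pairing \<rho> (w t) - pairing \<rho> (w 0))"
    using t by (simp add: diff Cc CL2)
  also have "\<dots> = integral {0..t} (?rhs F v) - integral {0..t} (?rhs G w)"
    using v w \<rho> t by (simp add: weak_heat_solution_def)
  also have "\<dots> = integral {0..t} (\<lambda>s. ?rhs F v s - ?rhs G w s)"
    by (intro Henstock_Kurzweil_Integration.integral_diff[symmetric] rhs CL2)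
  also have "\<dots> = integral {0..t} (?rhs (\<lambda>t x. F t x - G t x) (\<lambda>t x. v t x - w t x))"
    using t by (intro Henstock_Kurzweil_Integration.integral_cong) (simp add: diff Cc CL2)
  finally show "pairing \<rho> (\<lambda>x. v t x - w t x) - pairing \<rho> (\<lambda>x. v 0 x - w 0 x)
      = integral {0..t} (?rhs (\<lambda>t x. F t x - G t x) (\<lambda>t x. v t x - w t x))" .
qed


section \<open>The energy estimate\<close>

lemma continuous_on_slice:
  assumes "continuous_on (A \<times> UNIV) (\<lambda>(t, x). f t x)"
  shows "continuous_on A (\<lambda>t. f t x)"
  using continuous_on_compose2[OF assms
    continuous_on_Pair[OF continuous_on_id continuous_on_const, of A x]] by auto

lemma measurable_indicator_mult_continuous_on_Icc_times:
  fixes f :: "real \<Rightarrow> 'a::euclidean_space \<Rightarrow> real"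
  assumes "continuous_on ({a..b} \<times> UNIV) (\<lambda>(s, x). f s x)"
  shows "(\<lambda>(s, x). indicator {a..b} s * f s x) \<in> borel_measurable (lborel \<Otimes>\<^sub>M lebesgue)"
proof -
  have "{a..b} \<times> (UNIV :: 'a set) \<in> sets borel" by (intro borel_closed closed_Times) auto
  then have cut: "(\<lambda>z. indicator ({a..b} \<times> UNIV) z *\<^sub>R (case z of (s, x) \<Rightarrow> f s x))
    \<in> borel_measurable (borel \<Otimes>\<^sub>M borel)"
    unfolding borel_prod using assms by (rule borel_measurable_continuous_on_indicator)
  have "(\<lambda>z. (fst z, snd z))
    \<in> (lborel :: real measure) \<Otimes>\<^sub>M (lebesgue :: 'a measure) \<rightarrow>\<^sub>M borel \<Otimes>\<^sub>M borel"
    by (intro measurable_Pair measurable_compose[OF measurable_fst]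
        measurable_compose[OF measurable_snd]
        ident_measurable_lebesgue_borel) simp
  from measurable_compose[OF this cut] show ?thesis by (simp add: split_beta indicator_times)
qed

lemma lborel_integral_indicator_Icc:
  fixes f :: "real \<Rightarrow> real"
  assumes "continuous_on {a..b} f"
  shows "integrable lborel (\<lambda>s. indicator {a..b} s * f s)"
    and "(LINT s|lborel. indicator {a..b} s * f s) = integral {a..b} f"
  using borel_integrable_atLeastAtMost'[OF assms] set_borel_integral_eq_integral(2)[of "{a..b}" f]
  by (simp_all add: set_integrable_def set_lebesgue_integral_def)

lemma pair_sigma_finite_lborel_lebesgue: "pair_sigma_finite lborel lebesgue"
  by (simp add: pair_sigma_finite_def sigma_finite_lebesgue sigma_finite_lborel)

lemma integrable_inner_CL2:
  fixes V G :: "real \<Rightarrow> 'a::euclidean_space \<Rightarrow> complex"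
  assumes V: "V \<in> CL2 T" "continuous_on ({0..T} \<times> UNIV) (\<lambda>(t, x). V t x)"
    and G: "G \<in> CL2 T" "continuous_on ({0..T} \<times> UNIV) (\<lambda>(t, x). G t x)"
  shows "integrable (lborel \<Otimes>\<^sub>M lebesgue) (\<lambda>(s, x). indicator {0..T} s * (V s x \<bullet> G s x))"
proof -
  interpret pair_sigma_finite "lborel :: real measure" "lebesgue :: 'a measure"
    by (rule pair_sigma_finite_lborel_lebesgue)
  let ?H = "\<lambda>(s, x). indicator {0..T} s * (V s x \<bullet> G s x)"
  have meas: "?H \<in> borel_measurable (lborel \<Otimes>\<^sub>M lebesgue)"
    using continuous_on_inner[OF V(2) G(2)]
    by (intro measurable_indicator_mult_continuous_on_Icc_times) (simp add: split_beta)
  show ?thesis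
  proof (rule Fubini_integrable[OF meas])
    show "AE s in lborel. integrable lebesgue (\<lambda>x. ?H (s, x))"
      using integrable_inner_L2(1)[OF CL2_imp_L2[OF V(1)] CL2_imp_L2[OF G(1)]]
      by (intro AE_I2) (simp add: indicator_def)
    let ?N = "\<lambda>s. LINT x|lebesgue. norm (?H (s, x))"
    show "integrable lborel ?N"
    proof (rule Bochner_Integration.integrable_bound)
      show "integrable lborel (\<lambda>s. indicator {0..T} s * (L2_norm (V s) * L2_norm (G s)))"
        by (intro lborel_integral_indicator_Icc continuous_on_mult continuous_on_L2_norm V G)
      show "?N \<in> borel_measurable lborel"
        using meas
        by (intro sigma_finite_measure.borel_measurable_lebesgue_integral[OF sigma_finite_lebesgue])
           (simp add: split_beta')
      have "norm (?N s) \<le> norm (indicator {0..T} s * (L2_norm (V s) * L2_norm (G s)))" for s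
        using integrable_inner_L2(2)[OF CL2_imp_L2[OF V(1)] CL2_imp_L2[OF G(1)], of s s]
        by (simp add: indicator_def)
      then show "AE s in lborel. norm (?N s)
        \<le> norm (indicator {0..T} s * (L2_norm (V s) * L2_norm (G s)))"
        by simp
    qed
  qed
qed

lemma integral_inner_swap_CL2:
  fixes V G :: "real \<Rightarrow> 'a::euclidean_space \<Rightarrow> complex"
  assumes V: "V \<in> CL2 T" "continuous_on ({0..T} \<times> UNIV) (\<lambda>(t, x). V t x)"
    and G: "G \<in> CL2 T" "continuous_on ({0..T} \<times> UNIV) (\<lambda>(t, x). G t x)"
  shows "(LINT x|lebesgue. integral {0..T} (\<lambda>s. V s x \<bullet> G s x))
      = integral {0..T} (\<lambda>s. L2_inner (V s) (G s))"
proof -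
  interpret pair_sigma_finite "lborel :: real measure" "lebesgue :: 'a measure"
    by (rule pair_sigma_finite_lborel_lebesgue)
  have "(LINT x|lebesgue. integral {0..T} (\<lambda>s. V s x \<bullet> G s x))
      = (LINT x|lebesgue. LINT s|lborel. indicator {0..T} s * (V s x \<bullet> G s x))"
    by (simp add: lborel_integral_indicator_Icc(2) continuous_on_inner continuous_on_slice[OF V(2)]
        continuous_on_slice[OF G(2)])
  also have "\<dots> = (LINT s|lborel. LINT x|lebesgue. indicator {0..T} s * (V s x \<bullet> G s x))"
    by (rule Fubini_integral[OF integrable_inner_CL2[OF V G]])
  also have "\<dots> = (LINT s|lborel. indicator {0..T} s * L2_inner (V s) (G s))"
    by (simp add: L2_inner_def)
  also have "\<dots> = integral {0..T} (\<lambda>s. L2_inner (V s) (G s))"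
    by (intro lborel_integral_indicator_Icc(2) continuous_on_L2_inner V G)
  finally show ?thesis .
qed

lemma norm_power2_diff_eq_integral:
  fixes y g :: "real \<Rightarrow> 'b::euclidean_space"
  assumes g: "continuous_on {0..T} g" and "0 \<le> T"
    and y: "\<And>t. t \<in> {0..T} \<Longrightarrow> y t = y 0 + integral {0..t} g"
  shows "(norm (y T))\<^sup>2 - (norm (y 0))\<^sup>2 = 2 * integral {0..T} (\<lambda>s. y s \<bullet> g s)"
proof -
  have "(y has_vector_derivative g t) (at t within {0..T})" if t: "t \<in> {0..T}" for t
  proof -
    have "((\<lambda>t. y 0 + integral {0..t} g) has_vector_derivative 0 + g t) (at t within {0..T})"
      by (intro has_vector_derivative_add has_vector_derivative_const integral_has_vector_derivative
          g t)
    then have "((\<lambda>t. y 0 + integral {0..t} g) has_vector_derivative g t) (at t within {0..T})"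
      by simp
    then show ?thesis by (rule has_vector_derivative_transform[OF t y, rotated])
  qed
  from bounded_bilinear.has_vector_derivative[OF bounded_bilinear_inner this this]
  have "((\<lambda>s. y s \<bullet> y s) has_vector_derivative 2 * (y t \<bullet> g t)) (at t within {0..T})"
    if "t \<in> {0..T}" for t
    using that by (simp add: inner_commute)
  then have "((\<lambda>s. 2 * (y s \<bullet> g s)) has_integral (y T \<bullet> y T - y 0 \<bullet> y 0)) {0..T}"
    using \<open>0 \<le> T\<close> by (intro fundamental_theorem_of_calculus) auto
  from integral_unique[OF this] show ?thesis by (simp add: power2_norm_eq_inner)
qed

lemma L2_energy_identity:
  fixes V G :: "real \<Rightarrow> 'a::euclidean_space \<Rightarrow> complex"
  assumes V: "V \<in> CL2 T" "continuous_on ({0..T} \<times> UNIV) (\<lambda>(t, x). V t x)"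
    and G: "G \<in> CL2 T" "continuous_on ({0..T} \<times> UNIV) (\<lambda>(t, x). G t x)" and T_nonneg: "0 \<le> T"
    and evolution: "\<And>t x. t \<in> {0..T} \<Longrightarrow> V t x = V 0 x + integral {0..t} (\<lambda>s. G s x)"
  shows "(L2_norm (V T))\<^sup>2 - (L2_norm (V 0))\<^sup>2 = 2 * integral {0..T} (\<lambda>s. L2_inner (V s) (G s))"
proof -
  have "(L2_norm (V T))\<^sup>2 - (L2_norm (V 0))\<^sup>2
    = (LINT x|lebesgue. (norm (V T x))\<^sup>2 - (norm (V 0 x))\<^sup>2)"
    using T_nonneg by (simp add: L2_norm_power2 L2_integrable CL2_imp_L2[OF V(1)])
  also have "\<dots> = (LINT x|lebesgue. 2 * integral {0..T} (\<lambda>s. V s x \<bullet> G s x))"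
    by (simp only: norm_power2_diff_eq_integral[OF continuous_on_slice[OF G(2)] T_nonneg evolution])
  also have "\<dots> = 2 * integral {0..T} (\<lambda>s. L2_inner (V s) (G s))"
    by (simp add: integral_inner_swap_CL2[OF V G])
  finally show ?thesis .
qed

lemma mollified_weak_heat_solution:
  assumes sol: "weak_heat_solution T F v" and \<rho>: "\<rho> \<in> test_functions UNIV" and t: "t \<in> {0..T}"
  shows "convolution (v t) \<rho> x = convolution (v 0) \<rho> x
    + integral {0..t} (\<lambda>s. convolution (v s) (laplacian \<rho>) x + convolution (F s) \<rho> x)"
proof -
  have "pairing (\<lambda>y. \<rho> (x - y)) (v t) - pairing (\<lambda>y. \<rho> (x - y)) (v 0)
      = integral {0..t}
        (\<lambda>s. pairing (laplacian (\<lambda>y. \<rho> (x - y))) (v s) + pairing (\<lambda>y. \<rho> (x - y)) (F s))"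
    using sol t test_functions_reflect[OF \<rho>] by (simp add: weak_heat_solution_def)
  moreover have "laplacian (\<lambda>y. \<rho> (x - y)) = (\<lambda>y. laplacian \<rho> (x - y))"
    using laplacian_reflect[OF test_functions_smooth[OF \<rho>]] by blast
  ultimately show ?thesis by (simp add: convolution_eq_pairing algebra_simps)
qed

lemma L2_inner_mollified_heat_le:
  fixes f h :: "'a::euclidean_space \<Rightarrow> complex"
  assumes f: "f \<in> L2" and h: "h \<in> L2"
    and \<rho>: "\<rho> \<in> test_functions UNIV" and mass: "(LINT x|lebesgue. \<bar>\<rho> x\<bar>) = 1"
  shows "L2_inner (convolution f \<rho>) (\<lambda>x. convolution f (laplacian \<rho>) x + convolution h \<rho> x)
    \<le> L2_norm f * L2_norm h"
proof -
  note Cc = test_functions_imp_Cc[OF \<rho>] laplacian_Cc[OF \<rho>]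
  note young = convolution_Young[OF f Cc(1)] convolution_Young[OF h Cc(1)]
  have "L2_inner (convolution f \<rho>) (\<lambda>x. convolution f (laplacian \<rho>) x + convolution h \<rho> x)
      = L2_inner (convolution f \<rho>) (convolution f (laplacian \<rho>))
        + L2_inner (convolution f \<rho>) (convolution h \<rho>)"
    by (intro L2_inner_add_right young convolution_Young(1)[OF f Cc(2)])
  also have "\<dots> \<le> L2_norm (convolution f \<rho>) * L2_norm (convolution h \<rho>)"
    using convolution_laplacian_nonpos[OF f \<rho>] abs_L2_inner_le[OF young(1,3)] by linarith
  also have "\<dots> \<le> L2_norm f * L2_norm h"
    using young(2,4) by (intro mult_mono) (simp_all add: mass)
  finally show ?thesis .
qed

lemma mollified_energy_inequality:
  fixes v F :: "real \<Rightarrow> 'a::euclidean_space \<Rightarrow> complex"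
  assumes sol: "weak_heat_solution T F v" and T_nonneg: "0 \<le> T"
    and \<rho>: "\<rho> \<in> test_functions UNIV" and mass: "(LINT x|lebesgue. \<bar>\<rho> x\<bar>) = 1"
  shows "(L2_norm (convolution (v T) \<rho>))\<^sup>2
    \<le> (L2_norm (v 0))\<^sup>2 + 2 * integral {0..T} (\<lambda>s. L2_norm (v s) * L2_norm (F s))"
proof -
  have CL2: "v \<in> CL2 T" "F \<in> CL2 T" using sol by (simp_all add: weak_heat_solution_def)
  note L2 = CL2_imp_L2[OF CL2(1)] CL2_imp_L2[OF CL2(2)]
  note Cc = test_functions_imp_Cc[OF \<rho>] laplacian_Cc[OF \<rho>]
  let ?V = "\<lambda>s. convolution (v s) \<rho>"
  let ?G = "\<lambda>s x. convolution (v s) (laplacian \<rho>) x + convolution (F s) \<rho> x"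
  have V: "?V \<in> CL2 T" "continuous_on ({0..T} \<times> UNIV) (\<lambda>(s, x). ?V s x)"
    by (intro CL2_convolution continuous_on_convolution_CL2 Cc CL2)+
  have G: "?G \<in> CL2 T" by (intro CL2_add CL2_convolution Cc CL2)
  have G_cont: "continuous_on ({0..T} \<times> UNIV) (\<lambda>(s, x). ?G s x)"
    using continuous_on_add[OF continuous_on_convolution_CL2[OF CL2(1) Cc(2)]
      continuous_on_convolution_CL2[OF CL2(2) Cc(1)]]
    by (simp add: split_beta)
  have "(L2_norm (?V T))\<^sup>2 = (L2_norm (?V 0))\<^sup>2 + 2 * integral {0..T} (\<lambda>s. L2_inner (?V s) (?G s))"
    using L2_energy_identity[OF V G G_cont T_nonneg mollified_weak_heat_solution[OF sol \<rho>]] by simp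
  also have "\<dots> \<le> (L2_norm (v 0))\<^sup>2 + 2 * integral {0..T} (\<lambda>s. L2_norm (v s) * L2_norm (F s))"
  proof (intro add_mono power_mono mult_left_mono integral_le)
    show "L2_norm (?V 0) \<le> L2_norm (v 0)"
      using convolution_Young(2)[OF L2(1)[of 0] Cc(1)] T_nonneg by (simp add: mass)
    show "(\<lambda>s. L2_inner (?V s) (?G s)) integrable_on {0..T}"
      by (intro integrable_continuous_real continuous_on_L2_inner V G)
    show "(\<lambda>s. L2_norm (v s) * L2_norm (F s)) integrable_on {0..T}"
      by (intro integrable_continuous_real continuous_on_mult continuous_on_L2_norm CL2)
  qed (use L2_inner_mollified_heat_le[OF L2 \<rho> mass] in simp_all)
  finally show ?thesis .
qed

lemma energy_inequality:
  fixes v F :: "real \<Rightarrow> 'a::euclidean_space \<Rightarrow> complex" and \<psi> :: "'a \<Rightarrow> real"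
  assumes \<psi>: "friedrichs_mollifier \<psi>" and sol: "weak_heat_solution T F v" and T_nonneg: "0 \<le> T"
  shows "(L2_norm (v T))\<^sup>2
      \<le> (L2_norm (v 0))\<^sup>2 + 2 * integral {0..T} (\<lambda>s. L2_norm (v s) * L2_norm (F s))"
proof -
  obtain S where "mollifier \<psi> S" using friedrichs_mollifier_imp_mollifier[OF \<psi>] by blast
  then interpret mollifier \<psi> S .
  have vT: "v T \<in> L2" using sol T_nonneg by (auto simp: weak_heat_solution_def intro: CL2_imp_L2)
  have pos: "\<forall>\<^sub>F c in at_right (0::real). 0 < c" by (rule eventually_at_right_less)
  have "((\<lambda>c. (L2_norm (mollify \<psi> c (v T)))\<^sup>2) \<longlongrightarrow> (L2_norm (v T))\<^sup>2) (at_right 0)"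
    using pos
    by (intro tendsto_power L2_norm_tendsto[OF vT _ L2_mollify_tendsto[OF vT]])
       (auto elim!: eventually_mono intro: L2_mollify vT)
  moreover have "\<forall>\<^sub>F c in at_right 0. (L2_norm (mollify \<psi> c (v T)))\<^sup>2
      \<le> (L2_norm (v 0))\<^sup>2 + 2 * integral {0..T} (\<lambda>s. L2_norm (v s) * L2_norm (F s))"
    using pos
  proof eventually_elim
    case (elim c)
    then show ?case
      using friedrichs_mollifier_test_functions[OF \<psi>]
      by (intro mollified_energy_inequality[OF sol T_nonneg] dilate_test_functions
          integral_abs_dilate)
  qed
  ultimately show ?thesis by (rule tendsto_upperbound) simp
qed


section \<open>Stability and convergence\<close>

lemma Gronwall_integral:
  fixes y :: "real \<Rightarrow> real"
  assumes y: "continuous_on {0..T} y" and A_nonneg: "0 \<le> A"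
    and bound: "\<And>t. t \<in> {0..T} \<Longrightarrow> y t \<le> a + A * integral {0..t} y" and t: "t \<in> {0..T}"
  shows "y t \<le> a * exp (A * t)"
proof -
  define z where "z s = a + A * integral {0..s} y" for s
  have z_cont: "continuous_on {0..T} z"
    unfolding z_def
    by (intro continuous_intros indefinite_integral_continuous_1 integrable_continuous_real y)
  have z_deriv: "(z has_real_derivative A * y s) (at s)" if "0 < s" "s < T" for s
  proof -
    have "((\<lambda>s. integral {0..s} y) has_real_derivative y s) (at s)"
      using integral_has_real_derivative[OF y, of s] that by (simp add: at_within_Icc_at)
    then show ?thesis unfolding z_def by (auto intro!: derivative_eq_intros)
  qed
  have "exp (- A * t) * z t \<le> exp (- A * 0) * z 0"
  proof (rule DERIV_nonpos_imp_decreasing_open[of 0 t "\<lambda>s. exp (- A * s) * z s"])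
    show "continuous_on {0..t} (\<lambda>s. exp (- A * s) * z s)"
      using t by (intro continuous_intros continuous_on_subset[OF z_cont]) auto
    fix s assume s: "0 < s" "s < t"
    have "((\<lambda>s. exp (- A * s) * z s) has_real_derivative exp (- A * s) * (A * (y s - z s))) (at s)"
      using z_deriv[of s] s t by (auto intro!: derivative_eq_intros simp: algebra_simps)
    moreover have "exp (- A * s) * (A * (y s - z s)) \<le> 0"
      using bound[of s] s t A_nonneg by (intro mult_nonneg_nonpos) (auto simp: z_def)
    ultimately show "\<exists>d. ((\<lambda>s. exp (- A * s) * z s) has_real_derivative d) (at s) \<and> d \<le> 0" by blast
  qed (use t in simp)
  then have "z t \<le> a * exp (A * t)" by (simp add: z_def exp_minus field_simps)
  then show ?thesis using bound[OF t] by (simp add: z_def)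
qed

lemma Gronwall_integral_forcing:
  fixes y b :: "real \<Rightarrow> real"
  assumes y: "continuous_on {0..T} y" and b: "continuous_on {0..T} b" "\<And>s. 0 \<le> b s"
    and A_nonneg: "0 \<le> A" and a_nonneg: "0 \<le> a"
    and bound: "\<And>t. t \<in> {0..T} \<Longrightarrow> y t \<le> a + integral {0..t} (\<lambda>s. A * y s + b s)" and t: "t \<in> {0..T}"
  shows "y t \<le> (a + integral {0..T} b) * exp (A * T)"
proof -
  have b_int: "b integrable_on {0..T}" by (intro integrable_continuous_real b)
  have "y t \<le> (a + integral {0..T} b) * exp (A * t)"
  proof (rule Gronwall_integral[OF y A_nonneg _ t])
    fix t assume t: "t \<in> {0..T}"
    then have sub: "{0..t} \<subseteq> {0..T}" by auto
    have integrable: "y integrable_on {0..t}" "b integrable_on {0..t}"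
      by (intro integrable_continuous_real continuous_on_subset[OF _ sub] y b)+
    have "y t \<le> a + integral {0..t} (\<lambda>s. A * y s + b s)" by (rule bound[OF t])
    also have "integral {0..t} (\<lambda>s. A * y s + b s) = A * integral {0..t} y + integral {0..t} b"
      using integrable_on_mult_right[OF integrable(1), of A] integrable(2)
      by (simp add: Henstock_Kurzweil_Integration.integral_add)
    also have "integral {0..t} b \<le> integral {0..T} b"
      by (intro integral_subset_le sub integrable b_int ballI b)
    finally show "y t \<le> a + integral {0..T} b + A * integral {0..t} y" by simp
  qed
  also have "\<dots> \<le> (a + integral {0..T} b) * exp (A * T)"
    using t A_nonneg a_nonneg Henstock_Kurzweil_Integration.integral_nonneg[OF b_int b(2)]
    by (intro mult_left_mono) (auto simp: mult_left_mono)
  finally show ?thesis .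
qed

lemma weak_heat_solution_Gronwall:
  fixes v F :: "real \<Rightarrow> 'a::euclidean_space \<Rightarrow> complex" and \<psi> :: "'a \<Rightarrow> real"
  assumes \<psi>: "friedrichs_mollifier \<psi>" and sol: "weak_heat_solution T F v" and M_nonneg: "0 \<le> M"
    and e: "continuous_on {0..T} e"
    and F_le: "\<And>s. s \<in> {0..T} \<Longrightarrow> L2_norm (F s) \<le> M * L2_norm (v s) + e s"
    and t: "t \<in> {0..T}"
  shows "(L2_norm (v t))\<^sup>2
      \<le> ((L2_norm (v 0))\<^sup>2 + integral {0..T} (\<lambda>s. (e s)\<^sup>2)) * exp ((2 * M + 1) * T)"
proof (rule Gronwall_integral_forcing[OF _ _ _ _ _ _ t])
  have CL2: "v \<in> CL2 T" "F \<in> CL2 T" using sol by (simp_all add: weak_heat_solution_def)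
  let ?b = "\<lambda>s. (2 * M + 1) * (L2_norm (v s))\<^sup>2 + (e s)\<^sup>2"
  have product_le: "2 * (L2_norm (v s) * L2_norm (F s)) \<le> ?b s" if "s \<in> {0..T}" for s
  proof -
    have "2 * (L2_norm (v s) * L2_norm (F s)) \<le> 2 * (L2_norm (v s) * (M * L2_norm (v s) + e s))"
      by (intro mult_left_mono F_le that) simp_all
    also have "\<dots> = 2 * M * (L2_norm (v s))\<^sup>2 + 2 * L2_norm (v s) * e s"
      by (simp add: power2_eq_square algebra_simps)
    also have "\<dots> \<le> ?b s"
      using sum_squares_bound[of "L2_norm (v s)" "e s"] by (simp add: algebra_simps)
    finally show ?thesis .
  qed
  show "continuous_on {0..T} (\<lambda>s. (L2_norm (v s))\<^sup>2)" "continuous_on {0..T} (\<lambda>s. (e s)\<^sup>2)"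
    by (intro continuous_on_power continuous_on_L2_norm CL2 e)+
  fix t assume t: "t \<in> {0..T}"
  then have sub: "{0..t} \<subseteq> {0..T}" by auto
  have "(L2_norm (v t))\<^sup>2
    \<le> (L2_norm (v 0))\<^sup>2 + 2 * integral {0..t} (\<lambda>s. L2_norm (v s) * L2_norm (F s))"
    using t by (intro energy_inequality[OF \<psi>] weak_heat_solution_mono[OF sol]) auto
  also have "2 * integral {0..t} (\<lambda>s. L2_norm (v s) * L2_norm (F s))
      = integral {0..t} (\<lambda>s. 2 * (L2_norm (v s) * L2_norm (F s)))"
    by simp
  also have "\<dots> \<le> integral {0..t} ?b"
    using product_le sub
    by (intro integral_le integrable_continuous_real continuous_on_subset[OF _ sub]
        continuous_intros
        continuous_on_L2_norm CL2 e) auto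
  finally show "(L2_norm (v t))\<^sup>2 \<le> (L2_norm (v 0))\<^sup>2 + integral {0..t} ?b" by simp
qed (use M_nonneg in simp_all)

lemma cauchy_solution_stability:
  fixes u w :: "real \<Rightarrow> 'a::euclidean_space \<Rightarrow> complex" and \<psi> :: "'a \<Rightarrow> real"
  assumes \<psi>: "friedrichs_mollifier \<psi>" and T_pos: "0 < T"
    and u: "cauchy_solution T q u0 u" and w: "cauchy_solution T p w0 w"
    and q: "q \<in> Linf" and p: "p \<in> Linf" "Linf_norm p \<le> M" and u0: "u0 \<in> L2" and w0: "w0 \<in> L2"
    and t: "t \<in> {0..T}"
  shows "(L2_norm (\<lambda>x. w t x - u t x))\<^sup>2 \<le> ((L2_norm (\<lambda>x. w0 x - u0 x))\<^sup>2
    + integral {0..T} (\<lambda>s. (L2_norm (\<lambda>x. (p x - q x) *\<^sub>R u s x))\<^sup>2)) * exp ((2 * M + 1) * T)"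
proof -
  have CL2: "u \<in> CL2 T" "w \<in> CL2 T" using u w by (simp_all add: cauchy_solution_def)
  have sol: "weak_heat_solution T (\<lambda>s x. p x *\<^sub>R w s x - q x *\<^sub>R u s x) (\<lambda>s x. w s x - u s x)"
    by (intro weak_heat_solution_diff cauchy_solution_imp_weak_heat_solution[OF \<psi> T_pos _ w]
        cauchy_solution_imp_weak_heat_solution[OF \<psi> T_pos _ u] p q)
  have initial: "L2_norm (\<lambda>x. w 0 x - u 0 x) = L2_norm (\<lambda>x. w0 x - u0 x)"
  proof (rule L2_norm_cong_AE)
    show "(\<lambda>x. w 0 x - u 0 x) \<in> borel_measurable lebesgue"
      "(\<lambda>x. w0 x - u0 x) \<in> borel_measurable lebesgue"
      using T_pos
      by (intro L2_measurable L2_diff CL2_imp_L2[OF CL2(1)] CL2_imp_L2[OF CL2(2)] w0 u0; simp)+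
    have "AE x in lebesgue. w 0 x = w0 x" "AE x in lebesgue. u 0 x = u0 x"
      using u w by (auto simp: cauchy_solution_def)
    then show "AE x in lebesgue. w 0 x - u 0 x = w0 x - u0 x" by eventually_elim simp
  qed
  show ?thesis
    unfolding initial[symmetric]
  proof (rule weak_heat_solution_Gronwall[OF \<psi> sol _ _ _ t])
    show "0 \<le> M" using Linf_norm_nonneg[OF p(1)] p(2) by simp
    show "continuous_on {0..T} (\<lambda>s. L2_norm (\<lambda>x. (p x - q x) *\<^sub>R u s x))"
      by (intro continuous_on_L2_norm CL2_mult_Linf Linf_diff p q CL2)
    fix s assume s: "s \<in> {0..T}"
    have "Linf_norm p * L2_norm (\<lambda>x. w s x - u s x) \<le> M * L2_norm (\<lambda>x. w s x - u s x)"
      by (intro mult_right_mono p L2_norm_nonneg)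
    then show "L2_norm (\<lambda>x. p x *\<^sub>R w s x - q x *\<^sub>R u s x)
        \<le> M * L2_norm (\<lambda>x. w s x - u s x) + L2_norm (\<lambda>x. (p x - q x) *\<^sub>R u s x)"
      using L2_norm_mult_diff_le[OF p(1) q CL2_imp_L2[OF CL2(2) s] CL2_imp_L2[OF CL2(1) s]] by simp
  qed
qed

context mollifier
begin

lemma integral_mollify_mult_tendsto:
  fixes u :: "real \<Rightarrow> 'a \<Rightarrow> complex"
  assumes q: "q \<in> Linf" and u: "u \<in> CL2 T"
  shows "((\<lambda>c. integral {0..T} (\<lambda>s. (L2_norm (\<lambda>x. (mollify \<psi> c q x - q x) *\<^sub>R u s x))\<^sup>2)) \<longlongrightarrow> 0)
    (at_right 0)"
proof (rule tendsto_at_right_sequentially[OF zero_less_one])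
  fix c :: "nat \<Rightarrow> real" assume c_seq: "\<And>n. 0 < c n" "c \<longlonglongrightarrow> 0"
  let ?m = "\<lambda>n x. mollify \<psi> (c n) q x - q x"
  define e where "e n s = L2_norm (\<lambda>x. ?m n x *\<^sub>R u s x)" for n s
  obtain B where B: "\<And>s. s \<in> {0..T} \<Longrightarrow> L2_norm (u s) \<le> B" using CL2_bounded[OF u] by blast
  have m: "?m n \<in> Linf" "Linf_norm (?m n) \<le> 2 * Linf_norm q" for n
    using Linf_diff[OF Linf_mollify(1)[OF q c_seq(1)] q, of n] Linf_mollify(2)[OF q c_seq(1), of n]
    by auto
  have "(\<lambda>n. integral {0..T} (\<lambda>s. (e n s)\<^sup>2)) \<longlonglongrightarrow> integral {0..T} (\<lambda>_. 0)"
  proof (rule dominated_convergence(2)[where h = "\<lambda>_. (2 * Linf_norm q * B)\<^sup>2"])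
    show "(\<lambda>s. (e n s)\<^sup>2) integrable_on {0..T}" for n
      unfolding e_def
      by (intro integrable_continuous_real continuous_on_power continuous_on_L2_norm CL2_mult_Linf
          m u)
    show "norm ((e n s)\<^sup>2) \<le> (2 * Linf_norm q * B)\<^sup>2" if s: "s \<in> {0..T}" for n s
    proof -
      have "e n s \<le> Linf_norm (?m n) * L2_norm (u s)"
        unfolding e_def by (rule L2_mult_Linf(2)[OF m(1) CL2_imp_L2[OF u s]])
      also have "\<dots> \<le> 2 * Linf_norm q * B"
        by (intro mult_mono m(2) B s) (simp_all add: Linf_norm_nonneg q)
      finally show ?thesis by (simp add: power_mono e_def)
    qed
    show "(\<lambda>n. (e n s)\<^sup>2) \<longlonglongrightarrow> 0" if s: "s \<in> {0..T}" for s
    proof -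
      have "filterlim c (at_right 0) sequentially"
        using c_seq by (simp add: filterlim_at less_imp_neq[THEN not_sym])
      from filterlim_compose[OF L2_mollify_mult_tendsto[OF q CL2_imp_L2[OF u s]] this]
      show ?thesis unfolding e_def by (rule tendsto_null_power) simp
    qed
  qed auto
  then show "(\<lambda>n. integral {0..T} (\<lambda>s. (L2_norm (\<lambda>x. ?m n x *\<^sub>R u s x))\<^sup>2)) \<longlonglongrightarrow> 0"
    by (simp add: e_def)
qed

lemma mollified_cauchy_solutions_tendsto:
  fixes u :: "real \<Rightarrow> 'a \<Rightarrow> complex"
  assumes \<psi>: "friedrichs_mollifier \<psi>" and T_pos: "0 < T" and q: "q \<in> Linf" and u0: "u0 \<in> L2"
    and u: "cauchy_solution T q u0 u" and c_lim: "filterlim c (at_right 0) F"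
    and w: "\<forall>\<^sub>F i in F. cauchy_solution T (mollify \<psi> (c i) q) (mollify \<psi> (c i) u0) (w i)"
    and t: "t \<in> {0..T}"
  shows "((\<lambda>i. L2_norm (\<lambda>x. w i t x - u t x)) \<longlongrightarrow> 0) F"
proof -
  have uC: "u \<in> CL2 T" using u by (simp add: cauchy_solution_def)
  define error where "error c = ((L2_norm (\<lambda>x. mollify \<psi> c u0 x - u0 x))\<^sup>2
    + integral {0..T} (\<lambda>s. (L2_norm (\<lambda>x. (mollify \<psi> c q x - q x) *\<^sub>R u s x))\<^sup>2))
    * exp ((2 * Linf_norm q + 1) * T)" for c
  have "(error \<longlongrightarrow> 0) (at_right 0)"
    unfolding error_def
    by (intro tendsto_mult_left_zero tendsto_add_zero tendsto_null_power L2_mollify_tendsto[OF u0]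
        integral_mollify_mult_tendsto[OF q uC]) simp
  from tendsto_real_sqrt[OF filterlim_compose[OF this c_lim]]
  have lim: "((\<lambda>i. sqrt (error (c i))) \<longlongrightarrow> 0) F" by simp
  have "\<forall>\<^sub>F i in F. 0 < c i" using c_lim by (auto simp: filterlim_at elim: eventually_mono)
  then have "\<forall>\<^sub>F i in F. norm (L2_norm (\<lambda>x. w i t x - u t x)) \<le> sqrt (error (c i))"
    using w
  proof eventually_elim
    case (elim i)
    have "(L2_norm (\<lambda>x. w i t x - u t x))\<^sup>2 \<le> error (c i)"
      unfolding error_def using elim
      by (intro cauchy_solution_stability[OF \<psi> T_pos u _ q _ _ u0 _ t] Linf_mollify L2_mollify q u0)
    then show ?case by (simp add: real_le_rsqrt)
  qed
  then show ?thesis using lim by (rule Lim_null_comparison)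
qed

end

lemma mollifier_scale_filterlim: "mollifier_scale \<omega> \<Longrightarrow> filterlim \<omega> (at_right 0) (at_right 0)"
  unfolding mollifier_scale_def filterlim_at eventually_at_right_field
  by (intro conjI exI[of _ 1]) force+

theorem theorem3p5:
  fixes T :: real
    and q :: "'a::euclidean_space \<Rightarrow> real"
    and u0 :: "'a \<Rightarrow> complex"
    and u :: "real \<Rightarrow> 'a \<Rightarrow> complex"
    and \<psi> :: "'a \<Rightarrow> real"
    and \<omega> :: "real \<Rightarrow> real"
    and q_net :: "real \<Rightarrow> 'a \<Rightarrow> real"
    and u0_net :: "real \<Rightarrow> 'a \<Rightarrow> complex"
    and u_net :: "real \<Rightarrow> real \<Rightarrow> 'a \<Rightarrow> complex"
  assumes "T > 0"
    and "u0 \<in> L2"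
    and "q \<in> Linf"
    and "AE x in lebesgue. q x \<ge> 0"
    and "cauchy_solution T q u0 u"
    and "friedrichs_mollifier \<psi>"
    and "mollifier_scale \<omega>"
    and "very_weak_solution T \<psi> \<omega> q u0 q_net u0_net u_net"
  shows "\<forall>t\<in>{0..T}. ((\<lambda>\<epsilon>. L2_norm (\<lambda>x. u_net \<epsilon> t x - u t x)) \<longlongrightarrow> 0) (at_right 0)"
proof
  fix t assume t: "t \<in> {0..T}"
  obtain S where "mollifier \<psi> S" using friedrichs_mollifier_imp_mollifier assms(6) by blast
  then interpret mollifier \<psi> S .
  have "cauchy_solution T (mollify \<psi> (\<omega> \<epsilon>) q) (mollify \<psi> (\<omega> \<epsilon>) u0) (u_net \<epsilon>)"
    if "\<epsilon> \<in> {0<..1}" for \<epsilon>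
    using assms(8) that
    by (auto simp: very_weak_solution_def regularising_family_def mollifier_net_eq_dilate)
  then have "\<forall>\<^sub>F \<epsilon> in at_right 0.
      cauchy_solution T (mollify \<psi> (\<omega> \<epsilon>) q) (mollify \<psi> (\<omega> \<epsilon>) u0) (u_net \<epsilon>)"
    unfolding eventually_at_right_field by (intro exI[of _ 1]) auto
  then show "((\<lambda>\<epsilon>. L2_norm (\<lambda>x. u_net \<epsilon> t x - u t x)) \<longlongrightarrow> 0) (at_right 0)"
    using t by (rule mollified_cauchy_solutions_tendsto
        [OF assms(6,1,3,2,5) mollifier_scale_filterlim[OF assms(7)]])
qed

end
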